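(* Let $\mathcal{G}$ be the collection of all hypergraphs $\Phi=(V,\mathscr{C})$ for which there exist a constant $\varepsilon\in(0,1)$ and a function $x:\mathscr{C}\to(0,1)$ such that \[ \forall C\in \mathscr{C}:\quad 2\lvert C\rvert\cdot 2^{-\lvert C\rvert}\le (1-\varepsilon)\cdot x(C)\cdot \prod_{C'\in\Gamma_{\Phi^2}(C)}(1-x(C')). \] There exists an algorithm which, given as input a hypergraph $\Phi\in\mathcal{G}$, outputs an independent set of $\Phi$ distributed exactly uniformly at random among all independent sets of $\Phi$, in expected time \[ O\left(-\frac{1}{\log(1-\varepsilon)}\cdot \log\Big(\sum_{C\in\mathscr{C}}\frac{x(C)}{1-x(C)}\Big)\cdot \sum_{C\in\mathscr{C}}\ \sum_{C'\in\mathscr{C}:\,C\cap C'\neq\emptyset}\lvert C'\rvert\,\lvert C\rvert\right). \]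
   Context: A hypergraph $\Phi=(V,\mathscr{C})$ consists of a finite vertex set $V$ and a collection $\mathscr{C}$ of nonempty subsets of $V$ (hyperedges). A set $S\subseteq V$ is an independent set of $\Phi$ if $C\not\subseteq S$ for every $C\in\mathscr{C}$. For $C\in\mathscr{C}$, $\Gamma^{+}_{\Phi^2}(C)$ is the set of hyperedges $C'\in\mathscr{C}$ such that either $C\cap C'\neq\emptyset$ or there exists $C^*\in\mathscr{C}$ with $C\cap C^*\neq\emptyset$ and $C^*\cap C'\neq\emptyset$; and $\Gamma_{\Phi^2}(C):=\Gamma^{+}_{\Phi^2}(C)\setminus\{C\}$ (the hyperedges within distance $2$ of $C$, excluding $C$).
   Formalization: In the time bound the logarithm of the sum is replaced by max(1, log), since the sum may be at most 1, and the number of vertices in no hyperedge plus 1 is added, since the stated formula ignores such vertices and vanishes when there are no hyperedges. *)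

theory Defs
  imports "HOL-Probability.Probability"
begin

section \<open>Hypergraphs\<close>

type_synonym 'a hypergraph = "'a set \<times> 'a set set"

abbreviation verts :: "'a hypergraph \<Rightarrow> 'a set" where "verts \<equiv> fst"
abbreviation edges :: "'a hypergraph \<Rightarrow> 'a set set" where "edges \<equiv> snd"

definition hypergraph :: "'a hypergraph \<Rightarrow> bool" where
  "hypergraph \<Phi> \<longleftrightarrow> finite (verts \<Phi>) \<and> (\<forall>C\<in>edges \<Phi>. C \<noteq> {} \<and> C \<subseteq> verts \<Phi>)"

definition independent_set :: "'a hypergraph \<Rightarrow> 'a set \<Rightarrow> bool" where
  "independent_set \<Phi> S \<longleftrightarrow> S \<subseteq> verts \<Phi> \<and> (\<forall>C\<in>edges \<Phi>. \<not> C \<subseteq> S)"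

definition closed_nbhd2 :: "'a hypergraph \<Rightarrow> 'a set \<Rightarrow> 'a set set" where
  "closed_nbhd2 \<Phi> C = {C'\<in>edges \<Phi>. C \<inter> C' \<noteq> {} \<or>
     (\<exists>D\<in>edges \<Phi>. C \<inter> D \<noteq> {} \<and> D \<inter> C' \<noteq> {})}"

definition nbhd2 :: "'a hypergraph \<Rightarrow> 'a set \<Rightarrow> 'a set set" where
  "nbhd2 \<Phi> C = closed_nbhd2 \<Phi> C - {C}"

definition lll_witness :: "'a hypergraph \<Rightarrow> real \<Rightarrow> ('a set \<Rightarrow> real) \<Rightarrow> bool" where
  "lll_witness \<Phi> \<epsilon> x \<longleftrightarrow>
     0 < \<epsilon> \<and> \<epsilon> < 1 \<and> (\<forall>C\<in>edges \<Phi>. 0 < x C \<and> x C < 1) \<and>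
     (\<forall>C\<in>edges \<Phi>. 2 * real (card C) * (1 / 2) ^ card C
        \<le> (1 - \<epsilon>) * x C * (\<Prod>C'\<in>nbhd2 \<Phi> C. 1 - x C'))"

definition lll_hypergraphs :: "'a hypergraph set" where
  "lll_hypergraphs = {\<Phi>. hypergraph \<Phi> \<and> (\<exists>\<epsilon> x. lll_witness \<Phi> \<epsilon> x)}"

text \<open>
  The logarithm is bounded below by 1: the sum may well be at most 1 (for a single
  hyperedge with x = 1/2 it equals 1), and then its logarithm is no bound on a running time.
\<close>
definition time_bound :: "'a hypergraph \<Rightarrow> real \<Rightarrow> ('a set \<Rightarrow> real) \<Rightarrow> real" where
  "time_bound \<Phi> \<epsilon> x =
     - (1 / ln (1 - \<epsilon>)) * max 1 (ln (\<Sum>C\<in>edges \<Phi>. x C / (1 - x C))) *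
     (\<Sum>C\<in>edges \<Phi>. \<Sum>C'\<in>{C'\<in>edges \<Phi>. C \<inter> C' \<noteq> {}}. real (card C') * real (card C))"

text \<open>Vertices invisible to \<open>time_bound\<close>; each still costs a coin flip and an output cell.\<close>
definition isolated_verts :: "'a hypergraph \<Rightarrow> 'a set" where
  "isolated_verts \<Phi> = verts \<Phi> - \<Union>(edges \<Phi>)"


section \<open>Randomized random access machines\<close>

text \<open>
  Uniform-cost RAM with registers, an indirectly addressed memory and a fair coin.
  Subtraction is truncated and there is no multiplication. The coin flips still to
  come are part of the state, so execution is deterministic once they are fixed.
\<close>

type_synonym state = "(nat \<Rightarrow> nat) \<times> (nat \<Rightarrow> nat) \<times> bool stream"

datatype instr =
    IConst nat nat
  | ICopy nat nat
  | IAdd nat nat nat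
  | ISub nat nat nat
  | ILoad nat nat
  | IStore nat nat
  | IFlip nat

datatype com =
    Instr instr
  | Seq com com
  | If_nz nat com com
  | While_nz nat com

fun instr_step :: "instr \<Rightarrow> state \<Rightarrow> state" where
  "instr_step (IConst r k) (\<rho>, \<mu>, \<omega>) = (\<rho>(r := k), \<mu>, \<omega>)"
| "instr_step (ICopy r a) (\<rho>, \<mu>, \<omega>) = (\<rho>(r := \<rho> a), \<mu>, \<omega>)"
| "instr_step (IAdd r a b) (\<rho>, \<mu>, \<omega>) = (\<rho>(r := \<rho> a + \<rho> b), \<mu>, \<omega>)"
| "instr_step (ISub r a b) (\<rho>, \<mu>, \<omega>) = (\<rho>(r := \<rho> a - \<rho> b), \<mu>, \<omega>)"
| "instr_step (ILoad r a) (\<rho>, \<mu>, \<omega>) = (\<rho>(r := \<mu> (\<rho> a)), \<mu>, \<omega>)"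
| "instr_step (IStore a b) (\<rho>, \<mu>, \<omega>) = (\<rho>, \<mu>(\<rho> a := \<rho> b), \<omega>)"
| "instr_step (IFlip r) (\<rho>, \<mu>, \<omega>) = (\<rho>(r := of_bool (shd \<omega>)), \<mu>, stl \<omega>)"

text \<open>\<open>exec c s t s'\<close>: started in \<open>s\<close>, the program \<open>c\<close> halts in \<open>s'\<close> after \<open>t\<close> steps;
  every instruction and every evaluation of a branch or loop condition is one step.\<close>
inductive exec :: "com \<Rightarrow> state \<Rightarrow> nat \<Rightarrow> state \<Rightarrow> bool" where
  Instr: "exec (Instr i) s 1 (instr_step i s)"
| Seq: "exec c\<^sub>1 s t\<^sub>1 s' \<Longrightarrow> exec c\<^sub>2 s' t\<^sub>2 s'' \<Longrightarrow> exec (Seq c\<^sub>1 c\<^sub>2) s (t\<^sub>1 + t\<^sub>2) s''"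
| If_True: "fst s r \<noteq> 0 \<Longrightarrow> exec c\<^sub>1 s t s' \<Longrightarrow> exec (If_nz r c\<^sub>1 c\<^sub>2) s (t + 1) s'"
| If_False: "fst s r = 0 \<Longrightarrow> exec c\<^sub>2 s t s' \<Longrightarrow> exec (If_nz r c\<^sub>1 c\<^sub>2) s (t + 1) s'"
| While_False: "fst s r = 0 \<Longrightarrow> exec (While_nz r c) s 1 s"
| While_True: "fst s r \<noteq> 0 \<Longrightarrow> exec c s t\<^sub>1 s' \<Longrightarrow> exec (While_nz r c) s' t\<^sub>2 s'' \<Longrightarrow>
    exec (While_nz r c) s (t\<^sub>1 + t\<^sub>2 + 1) s''"

inductive_cases exec_InstrE: "exec (Instr i) s t s'"
inductive_cases exec_SeqE: "exec (Seq c\<^sub>1 c\<^sub>2) s t s'"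
inductive_cases exec_IfE: "exec (If_nz r c\<^sub>1 c\<^sub>2) s t s'"
inductive_cases exec_WhileE: "exec (While_nz r c) s t s'"

lemma exec_deterministic:
  assumes "exec c s t s'" "exec c s u s''"
  shows "t = u \<and> s' = s''"
  using assms
proof (induction arbitrary: u s'' rule: exec.induct)
  case (Instr i s)
  from Instr.prems show ?case by (rule exec_InstrE) simp
next
  case (Seq c\<^sub>1 s t\<^sub>1 s1 c\<^sub>2 t\<^sub>2 s2)
  from Seq.prems show ?case by (rule exec_SeqE) (blast dest: Seq.IH)
next
  case (If_True s r c\<^sub>1 t s' c\<^sub>2)
  obtain v where "u = v + 1" "exec c\<^sub>1 s v s''"
    by (rule exec_IfE[OF If_True.prems]) (use If_True.hyps in simp_all)
  with If_True.IH[of v s''] show ?case by blast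
next
  case (If_False s r c\<^sub>2 t s' c\<^sub>1)
  obtain v where "u = v + 1" "exec c\<^sub>2 s v s''"
    by (rule exec_IfE[OF If_False.prems]) (use If_False.hyps in simp_all)
  with If_False.IH[of v s''] show ?case by blast
next
  case (While_False s r c)
  from While_False.prems show ?case by (rule exec_WhileE) (use While_False.hyps in simp_all)
next
  case (While_True s r c t\<^sub>1 s1 t\<^sub>2 s2)
  obtain v v' s1' where "u = v + v' + 1" "exec c s v s1'" "exec (While_nz r c) s1' v' s''"
    by (rule exec_WhileE[OF While_True.prems]) (use While_True.hyps in simp_all)
  with While_True.IH(1)[of v s1'] While_True.IH(2)[of v' s''] show ?case by blast
qed

definition init_state :: "nat list \<Rightarrow> bool stream \<Rightarrow> state" where
  "init_state xs \<omega> = (\<lambda>_. 0, \<lambda>a. if a < length xs then xs ! a else 0, \<omega>)"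

definition coin_space :: "bool stream measure" where
  "coin_space = stream_space (measure_pmf (bernoulli_pmf (1 / 2)))"

text \<open>The infimum over the empty set is \<open>\<infinity>\<close>, so a run that does not halt has infinite running time.\<close>
definition run_time :: "com \<Rightarrow> nat list \<Rightarrow> bool stream \<Rightarrow> ennreal" where
  "run_time P xs \<omega> = (INF t\<in>{t. \<exists>s. exec P (init_state xs \<omega>) t s}. of_nat t)"

definition expected_time :: "com \<Rightarrow> nat list \<Rightarrow> ennreal" where
  "expected_time P xs = (\<integral>\<^sup>+\<omega>. run_time P xs \<omega> \<partial>coin_space)"


section \<open>Hypergraphs as input, vertex sets as output\<close>

text \<open>
  The machine sees the vertices as indices into an enumeration \<open>vs\<close> of the vertex set,
  and each hyperedge as a list of such indices; the enumerations are arbitrary.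
\<close>
definition represents :: "'a list \<Rightarrow> nat list list \<Rightarrow> 'a hypergraph \<Rightarrow> bool" where
  "represents vs es \<Phi> \<longleftrightarrow>
     distinct vs \<and> set vs = verts \<Phi> \<and>
     (\<forall>e\<in>set es. distinct e \<and> set e \<subseteq> {..<length vs}) \<and>
     distinct (map set es) \<and>
     (\<lambda>e. (!) vs ` set e) ` set es = edges \<Phi>"

definition encode :: "nat \<Rightarrow> nat list list \<Rightarrow> nat list" where
  "encode n es = n # length es # concat (map (\<lambda>e. length e # e) es)"

text \<open>On halting, the first \<open>length vs\<close> memory cells hold the characteristic vector of the output.\<close>
definition output_set :: "'a list \<Rightarrow> state \<Rightarrow> 'a set" where
  "output_set vs s = {vs ! i |i. i < length vs \<and> fst (snd s) i \<noteq> 0}"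

definition output_prob :: "com \<Rightarrow> 'a list \<Rightarrow> nat list list \<Rightarrow> 'a set \<Rightarrow> real" where
  "output_prob P vs es S = measure coin_space
     {\<omega>. \<exists>t s. exec P (init_state (encode (length vs) es) \<omega>) t s \<and> output_set vs s = S}"

end

theory Submission imports Defs begin

text \<open>
  The sampler is coupling from the past for the Glauber dynamics with systematic scan, run with a pair
  of sets that bounds all trajectories from below and above; the number of scans is doubled until the
  two bounds meet. If they still differ after \<open>2 m\<close> scans, then following the disagreement backwards in
  time gives a walk through edges all of whose vertices drew heads at their last update. Jumping along
  the walk to the first edge that shares no update with the current one selects \<open>m\<close> edges with disjoint
  sets of updates, consecutive ones at distance at most two. An edge can be entered at \<open>2 |C|\<close> times,
  so by the local lemma condition the probability of such a chain is at most
  \<open>(1 - \<epsilon>)\<^sup>m (\<Sum>C. x C / (1 - x C))\<close>. Edge counters make a scan linear in the size of the hypergraph,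
  and \<open>- ln (1 - \<epsilon>) \<le> |C|\<close> for every edge, so that even a single scan stays within the time bound.
\<close>

section \<open>Fair coins\<close>

text \<open>Isolated vertices shape the construction: the time bound allows them one coin and one
  output cell each, so they cannot take part in a scan that is repeated. In the infinite schedule,
  whose index counts backwards in time, they occupy the first indices and are thus updated last; the
  cyclic scan of the remaining vertices lies behind them. The program flips their coins before
  anything else, so its coin stream, read in order, is the coin sequence of the schedule, and a
  longer horizon merely appends coins. Exactness and decay are proved for the schedule alone; the
  program is tied to it by computing the same bounding pair. Restarting is cheap because the
  expected cost is governed by the sum of \<open>2 ^ k\<close> times the failure probability of
  round \<open>k\<close>: once \<open>2 ^ k\<close> exceeds a multiple of the logarithmic ratio in
  the time bound, quadratic decay in \<open>2 ^ k\<close> suffices, and below that point the trivial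
  bound 1 does.\<close>

lemma prob_space_coin_space: "prob_space coin_space"
  unfolding coin_space_def by (rule prob_space.prob_space_stream_space) (rule measure_pmf.prob_space_axioms)

interpretation coin: prob_space coin_space
  by (rule prob_space_coin_space)

lemma space_coin_space [simp]: "space coin_space = UNIV"
  by (simp add: coin_space_def space_stream_space)

lemma sets_coin_space: "sets coin_space = sets (stream_space (count_space UNIV))"
  unfolding coin_space_def by (rule sets_stream_space_cong) simp

lemma stake_event: "{\<omega>. Q (stake k \<omega>)} \<in> sets coin_space"
proof -
  have "stake k -` {xs. Q xs} \<inter> space (stream_space (count_space UNIV)) \<in> sets (stream_space (count_space (UNIV :: bool set)))"
    by (rule measurable_sets[OF measurable_stake]) simp
  then show ?thesis by (simp add: sets_coin_space space_stream_space vimage_def)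
qed

text \<open>Phrased for coin sequences rather than streams because the dynamics read coins by index
  and are later shifted; \<open>snth\<close> passes from one to the other.\<close>

definition finitary :: "nat \<Rightarrow> ((nat \<Rightarrow> bool) \<Rightarrow> bool) \<Rightarrow> bool" where
  "finitary k Q \<longleftrightarrow> (\<forall>c c'. (\<forall>i<k. c i = c' i) \<longrightarrow> Q c = Q c')"

lemma finitary_event:
  assumes "finitary k Q" shows "{\<omega>. Q (snth \<omega>)} \<in> sets coin_space"
proof -
  \<comment> \<open>Access beyond the end of the list is unspecified, but finitariness makes
    \<open>Q\<close> blind to it.\<close>
  have "{\<omega>. Q (snth \<omega>)} = {\<omega>. (\<lambda>xs. Q ((!) xs)) (stake k \<omega>)}"
    by (intro Collect_cong assms[unfolded finitary_def, rule_format]) simp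
  then show ?thesis using stake_event[of "\<lambda>xs. Q ((!) xs)" k] by simp
qed

text \<open>Conditioning on the first coin, by the product structure of the stream space; this is
  the induction step both for \<open>coin_all_heads\<close> and for stationarity.\<close>

lemma coin_first_flip:
  assumes "{\<omega>. Q \<omega>} \<in> sets coin_space"
  shows "coin.prob {\<omega>. Q \<omega>} = (coin.prob {\<omega>. Q (True ## \<omega>)} + coin.prob {\<omega>. Q (False ## \<omega>)}) / 2"
proof -
  have "emeasure coin_space {\<omega>. Q \<omega>} =
      (\<integral>\<^sup>+t. emeasure coin_space {\<omega>. Q (t ## \<omega>)} \<partial>measure_pmf (bernoulli_pmf (1/2)))"
    using prob_space.emeasure_stream_space[OF measure_pmf.prob_space_axioms, of "{\<omega>. Q \<omega>}" "bernoulli_pmf (1/2)"] assms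
    by (simp add: coin_space_def space_stream_space)
  also have "\<dots> = ennreal (coin.prob {\<omega>. Q (True ## \<omega>)}) * ennreal (1/2) + ennreal (coin.prob {\<omega>. Q (False ## \<omega>)}) * ennreal (1/2)"
    by (simp add: coin.emeasure_eq_measure)
  also have "\<dots> = ennreal ((coin.prob {\<omega>. Q (True ## \<omega>)} + coin.prob {\<omega>. Q (False ## \<omega>)}) / 2)"
    by (simp only: ennreal_mult'[symmetric] ennreal_plus[symmetric] measure_nonneg mult_nonneg_nonneg add_divide_distrib
        times_divide_eq_right mult_1_right) simp
  finally show ?thesis by (simp add: coin.emeasure_eq_measure)
qed

text \<open>Independence of the coins in the form that the union bound needs. Induction on a bound
  for the positions: after the first flip the remaining positions move down by one.\<close>

lemma coin_all_heads:
  assumes "finite A" shows "coin.prob {\<omega>. \<forall>i\<in>A. \<omega> !! i} = (1/2) ^ card A"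
proof -
  have "A \<subseteq> {..<k} \<Longrightarrow> coin.prob {\<omega>. \<forall>i\<in>A. \<omega> !! i} = (1/2) ^ card A" for k
  proof (induction k arbitrary: A)
    case 0
    then show ?case using coin.prob_space by simp
  next
    case (Suc k)
    define A' where "A' = {i. Suc i \<in> A}"
    have fin: "finite A" using Suc.prems finite_subset by blast
    have A': "A' \<subseteq> {..<k}" using Suc.prems by (auto simp: A'_def)
    have card: "card A = card A' + of_bool (0 \<in> A)"
    proof -
      have "A = Suc ` A' \<union> (if 0 \<in> A then {0} else {})"
        by (auto simp: A'_def image_iff) (metis not0_implies_Suc)+
      moreover have "card (Suc ` A' \<union> (if 0 \<in> A then {0} else {})) = card A' + of_bool (0 \<in> A)"
        using A' finite_subset by (subst card_Un_disjoint) (auto simp: card_image)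
      ultimately show ?thesis by simp
    qed
    have ev: "{\<omega>. \<forall>i\<in>A. \<omega> !! i} \<in> sets coin_space"
      by (rule finitary_event[of "Suc k"]) (use Suc.prems in \<open>auto simp: finitary_def\<close>)
    have split: "(\<forall>i\<in>A. (b ## \<omega>) !! i) \<longleftrightarrow> (0 \<in> A \<longrightarrow> b) \<and> (\<forall>i\<in>A'. \<omega> !! i)" for b \<omega>
    proof
      assume "\<forall>i\<in>A. (b ## \<omega>) !! i"
      then show "(0 \<in> A \<longrightarrow> b) \<and> (\<forall>i\<in>A'. \<omega> !! i)" by (force simp: A'_def)
    next
      assume H: "(0 \<in> A \<longrightarrow> b) \<and> (\<forall>i\<in>A'. \<omega> !! i)"
      show "\<forall>i\<in>A. (b ## \<omega>) !! i"
      proof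
        fix i assume "i \<in> A"
        with H show "(b ## \<omega>) !! i" by (cases i) (auto simp: A'_def)
      qed
    qed
    show ?case
      unfolding coin_first_flip[OF ev] split using Suc.IH[OF A'] by (simp add: card)
  qed
  then show ?thesis using finite_nat_iff_bounded[of A] assms by metis
qed

section \<open>Glauber dynamics and its bounding chain\<close>

text \<open>The update of \<open>X\<close> at \<open>v\<close>, blocked by \<open>Z\<close>: the Glauber dynamics is the case \<open>Z = X\<close>,
  and since the update is antitone in \<open>Z\<close>, the bounding pair \<open>(L, U)\<close> blocks each other.\<close>
definition upd :: "'a set set \<Rightarrow> 'a \<Rightarrow> bool \<Rightarrow> 'a set \<Rightarrow> 'a set \<Rightarrow> 'a set" where
  "upd E v b Z X = (if b \<and> (\<forall>C\<in>E. v \<in> C \<longrightarrow> \<not> C - {v} \<subseteq> Z) then insert v X else X - {v})"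

text \<open>Index \<open>i\<close> stands for time \<open>-i\<close>: the updates \<open>i + k - 1, \<dots>, i\<close> are performed in this order.\<close>
fun sim :: "'a set set \<Rightarrow> (nat \<Rightarrow> 'a) \<Rightarrow> (nat \<Rightarrow> bool) \<Rightarrow> nat \<Rightarrow> nat \<Rightarrow> 'a set \<Rightarrow> 'a set" where
  "sim E \<sigma> c i 0 X = X"
| "sim E \<sigma> c i (Suc k) X = (let X' = sim E \<sigma> c (Suc i) k X in upd E (\<sigma> i) (c i) X' X')"

definition upd2 :: "'a set set \<Rightarrow> 'a \<Rightarrow> bool \<Rightarrow> 'a set \<times> 'a set \<Rightarrow> 'a set \<times> 'a set" where
  "upd2 E v b P = (upd E v b (snd P) (fst P), upd E v b (fst P) (snd P))"

fun bsim :: "'a set set \<Rightarrow> (nat \<Rightarrow> 'a) \<Rightarrow> (nat \<Rightarrow> bool) \<Rightarrow> nat \<Rightarrow> nat \<Rightarrow> 'a set \<times> 'a set \<Rightarrow> 'a set \<times> 'a set" where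
  "bsim E \<sigma> c i 0 P = P"
| "bsim E \<sigma> c i (Suc k) P = upd2 E (\<sigma> i) (c i) (bsim E \<sigma> c (Suc i) k P)"

text \<open>Larger indices lie further in the past, so the block behind \<open>i + k\<close> is the
  one performed first.\<close>

lemma bsim_append: "bsim E \<sigma> c i (k + l) P = bsim E \<sigma> c i k (bsim E \<sigma> c (i + k) l P)"
  by (induction k arbitrary: i) auto

lemma sim_shift: "sim E \<sigma> c (i + d) k X = sim E (\<lambda>j. \<sigma> (j + d)) (\<lambda>j. c (j + d)) i k X"
proof (induction k arbitrary: i)
  case (Suc k)
  show ?case using Suc.IH[of "Suc i"] by simp
qed simp

lemma bsim_shift: "bsim E \<sigma> c (i + d) k P = bsim E (\<lambda>j. \<sigma> (j + d)) (\<lambda>j. c (j + d)) i k P"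
proof (induction k arbitrary: i)
  case (Suc k)
  show ?case using Suc.IH[of "Suc i"] by simp
qed simp

lemma sim_cong: "(\<And>j. i \<le> j \<Longrightarrow> j < i + k \<Longrightarrow> c j = c' j) \<Longrightarrow> sim E \<sigma> c i k X = sim E \<sigma> c' i k X"
  by (induction k arbitrary: i) (auto simp: Let_def)

lemma bsim_cong: "(\<And>j. i \<le> j \<Longrightarrow> j < i + k \<Longrightarrow> c j = c' j \<and> \<sigma> j = \<sigma>' j) \<Longrightarrow> bsim E \<sigma> c i k P = bsim E \<sigma>' c' i k P"
  by (induction k arbitrary: i) auto

lemma upd_mono:
  assumes "X \<subseteq> X'" "Z' \<subseteq> Z"
  shows "upd E v b Z X \<subseteq> upd E v b Z' X'"
proof -
  have "(\<forall>C\<in>E. v \<in> C \<longrightarrow> \<not> C - {v} \<subseteq> Z) \<Longrightarrow> (\<forall>C\<in>E. v \<in> C \<longrightarrow> \<not> C - {v} \<subseteq> Z')"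
    using assms(2) by (meson order.trans)
  then show ?thesis using assms(1) unfolding upd_def by auto
qed

text \<open>The true trajectory blocks itself. The lower bound is blocked by a larger set and the
  upper bound by a smaller one, so \<open>upd_mono\<close> preserves both inclusions at every
  update.\<close>

lemma sandwich:
  assumes "fst P \<subseteq> X" "X \<subseteq> snd P"
  shows "fst (bsim E \<sigma> c i k P) \<subseteq> sim E \<sigma> c i k X \<and> sim E \<sigma> c i k X \<subseteq> snd (bsim E \<sigma> c i k P)"
  using assms by (induction k arbitrary: i) (simp_all add: Let_def upd2_def upd_mono)

lemma bsim_subset:
  assumes "fst P \<subseteq> snd P"
  shows "fst (bsim E \<sigma> c i k P) \<subseteq> snd (bsim E \<sigma> c i k P)"
  using assms by (induction k arbitrary: i) (simp_all add: upd2_def upd_mono)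

lemma bsim_range:
  assumes "fst P \<subseteq> V" "snd P \<subseteq> V" "\<And>i. \<sigma> i \<in> V"
  shows "fst (bsim E \<sigma> c i k P) \<subseteq> V \<and> snd (bsim E \<sigma> c i k P) \<subseteq> V"
  using assms by (induction k arbitrary: i) (auto simp: upd2_def upd_def)

section \<open>Stationarity of the uniform distribution on independent sets\<close>

lemma hypergraph_finite_edges:
  assumes "hypergraph \<Phi>" shows "finite (edges \<Phi>)"
  using assms finite_subset[of "edges \<Phi>" "Pow (verts \<Phi>)"] unfolding hypergraph_def by auto

lemma finite_independent: "hypergraph \<Phi> \<Longrightarrow> finite {I. independent_set \<Phi> I}"
  by (rule finite_subset[of _ "Pow (verts \<Phi>)"]) (auto simp: independent_set_def hypergraph_def)

lemma independent_empty: "hypergraph \<Phi> \<Longrightarrow> independent_set \<Phi> {}"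
  by (auto simp: independent_set_def hypergraph_def)

lemma independent_upd:
  assumes "independent_set \<Phi> X" "v \<in> verts \<Phi>"
  shows "independent_set \<Phi> (upd (edges \<Phi>) v b X X)"
  using assms unfolding independent_set_def upd_def by auto

text \<open>Each independent set has exactly two preimages under (set, coin) \<open>\<mapsto>\<close> updated set,
  so the uniform distribution is stationary.\<close>
lemma upd_preimages:
  assumes "hypergraph \<Phi>" "v \<in> verts \<Phi>" "independent_set \<Phi> Y"
  shows "card {X. independent_set \<Phi> X \<and> upd (edges \<Phi>) v True X X = Y}
       + card {X. independent_set \<Phi> X \<and> upd (edges \<Phi>) v False X X = Y} = 2"
proof -
  have ind_iff: "independent_set \<Phi> (insert v X) \<longleftrightarrow> (\<forall>C\<in>edges \<Phi>. v \<in> C \<longrightarrow> \<not> C - {v} \<subseteq> X)"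
    if "independent_set \<Phi> X" for X
    using that assms(2) unfolding independent_set_def by auto
  have mono: "independent_set \<Phi> X" if "X \<subseteq> Z" "independent_set \<Phi> Z" for X Z
    using that unfolding independent_set_def by (meson order.trans)
  \<comment> \<open>If \<open>v \<in> Y\<close>, only heads leads to \<open>Y\<close>, from
    \<open>Y\<close> and from \<open>Y - {v}\<close>. Otherwise tails leads to it from
    \<open>Y\<close>, and the second preimage depends on whether \<open>v\<close> may be inserted:
    if so, it is \<open>insert v Y\<close> with tails; if not, \<open>Y\<close> itself with
    heads.\<close>
  show ?thesis
  proof (cases "v \<in> Y")
    case True
    have "{X. independent_set \<Phi> X \<and> upd (edges \<Phi>) v False X X = Y} = {}"
      using True by (auto simp: upd_def)
    moreover have "{X. independent_set \<Phi> X \<and> upd (edges \<Phi>) v True X X = Y} = {Y, Y - {v}}"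
    proof (intro set_eqI iffI)
      fix X assume "X \<in> {X. independent_set \<Phi> X \<and> upd (edges \<Phi>) v True X X = Y}"
      then show "X \<in> {Y, Y - {v}}" using True by (auto simp: upd_def split: if_splits)
    next
      fix X assume X: "X \<in> {Y, Y - {v}}"
      then have "independent_set \<Phi> X" using assms(3) mono[of "Y - {v}" Y] by auto
      moreover have "insert v X = Y" using X True by auto
      ultimately show "X \<in> {X. independent_set \<Phi> X \<and> upd (edges \<Phi>) v True X X = Y}"
        using ind_iff[of X] assms(3) by (simp add: upd_def)
    qed
    moreover have "Y \<noteq> Y - {v}" using True by blast
    ultimately show ?thesis by (simp only: card.empty) simp
  next
    case False
    have F: "{X. independent_set \<Phi> X \<and> upd (edges \<Phi>) v False X X = Y} =
      {Y} \<union> (if independent_set \<Phi> (insert v Y) then {insert v Y} else {})"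
      using False assms(3) by (auto simp: upd_def insert_absorb split: if_splits)
    have T: "{X. independent_set \<Phi> X \<and> upd (edges \<Phi>) v True X X = Y} =
      (if independent_set \<Phi> (insert v Y) then {} else {Y})"
    proof (intro set_eqI iffI)
      fix X assume "X \<in> {X. independent_set \<Phi> X \<and> upd (edges \<Phi>) v True X X = Y}"
      then have X: "independent_set \<Phi> X" "upd (edges \<Phi>) v True X X = Y" by auto
      then have bl: "\<not> independent_set \<Phi> (insert v X)" and eq: "X - {v} = Y"
        using False ind_iff[of X] by (auto simp: upd_def split: if_splits)
      then have "v \<notin> X" using X(1) by (metis insert_absorb)
      then show "X \<in> (if independent_set \<Phi> (insert v Y) then {} else {Y})" using bl eq by auto
    next
      fix X assume "X \<in> (if independent_set \<Phi> (insert v Y) then {} else {Y})"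
      then have "X = Y" "\<not> independent_set \<Phi> (insert v Y)" by (auto split: if_splits)
      then show "X \<in> {X. independent_set \<Phi> X \<and> upd (edges \<Phi>) v True X X = Y}"
        using assms(3) False ind_iff[of Y] by (auto simp: upd_def)
    qed
    have "Y \<noteq> insert v Y" using False by blast
    then show ?thesis unfolding F T by simp
  qed
qed

lemma independent_sim:
  assumes "independent_set \<Phi> X" "\<And>i. \<sigma> i \<in> verts \<Phi>"
  shows "independent_set \<Phi> (sim (edges \<Phi>) \<sigma> c i k X)"
  using assms by (induction k arbitrary: i) (auto simp: Let_def independent_upd)

lemma finitary_sim: "finitary k (\<lambda>c. Q (sim E \<sigma> c 0 k X))"
  unfolding finitary_def
proof (intro allI impI)
  fix c c' :: "nat \<Rightarrow> bool" assume "\<forall>i<k. c i = c' i"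
  then have "sim E \<sigma> c 0 k X = sim E \<sigma> c' 0 k X" by (intro sim_cong) simp
  then show "Q (sim E \<sigma> c 0 k X) = Q (sim E \<sigma> c' 0 k X)" by simp
qed

lemma finitary_bsim: "finitary k (\<lambda>c. Q (bsim E \<sigma> c 0 k P))"
  unfolding finitary_def
proof (intro allI impI)
  fix c c' :: "nat \<Rightarrow> bool" assume "\<forall>i<k. c i = c' i"
  then have "bsim E \<sigma> c 0 k P = bsim E \<sigma> c' 0 k P" by (intro bsim_cong) simp
  then show "Q (bsim E \<sigma> c 0 k P) = Q (bsim E \<sigma> c' 0 k P)" by simp
qed

text \<open>The transition matrix has column sums one, which is stationarity of the uniform
  distribution without the normalising factor. The induction splits off the update at index 0, the
  last in time but driven by the first coin of the stream.\<close>

lemma sim_stationary: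
  assumes "hypergraph \<Phi>" "\<And>i. \<sigma> i \<in> verts \<Phi>" "independent_set \<Phi> Y"
  shows "(\<Sum>X | independent_set \<Phi> X. coin.prob {\<omega>. sim (edges \<Phi>) \<sigma> (snth \<omega>) 0 k X = Y}) = 1"
  using assms(2,3)
proof (induction k arbitrary: \<sigma> Y)
  case 0
  have "coin.prob {\<omega>. X = Y} = of_bool (X = Y)" for X
    using coin.prob_space by simp
  then show ?case using 0 finite_independent[OF assms(1)] by (simp add: of_bool_def)
next
  case (Suc k)
  let ?I = "{I. independent_set \<Phi> I}" and ?E = "edges \<Phi>"
  define \<tau> where "\<tau> = (\<lambda>j. \<sigma> (Suc j))"
  have fin: "finite ?I" by (rule finite_independent[OF assms(1)])
  have step: "coin.prob {\<omega>. sim ?E \<sigma> (snth \<omega>) 0 (Suc k) X = Y} =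
      (\<Sum>Z\<in>?I. coin.prob {\<omega>. sim ?E \<tau> (snth \<omega>) 0 k X = Z} *
        (of_bool (upd ?E (\<sigma> 0) True Z Z = Y) + of_bool (upd ?E (\<sigma> 0) False Z Z = Y)) / 2)"
    if X: "X \<in> ?I" for X
  proof -
    have cons: "sim ?E \<sigma> (snth (b ## \<omega>)) 0 (Suc k) X =
        upd ?E (\<sigma> 0) b (sim ?E \<tau> (snth \<omega>) 0 k X) (sim ?E \<tau> (snth \<omega>) 0 k X)" for b \<omega>
      using sim_shift[of ?E \<sigma> "snth (b ## \<omega>)" 0 1 k X] by (simp add: \<tau>_def Let_def)
    have part: "coin.prob {\<omega>. sim ?E \<sigma> (snth (b ## \<omega>)) 0 (Suc k) X = Y} =
        (\<Sum>Z\<in>?I. coin.prob {\<omega>. sim ?E \<tau> (snth \<omega>) 0 k X = Z} * of_bool (upd ?E (\<sigma> 0) b Z Z = Y))" for b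
    proof -
      have "{\<omega>. sim ?E \<sigma> (snth (b ## \<omega>)) 0 (Suc k) X = Y} =
        (\<Union>Z\<in>{Z\<in>?I. upd ?E (\<sigma> 0) b Z Z = Y}. {\<omega>. sim ?E \<tau> (snth \<omega>) 0 k X = Z})"
        unfolding cons using X independent_sim[of \<Phi> X \<tau>] Suc.prems(1) by (auto simp: \<tau>_def)
      also have "coin.prob \<dots> = (\<Sum>Z\<in>{Z\<in>?I. upd ?E (\<sigma> 0) b Z Z = Y}. coin.prob {\<omega>. sim ?E \<tau> (snth \<omega>) 0 k X = Z})"
        using fin by (intro coin.finite_measure_finite_Union)
          (auto simp: disjoint_family_on_def intro!: finitary_event[OF finitary_sim])
      also have "\<dots> = (\<Sum>Z\<in>?I. coin.prob {\<omega>. sim ?E \<tau> (snth \<omega>) 0 k X = Z} * of_bool (upd ?E (\<sigma> 0) b Z Z = Y))"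
        using fin by (intro sum.mono_neutral_cong_left) auto
      finally show ?thesis .
    qed
    have "coin.prob {\<omega>. sim ?E \<sigma> (snth \<omega>) 0 (Suc k) X = Y} =
      (coin.prob {\<omega>. sim ?E \<sigma> (snth (True ## \<omega>)) 0 (Suc k) X = Y} + coin.prob {\<omega>. sim ?E \<sigma> (snth (False ## \<omega>)) 0 (Suc k) X = Y}) / 2"
      by (rule coin_first_flip) (rule finitary_event[OF finitary_sim])
    then show ?thesis unfolding part
      by (simp add: sum_divide_distrib[symmetric] sum.distrib[symmetric] distrib_left)
  qed
  have "(\<Sum>X\<in>?I. coin.prob {\<omega>. sim ?E \<sigma> (snth \<omega>) 0 (Suc k) X = Y}) =
     (\<Sum>Z\<in>?I. (\<Sum>X\<in>?I. coin.prob {\<omega>. sim ?E \<tau> (snth \<omega>) 0 k X = Z}) *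
        (of_bool (upd ?E (\<sigma> 0) True Z Z = Y) + of_bool (upd ?E (\<sigma> 0) False Z Z = Y)) / 2)"
    by (simp only: sum.cong[OF refl step] sum_distrib_right sum_divide_distrib) (rule sum.swap)
  also have "\<dots> = (\<Sum>Z\<in>?I. (of_bool (upd ?E (\<sigma> 0) True Z Z = Y) + of_bool (upd ?E (\<sigma> 0) False Z Z = Y)) / 2)"
    using Suc.IH[of \<tau>] Suc.prems(1) by (intro sum.cong) (auto simp: \<tau>_def)
  also have "\<dots> = (real (card {Z\<in>?I. upd ?E (\<sigma> 0) True Z Z = Y}) + real (card {Z\<in>?I. upd ?E (\<sigma> 0) False Z Z = Y})) / 2"
    using fin by (simp add: sum_divide_distrib[symmetric] sum.distrib of_bool_def sum.If_cases Int_def)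
  also have "\<dots> = 1"
    using upd_preimages[OF assms(1) Suc.prems(1)[of 0] Suc.prems(2)]
    by (simp flip: of_nat_add)
  finally show ?case .
qed

section \<open>Coupling from the past\<close>

definition coalesced :: "'a hypergraph \<Rightarrow> (nat \<Rightarrow> 'a) \<Rightarrow> (nat \<Rightarrow> bool) \<Rightarrow> nat \<Rightarrow> bool" where
  "coalesced \<Phi> \<sigma> c k \<longleftrightarrow>
     fst (bsim (edges \<Phi>) \<sigma> c 0 k ({}, verts \<Phi>)) = snd (bsim (edges \<Phi>) \<sigma> c 0 k ({}, verts \<Phi>))"

lemma coalesced_sim:
  assumes "coalesced \<Phi> \<sigma> c k" "X \<subseteq> verts \<Phi>"
  shows "sim (edges \<Phi>) \<sigma> c 0 k X = fst (bsim (edges \<Phi>) \<sigma> c 0 k ({}, verts \<Phi>))"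
  using sandwich[of "({}, verts \<Phi>)" X "edges \<Phi>" \<sigma> c 0 k] assms unfolding coalesced_def by auto

text \<open>A longer horizon puts further updates before the last \<open>k\<close>. They hand over a
  pair inside \<open>({}, verts \<Phi>)\<close>, and monotonicity confines the result to a pair that
  has already collapsed. In a forward simulation a meeting of the bounds would not freeze the
  value.\<close>

lemma coalesced_bsim:
  assumes "coalesced \<Phi> \<sigma> c k" "k \<le> l" "\<And>i. \<sigma> i \<in> verts \<Phi>"
  shows "bsim (edges \<Phi>) \<sigma> c 0 l ({}, verts \<Phi>) = bsim (edges \<Phi>) \<sigma> c 0 k ({}, verts \<Phi>)"
proof -
  let ?B = "\<lambda>P. bsim (edges \<Phi>) \<sigma> c 0 k P"
  define P where "P = bsim (edges \<Phi>) \<sigma> c k (l - k) ({}, verts \<Phi>)"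
  have l: "bsim (edges \<Phi>) \<sigma> c 0 l ({}, verts \<Phi>) = ?B P"
    using assms(2) bsim_append[of "edges \<Phi>" \<sigma> c 0 k "l - k"] by (simp add: P_def)
  have P: "fst P \<subseteq> snd P" "snd P \<subseteq> verts \<Phi>"
    using bsim_subset[of "({}, verts \<Phi>)"] bsim_range[of "({}, verts \<Phi>)" "verts \<Phi>" \<sigma>] assms(3)
    by (auto simp: P_def)
  have mono: "fst (bsim E \<sigma> c i j Q) \<subseteq> fst (bsim E \<sigma> c i j Q') \<and> snd (bsim E \<sigma> c i j Q') \<subseteq> snd (bsim E \<sigma> c i j Q)"
    if "fst Q \<subseteq> fst Q'" "snd Q' \<subseteq> snd Q" for E i j Q Q'
    using that by (induction j arbitrary: i) (simp_all add: upd2_def upd_mono)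
  have "fst (?B ({}, verts \<Phi>)) \<subseteq> fst (?B P)" "snd (?B P) \<subseteq> snd (?B ({}, verts \<Phi>))"
    using mono[of "({}, verts \<Phi>)" P] P by auto
  moreover have "fst (?B P) \<subseteq> snd (?B P)" using bsim_subset P(1) by blast
  ultimately show ?thesis using assms(1) unfolding l coalesced_def
    by (intro prod_eqI subset_antisym) auto
qed

lemma coalesced_event:
  "{\<omega>. coalesced \<Phi> \<sigma> (snth \<omega>) k \<and> Q (bsim (edges \<Phi>) \<sigma> (snth \<omega>) 0 k ({}, verts \<Phi>))} \<in> sets coin_space"
  "{\<omega>. \<not> coalesced \<Phi> \<sigma> (snth \<omega>) k} \<in> sets coin_space"
  unfolding coalesced_def by (rule finitary_event[OF finitary_bsim])+

text \<open>By \<open>coalesced_bsim\<close> the value is the same for every \<open>k\<close> at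
  which the bounds have met, so the existential describes a single output.\<close>

definition coupled_output :: "'a hypergraph \<Rightarrow> (nat \<Rightarrow> 'a) \<Rightarrow> 'a set \<Rightarrow> bool stream set" where
  "coupled_output \<Phi> \<sigma> Y = {\<omega>. \<exists>k. coalesced \<Phi> \<sigma> (snth \<omega>) k \<and>
     fst (bsim (edges \<Phi>) \<sigma> (snth \<omega>) 0 k ({}, verts \<Phi>)) = Y}"

lemma coupled_output_event: "coupled_output \<Phi> \<sigma> Y \<in> sets coin_space"
  unfolding coupled_output_def Collect_ex_eq
  by (intro sets.countable_UN') (auto intro: coalesced_event(1)[where Q = "\<lambda>P. fst P = Y"])

text \<open>For each \<open>k\<close> and each independent start, the output agrees with the
  trajectory from that start unless the bounds differ at horizon \<open>k\<close>. Averaged over all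
  starts the trajectory is uniform by stationarity, and the error is at most the failure
  probability, where \<open>k\<close> is free.\<close>

theorem coupling_from_the_past:
  assumes "hypergraph \<Phi>" and \<sigma>: "\<And>i. \<sigma> i \<in> verts \<Phi>"
    and small: "\<And>e. e > 0 \<Longrightarrow> \<exists>k. coin.prob {\<omega>. \<not> coalesced \<Phi> \<sigma> (snth \<omega>) k} < e"
  shows "coin.prob (coupled_output \<Phi> \<sigma> Y) = pmf (pmf_of_set {I. independent_set \<Phi> I}) Y"
proof -
  let ?I = "{I. independent_set \<Phi> I}" and ?E = "edges \<Phi>"
  have fin: "finite ?I" and ne: "?I \<noteq> {}"
    using finite_independent[OF assms(1)] independent_empty[OF assms(1)] by auto
  let ?S = "\<lambda>k X. {\<omega>. sim ?E \<sigma> (snth \<omega>) 0 k X = Y}" and ?N = "\<lambda>k. {\<omega>. \<not> coalesced \<Phi> \<sigma> (snth \<omega>) k}"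
  have S: "?S k X \<in> sets coin_space" for k X by (rule finitary_event[OF finitary_sim])
  have N: "?N k \<in> sets coin_space" for k by (rule coalesced_event)
  have O: "coupled_output \<Phi> \<sigma> Y \<in> sets coin_space" by (rule coupled_output_event)
  have near: "\<bar>coin.prob (coupled_output \<Phi> \<sigma> Y) - coin.prob (?S k X)\<bar> \<le> coin.prob (?N k)" if X: "X \<in> ?I" for k X
  proof -
    have XV: "X \<subseteq> verts \<Phi>" using X by (simp add: independent_set_def)
    have "?S k X \<subseteq> coupled_output \<Phi> \<sigma> Y \<union> ?N k"
      using coalesced_sim[OF _ XV] by (auto simp: coupled_output_def)
    then have "coin.prob (?S k X) \<le> coin.prob (coupled_output \<Phi> \<sigma> Y) + coin.prob (?N k)"
      using coin.finite_measure_mono[of "?S k X" "coupled_output \<Phi> \<sigma> Y \<union> ?N k"]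
        measure_Un_le[OF O N[of k]] sets.Un[OF O N[of k]] by linarith
    moreover have "coupled_output \<Phi> \<sigma> Y \<subseteq> ?S k X \<union> ?N k"
    proof
      fix \<omega> assume "\<omega> \<in> coupled_output \<Phi> \<sigma> Y"
      then obtain l where l: "coalesced \<Phi> \<sigma> (snth \<omega>) l" "fst (bsim ?E \<sigma> (snth \<omega>) 0 l ({}, verts \<Phi>)) = Y"
        by (auto simp: coupled_output_def)
      show "\<omega> \<in> ?S k X \<union> ?N k"
      proof (cases "coalesced \<Phi> \<sigma> (snth \<omega>) k")
        case True
        then have "bsim ?E \<sigma> (snth \<omega>) 0 k ({}, verts \<Phi>) = bsim ?E \<sigma> (snth \<omega>) 0 l ({}, verts \<Phi>)"
          using coalesced_bsim[OF l(1) _ \<sigma>, where l = k] coalesced_bsim[OF True _ \<sigma>, where l = l] linear[of k l] by metis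
        then show ?thesis using coalesced_sim[OF True XV] l(2) by auto
      qed auto
    qed
    then have "coin.prob (coupled_output \<Phi> \<sigma> Y) \<le> coin.prob (?S k X) + coin.prob (?N k)"
      using coin.finite_measure_mono[of "coupled_output \<Phi> \<sigma> Y" "?S k X \<union> ?N k"]
        measure_Un_le[OF S[of k X] N[of k]] sets.Un[OF S[of k X] N[of k]] by linarith
    ultimately show ?thesis by linarith
  qed
  show ?thesis
  proof (cases "Y \<in> ?I")
    case True
    let ?p = "coin.prob (coupled_output \<Phi> \<sigma> Y)"
    have c: "real (card ?I) > 0" using fin ne by (simp add: card_gt_0_iff)
    have bound: "\<bar>?p - 1 / card ?I\<bar> \<le> coin.prob (?N k)" for k
    proof -
      \<comment> \<open>Stationarity turns the sum of the trajectory probabilities over all starts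
        into 1.\<close>
      have "\<bar>card ?I * ?p - 1\<bar> = \<bar>\<Sum>X\<in>?I. ?p - coin.prob (?S k X)\<bar>"
        using sim_stationary[OF assms(1) \<sigma>, where Y = Y and k = k] True by (simp add: sum_subtractf)
      also have "\<dots> \<le> (\<Sum>X\<in>?I. coin.prob (?N k))"
        using near by (intro order.trans[OF sum_abs] sum_mono) auto
      finally have "\<bar>card ?I * ?p - 1\<bar> \<le> card ?I * coin.prob (?N k)" by simp
      moreover have "\<bar>card ?I * ?p - 1\<bar> = card ?I * \<bar>?p - 1 / card ?I\<bar>"
      proof -
        have "card ?I * ?p - 1 = card ?I * (?p - 1 / card ?I)" using c by (simp add: right_diff_distrib)
        then show ?thesis by (simp only: abs_mult abs_of_nat)
      qed
      ultimately show ?thesis using c by simp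
    qed
    have "?p = 1 / card ?I"
    proof (rule ccontr)
      assume "?p \<noteq> 1 / card ?I"
      then have "\<bar>?p - 1 / card ?I\<bar> > 0" by simp
      from small[OF this] bound show False by (meson not_less)
    qed
    then show ?thesis using fin ne True by simp
  next
    case False
    \<comment> \<open>The trajectory from the empty set stays independent and equals the output once
      the bounds have met, so no other set is ever returned.\<close>
    have "coupled_output \<Phi> \<sigma> Y = {}"
    proof -
      have "independent_set \<Phi> (fst (bsim ?E \<sigma> (snth \<omega>) 0 k ({}, verts \<Phi>)))" if "coalesced \<Phi> \<sigma> (snth \<omega>) k" for \<omega> k
        using coalesced_sim[OF that, of "{}"] 
          independent_sim[OF independent_empty[OF assms(1)], of \<sigma> "snth \<omega>" 0 k] \<sigma> by simp
      then show ?thesis using False by (auto simp: coupled_output_def)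
    qed
    then show ?thesis using fin ne False by simp
  qed
qed

section \<open>Decay of the coalescence time\<close>

text \<open>Updates below \<open>s\<close> concern isolated vertices; beyond, every window of
  \<open>N\<close> indices meets each vertex of an edge exactly once. Covering bounds how far back a
  last update lies, injectivity bounds how often an edge can be entered; the order within a window
  is left open.\<close>

locale schedule =
  fixes \<Phi> :: "'a hypergraph" and \<sigma> :: "nat \<Rightarrow> 'a" and s N :: nat
  assumes hyper: "hypergraph \<Phi>"
    and sched_verts: "\<sigma> i \<in> verts \<Phi>"
    and sched_all: "v \<in> verts \<Phi> \<Longrightarrow> \<exists>i<s + N. \<sigma> i = v"
    and sched_isolated: "i < s \<Longrightarrow> \<sigma> i \<notin> \<Union>(edges \<Phi>)"
    and sched_cover: "v \<in> \<Union>(edges \<Phi>) \<Longrightarrow> s \<le> i \<Longrightarrow> \<exists>j\<in>{i..<i + N}. \<sigma> j = v"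
    and sched_inj: "s \<le> i \<Longrightarrow> inj_on \<sigma> {i..<i + N}"
begin

text \<open>Since the index counts backwards, this is the most recent update of \<open>u\<close> at
  the moment when update \<open>i\<close> has just been performed.\<close>

definition next_time :: "'a \<Rightarrow> nat \<Rightarrow> nat" where
  "next_time u i = (LEAST j. i \<le> j \<and> \<sigma> j = u)"

text \<open>The updates that determine the current state of the edge at that moment; disjointness of
  these sets is what makes coins of different nodes independent.\<close>

definition slots :: "'a set \<times> nat \<Rightarrow> nat set" where
  "slots n = (\<lambda>u. next_time u (snd n)) ` fst n"

lemma next_time:
  assumes "i \<le> j" "\<sigma> j = u"
  shows "i \<le> next_time u i" "\<sigma> (next_time u i) = u" "next_time u i \<le> j"
    "\<And>l. i \<le> l \<Longrightarrow> l < next_time u i \<Longrightarrow> \<sigma> l \<noteq> u"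
proof -
  have "i \<le> next_time u i \<and> \<sigma> (next_time u i) = u"
    unfolding next_time_def by (rule LeastI[of _ j]) (use assms in auto)
  then show "i \<le> next_time u i" "\<sigma> (next_time u i) = u" by auto
  show "next_time u i \<le> j" unfolding next_time_def by (rule Least_le) (use assms in auto)
  show "\<And>l. i \<le> l \<Longrightarrow> l < next_time u i \<Longrightarrow> \<sigma> l \<noteq> u"
    unfolding next_time_def using not_less_Least by blast
qed

lemma next_time_self: "next_time (\<sigma> i) i = i"
  using next_time[of i i "\<sigma> i"] by simp

lemma next_time_Suc:
  assumes "\<sigma> i \<noteq> u" shows "next_time u (Suc i) = next_time u i"
proof -
  have "(\<lambda>j. Suc i \<le> j \<and> \<sigma> j = u) = (\<lambda>j. i \<le> j \<and> \<sigma> j = u)"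
    using assms by (auto simp: Suc_le_eq order_less_le)
  then show ?thesis by (simp add: next_time_def)
qed

lemma next_time_edge:
  assumes "u \<in> \<Union>(edges \<Phi>)" "s \<le> i"
  shows "i \<le> next_time u i" "\<sigma> (next_time u i) = u" "next_time u i < i + N"
proof -
  obtain j where "i \<le> j" "j < i + N" "\<sigma> j = u" using sched_cover[OF assms] by auto
  then show "i \<le> next_time u i" "\<sigma> (next_time u i) = u" "next_time u i < i + N"
    using next_time[of i j u] by auto
qed

lemma slots_props:
  assumes "C \<in> edges \<Phi>" "s \<le> i" "j \<in> slots (C, i)"
  shows "i \<le> j" "j < i + N" "\<sigma> j \<in> C"
proof -
  obtain u where u: "u \<in> C" "j = next_time u i" using assms(3) by (auto simp: slots_def)
  then have "u \<in> \<Union>(edges \<Phi>)" using assms(1) by auto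
  from next_time_edge[OF this assms(2)] u show "i \<le> j" "j < i + N" "\<sigma> j \<in> C" by auto
qed

lemma card_slots:
  assumes "C \<in> edges \<Phi>" "s \<le> i"
  shows "card (slots (C, i)) = card C" "finite (slots (C, i))"
proof -
  have "inj_on (\<lambda>u. next_time u i) C"
    by (rule inj_on_inverseI[of _ \<sigma>]) (use next_time_edge(2)[OF _ assms(2)] assms(1) in auto)
  then show "card (slots (C, i)) = card C" by (simp add: slots_def card_image)
  have "finite C" using assms(1) hyper finite_subset unfolding hypergraph_def by blast
  then show "finite (slots (C, i))" by (simp add: slots_def)
qed

section \<open>Tracing a disagreement back in time\<close>

definition pair_at :: "(nat \<Rightarrow> bool) \<Rightarrow> nat \<Rightarrow> nat \<Rightarrow> 'a set \<times> 'a set" where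
  "pair_at c K i = bsim (edges \<Phi>) \<sigma> c i (K - i) ({}, verts \<Phi>)"

definition discrepant :: "(nat \<Rightarrow> bool) \<Rightarrow> nat \<Rightarrow> 'a \<Rightarrow> nat \<Rightarrow> bool" where
  "discrepant c K u i \<longleftrightarrow> u \<in> snd (pair_at c K i) \<and> u \<notin> fst (pair_at c K i)"

lemma pair_at_step: "i < K \<Longrightarrow> pair_at c K i = upd2 (edges \<Phi>) (\<sigma> i) (c i) (pair_at c K (Suc i))"
  unfolding pair_at_def by (subst Suc_diff_Suc[symmetric]) auto

lemma pair_at_keep:
  assumes "i \<le> j" "j \<le> K" "\<And>l. i \<le> l \<Longrightarrow> l < j \<Longrightarrow> \<sigma> l \<noteq> u"
  shows "(u \<in> fst (pair_at c K i) \<longleftrightarrow> u \<in> fst (pair_at c K j)) \<and> (u \<in> snd (pair_at c K i) \<longleftrightarrow> u \<in> snd (pair_at c K j))"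
  using assms
proof (induction rule: inc_induct)
  case (step i)
  have "u \<noteq> \<sigma> i" using step.prems(2)[of i] step.hyps by auto
  then have "(u \<in> fst (pair_at c K i) \<longleftrightarrow> u \<in> fst (pair_at c K (Suc i))) \<and> (u \<in> snd (pair_at c K i) \<longleftrightarrow> u \<in> snd (pair_at c K (Suc i)))"
    using step.hyps step.prems(1) by (simp add: pair_at_step upd2_def upd_def)
  then show ?case using step by auto
qed simp

text \<open>The upper bound starts full, so membership is evidence of heads only if the last update
  lies within the horizon \<open>K\<close>.\<close>

lemma upper_heads:
  assumes "u \<in> snd (pair_at c K i)" "i \<le> j" "\<sigma> j = u" "next_time u i < K"
  shows "c (next_time u i)"
proof -
  note n = next_time[OF assms(2,3)]
  have "u \<in> snd (pair_at c K (next_time u i))"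
    using pair_at_keep[of i "next_time u i" K u c] n assms(1,4) by simp
  then show ?thesis using assms(4) n(2) by (auto simp: pair_at_step upd2_def upd_def split: if_splits)
qed

text \<open>If the two bounds disagree right after an update, then some edge through the updated vertex
  is blocked by the upper but not by the lower bound, so they disagreed inside that edge before.\<close>
lemma discrepant_update:
  assumes "discrepant c K (\<sigma> i) i" "i < K"
  obtains C w where "C \<in> edges \<Phi>" "\<sigma> i \<in> C" "c i" "C - {\<sigma> i} \<subseteq> snd (pair_at c K (Suc i))"
    "w \<in> C" "w \<noteq> \<sigma> i" "discrepant c K w (Suc i)"
proof -
  let ?P = "pair_at c K (Suc i)"
  have U: "c i" "\<forall>C\<in>edges \<Phi>. \<sigma> i \<in> C \<longrightarrow> \<not> C - {\<sigma> i} \<subseteq> fst ?P"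
    using assms by (auto simp: discrepant_def pair_at_step upd2_def upd_def split: if_splits)
  have "\<not> (\<forall>C\<in>edges \<Phi>. \<sigma> i \<in> C \<longrightarrow> \<not> C - {\<sigma> i} \<subseteq> snd ?P)"
    using assms U(1) by (auto simp: discrepant_def pair_at_step upd2_def upd_def split: if_splits)
  then obtain C where C: "C \<in> edges \<Phi>" "\<sigma> i \<in> C" "C - {\<sigma> i} \<subseteq> snd ?P" by blast
  then obtain w where "w \<in> C" "w \<noteq> \<sigma> i" "w \<notin> fst ?P" using U(2) by blast
  then show ?thesis using that[of C w] C U(1) by (auto simp: discrepant_def)
qed

text \<open>Slots at or beyond the horizon \<open>K\<close> were never performed and say nothing
  about their coins; hence the guard \<open>j < K\<close>.\<close>

definition node :: "(nat \<Rightarrow> bool) \<Rightarrow> nat \<Rightarrow> 'a set \<times> nat \<Rightarrow> bool" where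
  "node c K n \<longleftrightarrow> fst n \<in> edges \<Phi> \<and> s \<le> snd n \<and> \<sigma> (snd n) \<in> fst n \<and> (\<forall>j\<in>slots n. j < K \<longrightarrow> c j)"

definition link :: "'a set \<times> nat \<Rightarrow> 'a set \<times> nat \<Rightarrow> bool" where
  "link n n' \<longleftrightarrow> snd n' \<in> slots n \<and> snd n < snd n'"

text \<open>A disagreement at an update is inherited from another vertex \<open>w\<close> of the
  blocked edge, and that of \<open>w\<close> dates from its own last update \<open>j\<close>. Either
  the walk continues from \<open>j\<close>, with \<open>K - j\<close> smaller, or \<open>j\<close>
  lies beyond the horizon, which is then less than a window away.\<close>

lemma discrepant_walk:
  assumes "discrepant c K (\<sigma> i) i" "i < K" "s \<le> i"
  shows "\<exists>ns. ns \<noteq> [] \<and> snd (hd ns) = i \<and> (\<forall>n\<in>set ns. node c K n) \<and> successively link ns \<and> K < snd (last ns) + N"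
  using assms
proof (induction "K - i" arbitrary: i rule: less_induct)
  case less
  obtain C w where C: "C \<in> edges \<Phi>" "\<sigma> i \<in> C" "c i" "C - {\<sigma> i} \<subseteq> snd (pair_at c K (Suc i))"
    and w: "w \<in> C" "w \<noteq> \<sigma> i" "discrepant c K w (Suc i)"
    using discrepant_update[OF less.prems(1,2)] by blast
  \<comment> \<open>The vertex updated at \<open>i\<close> drew heads; every other vertex of
    \<open>C\<close> was in the upper bound just before, so its last update drew heads as
    well.\<close>
  have node: "node c K (C, i)"
    unfolding node_def fst_conv snd_conv
  proof (intro conjI ballI impI)
    fix j assume j: "j \<in> slots (C, i)" "j < K"
    then obtain u where u: "u \<in> C" "j = next_time u i" by (auto simp: slots_def)
    show "c j"
    proof (cases "u = \<sigma> i")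
      case True
      then show ?thesis using C(3) u(2) next_time_self by simp
    next
      case False
      have "u \<in> \<Union>(edges \<Phi>)" using u C(1) by auto
      then obtain l where "Suc i \<le> l" "\<sigma> l = u" using sched_cover[of u "Suc i"] less.prems(3) by auto
      then show ?thesis using upper_heads[of u c K "Suc i" l] next_time_Suc[of i u] u j(2) False C(4) by auto
    qed
  qed (use C less.prems in auto)
  define j where "j = next_time w i"
  have wE: "w \<in> \<Union>(edges \<Phi>)" using w C by auto
  have j: "i \<le> j" "\<sigma> j = w" "j < i + N" using next_time_edge[OF wE less.prems(3)] by (auto simp: j_def)
  have ij: "i < j" using j w(2) by (cases "i = j") auto
  have jslot: "j \<in> slots (C, i)" using w(1) by (auto simp: slots_def j_def)
  show ?case
  proof (cases "j < K")
    case True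
    have j': "j = next_time w (Suc i)" using next_time_Suc[of i w] w(2) j_def by simp
    have "discrepant c K (\<sigma> j) j"
      using w(3) pair_at_keep[of "Suc i" j K w c] next_time(4)[of "Suc i" j w] j ij True
      unfolding discrepant_def j'[symmetric] by auto
    then obtain ns where ns: "ns \<noteq> []" "snd (hd ns) = j" "\<forall>n\<in>set ns. node c K n" "successively link ns" "K < snd (last ns) + N"
      using less.hyps[of j] True ij less.prems diff_less_mono2[of i j K] by (auto simp del: diff_less_mono2)
    have "successively link ((C, i) # ns)"
      using ns jslot ij by (auto simp: successively_Cons link_def)
    then show ?thesis using ns node by (intro exI[of _ "(C, i) # ns"]) auto
  next
    case False
    then show ?thesis using node j by (intro exI[of _ "[(C, i)]"]) auto
  qed
qed

text \<open>The width \<open>2 * N\<close> consists of two windows: the intermediate edge is entered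
  less than \<open>N\<close> after the present node, and its slots reach less than \<open>N\<close>
  further.\<close>

definition near :: "'a set \<times> nat \<Rightarrow> ('a set \<times> nat) set" where
  "near n = {n'. fst n' \<in> closed_nbhd2 \<Phi> (fst n) \<and> snd n' \<in> {snd n..<snd n + 2 * N} \<and> \<sigma> (snd n') \<in> fst n'}"

text \<open>The number counts jumps, so a chain has one node more. Disjointness of slots is imposed
  separately, to keep this recursion local.\<close>

fun node_chains :: "nat \<Rightarrow> 'a set \<times> nat \<Rightarrow> ('a set \<times> nat) list set" where
  "node_chains 0 n = {[n]}"
| "node_chains (Suc m) n = (\<Union>n'\<in>near n. (#) n ` node_chains m n')"

text \<open>Jumping from a node of a walk to the successor of the last node sharing a slot with it
  yields nodes with pairwise disjoint slots, at distance at most two in the hypergraph.\<close>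
lemma select_chain:
  assumes "ns \<noteq> []" "\<forall>n\<in>set ns. node c K n" "successively link ns" "K < snd (last ns) + N"
    "snd (hd ns) + (2 * m + 1) * N \<le> K"
  shows "\<exists>l\<in>node_chains m (hd ns). set l \<subseteq> set ns \<and> sorted_wrt (\<lambda>a b. slots a \<inter> slots b = {}) l"
  using assms
proof (induction m arbitrary: ns)
  case 0
  then show ?case by auto
next
  case (Suc m)
  obtain C i where hd: "hd ns = (C, i)" by fastforce
  have n0: "(C, i) \<in> set ns" using Suc.prems(1) hd by (metis hd_in_set)
  then have nodeC: "C \<in> edges \<Phi>" "s \<le> i" "\<sigma> i \<in> C" using Suc.prems(2) by (auto simp: node_def)
  have "i \<in> slots (C, i)" using nodeC next_time_self[of i] by (force simp: slots_def)
  then have "\<exists>x\<in>set ns. slots x \<inter> slots (C, i) \<noteq> {}" using n0 by blast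
  from split_list_last_prop[OF this] obtain ys x zs where
    ns: "ns = ys @ x # zs" and x: "slots x \<inter> slots (C, i) \<noteq> {}" and zs: "\<forall>z\<in>set zs. \<not> slots z \<inter> slots (C, i) \<noteq> {}"
    by blast
  obtain D k where xD: "x = (D, k)" by fastforce
  have nodeD: "D \<in> edges \<Phi>" "s \<le> k" using Suc.prems(2) ns xD by (auto simp: node_def)
  obtain t where t: "t \<in> slots (D, k)" "t \<in> slots (C, i)" using x xD by auto
  have "k \<le> t" "t < i + N" "\<sigma> t \<in> D" "\<sigma> t \<in> C"
    using slots_props[OF nodeD t(1)] slots_props[OF nodeC(1,2) t(2)] by auto
  then have ki: "k < i + N" and CD: "C \<inter> D \<noteq> {}" by auto
  \<comment> \<open>If the walk ended at \<open>x\<close>, the horizon would lie less than two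
    windows beyond \<open>i\<close>, whereas at least three are available.\<close>
  have "zs \<noteq> []"
  proof
    assume "zs = []"
    then have "K < k + N" using Suc.prems(4) ns xD by simp
    then show False using ki Suc.prems(5) hd by (simp add: algebra_simps)
  qed
  then obtain y bs where y: "zs = y # bs" by (cases zs) auto
  obtain C' i' where yC: "y = (C', i')" by fastforce
  have "sorted_wrt (\<lambda>a b. snd a < snd b) ns"
  proof -
    have "successively (\<lambda>a b. snd a < snd b) ns"
      using Suc.prems(3) by (rule successively_mono) (auto simp: link_def)
    then show ?thesis
      by (subst (asm) successively_iff_sorted_wrt_strong) (auto)
  qed
  moreover have "ns = (C, i) # tl ns" using Suc.prems(1) hd by (metis list.collapse)
  ultimately have ge: "i \<le> snd n" if "n \<in> set ns" for n
    using that by (metis (no_types, lifting) less_imp_le order_refl set_ConsD snd_conv sorted_wrt.simps(2))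
  have nodey: "C' \<in> edges \<Phi>" "s \<le> i'" "\<sigma> i' \<in> C'" "i \<le> i'"
    using Suc.prems(2) ns y yC ge[of y] by (auto simp: node_def)
  have "link x y" using Suc.prems(3) ns y by (auto simp: successively_append_iff)
  then have "i' \<in> slots (D, k)" by (simp add: link_def xD yC)
  note i' = slots_props[OF nodeD this]
  have near: "y \<in> near (C, i)"
  proof -
    have "D \<inter> C' \<noteq> {}" using i'(3) nodey(3) by auto
    then show ?thesis using CD nodeD nodey i' ki by (auto simp: near_def yC closed_nbhd2_def)
  qed
  have "\<exists>l\<in>node_chains m (hd zs). set l \<subseteq> set zs \<and> sorted_wrt (\<lambda>a b. slots a \<inter> slots b = {}) l"
  proof (rule Suc.IH)
    show "successively link zs" using Suc.prems(3) ns y by (auto simp: successively_append_iff)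
    show "K < snd (last zs) + N" using Suc.prems(4) ns y by simp
    \<comment> \<open>One jump uses up at most two windows of the horizon.\<close>
    show "snd (hd zs) + (2 * m + 1) * N \<le> K"
      using Suc.prems(5) hd y yC i' ki by (simp add: algebra_simps)
  qed (use Suc.prems ns y in auto)
  then obtain l where l: "l \<in> node_chains m y" "set l \<subseteq> set zs" "sorted_wrt (\<lambda>a b. slots a \<inter> slots b = {}) l"
    using y by auto
  have "(C, i) # l \<in> node_chains (Suc m) (C, i)" using near l by auto
  moreover have "sorted_wrt (\<lambda>a b. slots a \<inter> slots b = {}) ((C, i) # l)" using l zs by auto
  moreover have "set ((C, i) # l) \<subseteq> set ns" using l n0 ns by auto
  ultimately show ?case using hd by metis
qed

lemma node_chains_nodes:
  assumes "l \<in> node_chains m n" "fst n \<in> edges \<Phi>" "s \<le> snd n" "n' \<in> set l"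
  shows "fst n' \<in> edges \<Phi> \<and> s \<le> snd n' \<and> snd n' \<le> snd n + 2 * m * N"
  using assms
proof (induction m arbitrary: n l)
  case (Suc m)
  then obtain k l' where k: "k \<in> near n" "l' \<in> node_chains m k" "l = n # l'" by auto
  have "fst k \<in> edges \<Phi>" "s \<le> snd k" "snd k \<le> snd n + 2 * N"
    using k(1) Suc.prems by (auto simp: near_def closed_nbhd2_def)
  then show ?case using Suc.IH[OF k(2)] Suc.prems k(3) by (fastforce simp: algebra_simps)
qed auto

lemma finite_near: "finite (near n)"
proof (rule finite_subset)
  show "near n \<subseteq> edges \<Phi> \<times> {snd n..<snd n + 2 * N}" by (auto simp: near_def closed_nbhd2_def)
  show "finite (edges \<Phi> \<times> {snd n..<snd n + 2 * N})" using hypergraph_finite_edges[OF hyper] by simp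
qed

lemma finite_node_chains: "finite (node_chains m n)"
  by (induction m arbitrary: n) (auto simp: finite_near)

section \<open>Weighted count of chains\<close>

definition weight :: "('a set \<times> nat) list \<Rightarrow> real" where
  "weight l = (1/2) ^ sum_list (map (\<lambda>n. card (fst n)) l)"

text \<open>Disjoint slots make the exponents add up.\<close>

lemma chain_prob:
  assumes "\<forall>n\<in>set l. fst n \<in> edges \<Phi> \<and> s \<le> snd n" "sorted_wrt (\<lambda>a b. slots a \<inter> slots b = {}) l"
  shows "coin.prob {\<omega>. \<forall>n\<in>set l. \<forall>j\<in>slots n. \<omega> !! j} = weight l"
proof -
  have "finite (\<Union>n\<in>set l. slots n) \<and> card (\<Union>n\<in>set l. slots n) = sum_list (map (\<lambda>n. card (fst n)) l)"
    using assms
  proof (induction l)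
    case (Cons n l)
    have sl: "finite (slots n)" "card (slots n) = card (fst n)"
      using Cons.prems(1) card_slots[of "fst n" "snd n"] by auto
    have disj: "slots n \<inter> (\<Union>n\<in>set l. slots n) = {}" using Cons.prems(2) by auto
    have IH: "finite (\<Union>n\<in>set l. slots n) \<and> card (\<Union>n\<in>set l. slots n) = sum_list (map (\<lambda>n. card (fst n)) l)"
      using Cons by simp
    show ?case using IH sl card_Un_disjoint[OF sl(1) _ disj] by simp
  qed simp
  then show ?thesis using coin_all_heads[of "\<Union>n\<in>set l. slots n"] by (simp add: weight_def)
qed

text \<open>The sum runs over all chains, disjoint or not: this gives a recursion in
  \<open>m\<close>, and the added terms are nonnegative.\<close>

definition chain_sum :: "nat \<Rightarrow> 'a set \<times> nat \<Rightarrow> real" where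
  "chain_sum m n = (\<Sum>l\<in>node_chains m n. weight l)"

lemma chain_sum_nonneg: "0 \<le> chain_sum m n"
  unfolding chain_sum_def weight_def by (intro sum_nonneg) simp

lemma hd_node_chains: "l \<in> node_chains m n \<Longrightarrow> hd l = n"
  by (cases m) auto

lemma chain_sum_Suc: "chain_sum (Suc m) n = (1/2) ^ card (fst n) * (\<Sum>n'\<in>near n. chain_sum m n')"
proof -
  have "chain_sum (Suc m) n = (\<Sum>n'\<in>near n. \<Sum>l\<in>(#) n ` node_chains m n'. weight l)"
    unfolding chain_sum_def node_chains.simps
  proof (rule sum.UNION_disjoint)
    show "\<forall>i\<in>near n. \<forall>j\<in>near n. i \<noteq> j \<longrightarrow> (#) n ` node_chains m i \<inter> (#) n ` node_chains m j = {}"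
      using hd_node_chains by blast
  qed (auto simp: finite_near finite_node_chains)
  also have "\<dots> = (\<Sum>n'\<in>near n. (1/2) ^ card (fst n) * chain_sum m n')"
    unfolding chain_sum_def sum_distrib_left
    by (rule sum.cong[OF refl]) (subst sum.reindex, auto simp: weight_def power_add)
  finally show ?thesis by (simp add: sum_distrib_left)
qed

lemma card_window:
  assumes "s \<le> i" "finite C"
  shows "card {j\<in>{i..<i + N}. \<sigma> j \<in> C} \<le> card C"
proof (rule card_inj_on_le[of \<sigma>])
  show "inj_on \<sigma> {j\<in>{i..<i + N}. \<sigma> j \<in> C}" using sched_inj[OF assms(1)] by (rule inj_on_subset) auto
qed (use assms in auto)

lemma card_window2:
  assumes "s \<le> i" "finite C"
  shows "card {j\<in>{i..<i + 2 * N}. \<sigma> j \<in> C} \<le> 2 * card C"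
proof -
  have "{j\<in>{i..<i + 2 * N}. \<sigma> j \<in> C} = {j\<in>{i..<i + N}. \<sigma> j \<in> C} \<union> {j\<in>{i + N..<(i + N) + N}. \<sigma> j \<in> C}"
    by auto
  then have "card {j\<in>{i..<i + 2 * N}. \<sigma> j \<in> C} \<le> card {j\<in>{i..<i + N}. \<sigma> j \<in> C} + card {j\<in>{i + N..<(i + N) + N}. \<sigma> j \<in> C}"
    by (metis (no_types, lifting) card_Un_le)
  then show ?thesis using card_window[of i C] card_window[of "i + N" C] assms by linarith
qed

text \<open>Multiplied out, the left side is the probability that exactly one of independent events
  with probabilities \<open>x a\<close> occurs.\<close>

lemma sum_odds_le_prod:
  fixes x :: "'b \<Rightarrow> real"
  assumes "finite A" "\<And>a. a \<in> A \<Longrightarrow> 0 < x a \<and> x a < 1"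
  shows "(\<Sum>a\<in>A. x a / (1 - x a)) * (\<Prod>a\<in>A. 1 - x a) \<le> 1"
  using assms
proof (induction A rule: finite_induct)
  case (insert a A)
  let ?S = "\<Sum>a\<in>A. x a / (1 - x a)" and ?P = "\<Prod>a\<in>A. 1 - x a"
  have IH: "?S * ?P \<le> 1" using insert by simp
  have P: "0 \<le> ?P" "?P \<le> 1" using insert.prems by (auto intro!: prod_nonneg prod_le_1 simp: less_imp_le)
  have x: "0 < x a" "x a < 1" using insert.prems by auto
  have "(\<Sum>a\<in>insert a A. x a / (1 - x a)) * (\<Prod>a\<in>insert a A. 1 - x a) = x a * ?P + (1 - x a) * (?S * ?P)"
    using insert.hyps x by (simp add: field_simps)
  also have "\<dots> \<le> x a * 1 + (1 - x a) * 1"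
    using IH P x by (intro add_mono mult_left_mono) auto
  finally show ?case by simp
qed simp

lemma finite_edge: "C \<in> edges \<Phi> \<Longrightarrow> finite C"
  using hyper finite_subset unfolding hypergraph_def by blast

text \<open>The geometric decay of the asymmetric local lemma; the factor \<open>2 |C|\<close> counts the
  time slots at which a chain can enter the edge \<open>C\<close>.\<close>
lemma chain_sum_bound:
  assumes "lll_witness \<Phi> \<epsilon> x" "C \<in> edges \<Phi>" "s \<le> i"
  shows "2 * card C * chain_sum m (C, i) \<le> (1 - \<epsilon>) ^ Suc m * (x C / (1 - x C))"
  using assms(2,3)
proof (induction m arbitrary: C i)
  case 0
  have w: "0 < \<epsilon>" "\<epsilon> < 1" "0 < x C" "x C < 1"
    and lll: "2 * real (card C) * (1 / 2) ^ card C \<le> (1 - \<epsilon>) * x C * (\<Prod>C'\<in>nbhd2 \<Phi> C. 1 - x C')"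
    using assms(1) 0 by (auto simp: lll_witness_def)
  have "(\<Prod>C'\<in>nbhd2 \<Phi> C. 1 - x C') \<le> 1"
    using assms(1) by (intro prod_le_1) (auto simp: lll_witness_def nbhd2_def closed_nbhd2_def less_imp_le)
  then have "(1 - \<epsilon>) * x C * (\<Prod>C'\<in>nbhd2 \<Phi> C. 1 - x C') \<le> (1 - \<epsilon>) * x C * 1"
    using w by (intro mult_left_mono) auto
  also have "\<dots> \<le> (1 - \<epsilon>) * (x C / (1 - x C))" using w by (simp add: field_simps)
  finally show ?case using lll by (simp add: chain_sum_def weight_def mult.assoc)
next
  case (Suc m)
  let ?q = "1 - \<epsilon>" and ?G = "closed_nbhd2 \<Phi> C"
  have w: "0 < \<epsilon>" "\<epsilon> < 1" "0 < x C" "x C < 1"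
    and lll: "2 * real (card C) * (1 / 2) ^ card C \<le> ?q * x C * (\<Prod>C'\<in>nbhd2 \<Phi> C. 1 - x C')"
    using assms(1) Suc.prems by (auto simp: lll_witness_def)
  have xs: "0 < x D \<and> x D < 1" if "D \<in> ?G" for D
    using assms(1) that by (auto simp: lll_witness_def closed_nbhd2_def)
  have finG: "finite ?G" using hypergraph_finite_edges[OF hyper] by (simp add: closed_nbhd2_def)
  have CG: "C \<in> ?G" using Suc.prems(1) hyper by (auto simp: closed_nbhd2_def hypergraph_def)
  have "(\<Sum>n'\<in>near (C, i). chain_sum m n') = (\<Sum>D\<in>?G. \<Sum>j\<in>{j\<in>{i..<i + 2 * N}. \<sigma> j \<in> D}. chain_sum m (D, j))"
  proof -
    have "near (C, i) = Sigma ?G (\<lambda>D. {j\<in>{i..<i + 2 * N}. \<sigma> j \<in> D})" by (auto simp: near_def)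
    then show ?thesis using finG by (simp add: sum.Sigma)
  qed
  also have "\<dots> \<le> (\<Sum>D\<in>?G. ?q ^ Suc m * (x D / (1 - x D)))"
  proof (rule sum_mono)
    fix D assume D: "D \<in> ?G"
    then have DE: "D \<in> edges \<Phi>" by (simp add: closed_nbhd2_def)
    \<comment> \<open>The denominator \<open>2 * card D\<close> in \<open>?B\<close> will cancel
      against the number of times at which \<open>D\<close> can be entered.\<close>
    let ?J = "{j\<in>{i..<i + 2 * N}. \<sigma> j \<in> D}" and ?B = "?q ^ Suc m * (x D / (1 - x D)) / (2 * card D)"
    have "D \<noteq> {}" "finite D" using DE hyper finite_edge by (auto simp: hypergraph_def)
    then have cD: "card D > 0" by (simp add: card_gt_0_iff)
    have "(\<Sum>j\<in>?J. chain_sum m (D, j)) \<le> (\<Sum>j\<in>?J. ?B)"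
    proof (rule sum_mono)
      fix j assume "j \<in> ?J"
      then have "2 * card D * chain_sum m (D, j) \<le> ?q ^ Suc m * (x D / (1 - x D))"
        using Suc.IH[OF DE] Suc.prems(2) by simp
      then show "chain_sum m (D, j) \<le> ?B" using cD by (subst pos_le_divide_eq) (auto simp: mult.commute)
    qed
    also have "\<dots> = card ?J * ?B" by simp
    also have "\<dots> \<le> (2 * card D) * ?B"
      using card_window2[OF Suc.prems(2) \<open>finite D\<close>] w xs[OF D]
      by (intro mult_right_mono) (auto simp flip: of_nat_mult)
    also have "\<dots> = ?q ^ Suc m * (x D / (1 - x D))" using cD by simp
    finally show "(\<Sum>j\<in>?J. chain_sum m (D, j)) \<le> ?q ^ Suc m * (x D / (1 - x D))" .
  qed
  finally have near: "(\<Sum>n'\<in>near (C, i). chain_sum m n') \<le> ?q ^ Suc m * (\<Sum>D\<in>?G. x D / (1 - x D))"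
    by (simp only: sum_distrib_left)
  have S0: "0 \<le> (\<Sum>D\<in>?G. x D / (1 - x D))" using xs by (intro sum_nonneg) (auto simp: less_imp_le)
  \<comment> \<open>Completing the product by the factor of \<open>C\<close> itself turns
    \<open>x C\<close> into the odds \<open>x C / (1 - x C)\<close>; the odds summed over the closed
    neighbourhood are then absorbed by the completed product.\<close>
  have P: "(\<Prod>D\<in>?G. 1 - x D) = (1 - x C) * (\<Prod>C'\<in>nbhd2 \<Phi> C. 1 - x C')"
    unfolding nbhd2_def by (rule prod.remove[OF finG CG])
  have "2 * card C * chain_sum (Suc m) (C, i) \<le> 2 * card C * ((1/2) ^ card C * (\<Sum>n'\<in>near (C, i). chain_sum m n'))"
    by (simp add: chain_sum_Suc)
  also have "\<dots> = (2 * real (card C) * (1/2) ^ card C) * (\<Sum>n'\<in>near (C, i). chain_sum m n')" by simp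
  also have "\<dots> \<le> (?q * x C * (\<Prod>C'\<in>nbhd2 \<Phi> C. 1 - x C')) * (?q ^ Suc m * (\<Sum>D\<in>?G. x D / (1 - x D)))"
    by (rule mult_mono'[OF lll near]) (auto intro!: sum_nonneg chain_sum_nonneg)
  also have "\<dots> = ?q ^ Suc (Suc m) * (x C / (1 - x C)) * ((\<Sum>D\<in>?G. x D / (1 - x D)) * (\<Prod>D\<in>?G. 1 - x D))"
    unfolding P using w by simp
  also have "\<dots> \<le> ?q ^ Suc (Suc m) * (x C / (1 - x C)) * 1"
    using sum_odds_le_prod[of ?G x, OF finG] xs w by (intro mult_left_mono) auto
  finally show ?case by simp
qed

text \<open>A disagreement at index 0 yields a walk whose head lies in the first window behind
  \<open>s\<close>; the remaining \<open>2 * m + 1\<close> windows leave room for \<open>m\<close>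
  jumps. The estimate is a union bound over heads and chains with disjoint slots.\<close>

theorem coalescence_decay:
  assumes "lll_witness \<Phi> \<epsilon> x"
  shows "coin.prob {\<omega>. \<not> coalesced \<Phi> \<sigma> (snth \<omega>) (s + 2 * Suc m * N)}
    \<le> (1 - \<epsilon>) ^ Suc m * (\<Sum>C\<in>edges \<Phi>. x C / (1 - x C))"
proof -
  let ?K = "s + 2 * Suc m * N" and ?E = "edges \<Phi>"
  define J where "J C = {i\<in>{s..<s + N}. \<sigma> i \<in> C}" for C
  define G where "G C i = {l\<in>node_chains m (C, i). sorted_wrt (\<lambda>a b. slots a \<inter> slots b = {}) l}" for C i
  define W where "W l = {\<omega>. \<forall>n\<in>set l. \<forall>j\<in>slots n. \<omega> !! j}" for l
  have finE: "finite ?E" by (rule hypergraph_finite_edges[OF hyper])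
  have finG: "finite (G C i)" for C i by (simp add: G_def finite_node_chains)
  \<comment> \<open>Even the last node of a chain is entered more than a window before the horizon,
    so all its slots were performed and the guard in \<open>node\<close> is void.\<close>
  have valid: "fst n \<in> ?E \<and> s \<le> snd n \<and> snd n + N < ?K" if "C \<in> ?E" "i \<in> J C" "l \<in> G C i" "n \<in> set l" for C i l n
    using node_chains_nodes[of l m "(C, i)" n] that by (auto simp: G_def J_def)
  have Wset: "W l \<in> sets coin_space" if "C \<in> ?E" "i \<in> J C" "l \<in> G C i" for C i l
    unfolding W_def
  proof (rule finitary_event[of ?K "\<lambda>c. \<forall>n\<in>set l. \<forall>j\<in>slots n. c j"])
    have "j < ?K" if "n \<in> set l" "j \<in> slots n" for n j
      using valid[OF \<open>C \<in> ?E\<close> \<open>i \<in> J C\<close> \<open>l \<in> G C i\<close> that(1)] slots_props(2)[of "fst n" "snd n" j] that(2) by auto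
    then show "finitary ?K (\<lambda>c. \<forall>n\<in>set l. \<forall>j\<in>slots n. c j)" by (auto simp: finitary_def)
  qed
  have "{\<omega>. \<not> coalesced \<Phi> \<sigma> (snth \<omega>) ?K} \<subseteq> (\<Union>C\<in>?E. \<Union>i\<in>J C. \<Union>l\<in>G C i. W l)"
  proof
    fix \<omega> assume "\<omega> \<in> {\<omega>. \<not> coalesced \<Phi> \<sigma> (snth \<omega>) ?K}"
    then have "fst (pair_at (snth \<omega>) ?K 0) \<noteq> snd (pair_at (snth \<omega>) ?K 0)"
      by (simp add: coalesced_def pair_at_def)
    moreover have "fst (pair_at (snth \<omega>) ?K 0) \<subseteq> snd (pair_at (snth \<omega>) ?K 0)"
      unfolding pair_at_def by (rule bsim_subset) simp
    ultimately obtain u where u: "discrepant (snth \<omega>) ?K u 0" by (auto simp: discrepant_def)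
    have "u \<in> verts \<Phi>"
      using u bsim_range[of "({}, verts \<Phi>)" "verts \<Phi>" \<sigma> ?E "snth \<omega>" 0 ?K] sched_verts
      by (auto simp: discrepant_def pair_at_def)
    then obtain j where j: "j < s + N" "\<sigma> j = u" using sched_all by blast
    define i where "i = next_time u 0"
    note i = next_time[OF le0 j(2), folded i_def]
    have iK: "i < ?K" using i(3) j by simp
    have disc: "discrepant (snth \<omega>) ?K (\<sigma> i) i"
      using u pair_at_keep[of 0 i ?K u "snth \<omega>"] i iK by (simp add: discrepant_def)
    \<comment> \<open>An isolated vertex lies in no edge, so an update of it cannot be blocked and
      leaves no disagreement.\<close>
    have "s \<le> i"
    proof (rule ccontr)
      assume "\<not> s \<le> i"
      then have "\<sigma> i \<notin> \<Union>?E" using sched_isolated by simp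
      then show False using discrepant_update[OF disc iK] by blast
    qed
    then obtain ns where ns: "ns \<noteq> []" "snd (hd ns) = i" "\<forall>n\<in>set ns. node (snth \<omega>) ?K n" "successively link ns" "?K < snd (last ns) + N"
      using discrepant_walk[OF disc iK] by blast
    obtain C where C: "hd ns = (C, i)" using ns(2) by (metis prod.collapse)
    have "node (snth \<omega>) ?K (C, i)" using ns C by (metis hd_in_set)
    then have CE: "C \<in> ?E" and iJ: "i \<in> J C"
      using \<open>s \<le> i\<close> i j by (auto simp: node_def J_def)
    obtain l where l: "l \<in> node_chains m (C, i)" "set l \<subseteq> set ns" "sorted_wrt (\<lambda>a b. slots a \<inter> slots b = {}) l"
      using select_chain[OF ns(1,3,4,5), of m] C i(3) j by (auto simp: algebra_simps)
    have lG: "l \<in> G C i" using l by (simp add: G_def)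
    have "\<omega> \<in> W l"
      unfolding W_def
    proof (intro CollectI ballI)
      fix n j assume n: "n \<in> set l" "j \<in> slots n"
      have "j < ?K" using valid[OF CE iJ lG n(1)] slots_props(2)[of "fst n" "snd n" j] n(2) by auto
      then show "\<omega> !! j" using ns(3) l(2) n by (auto simp: node_def)
    qed
    then show "\<omega> \<in> (\<Union>C\<in>?E. \<Union>i\<in>J C. \<Union>l\<in>G C i. W l)" using CE iJ lG by blast
  qed
  then have "coin.prob {\<omega>. \<not> coalesced \<Phi> \<sigma> (snth \<omega>) ?K} \<le> coin.prob (\<Union>C\<in>?E. \<Union>i\<in>J C. \<Union>l\<in>G C i. W l)"
    using Wset finE finG by (intro coin.finite_measure_mono) (auto simp: J_def intro!: sets.finite_UN)
  also have "\<dots> \<le> (\<Sum>C\<in>?E. coin.prob (\<Union>i\<in>J C. \<Union>l\<in>G C i. W l))"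
    using Wset finE finG by (intro measure_UNION_le) (auto simp: J_def intro!: sets.finite_UN)
  also have "\<dots> \<le> (\<Sum>C\<in>?E. \<Sum>i\<in>J C. coin.prob (\<Union>l\<in>G C i. W l))"
    using Wset finG by (intro sum_mono measure_UNION_le) (auto simp: J_def intro!: sets.finite_UN)
  also have "\<dots> \<le> (\<Sum>C\<in>?E. \<Sum>i\<in>J C. \<Sum>l\<in>G C i. coin.prob (W l))"
    using Wset finG by (intro sum_mono measure_UNION_le) auto
  also have "\<dots> \<le> (\<Sum>C\<in>?E. \<Sum>i\<in>J C. chain_sum m (C, i))"
  proof (intro sum_mono)
    fix C i assume C: "C \<in> ?E" and i: "i \<in> J C"
    have "(\<Sum>l\<in>G C i. coin.prob (W l)) = (\<Sum>l\<in>G C i. weight l)"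
      using valid[OF C i] unfolding W_def by (intro sum.cong refl chain_prob) (auto simp: G_def)
    also have "\<dots> \<le> chain_sum m (C, i)"
      unfolding chain_sum_def by (intro sum_mono2) (auto simp: G_def finite_node_chains weight_def)
    finally show "(\<Sum>l\<in>G C i. coin.prob (W l)) \<le> chain_sum m (C, i)" .
  qed
  also have "\<dots> \<le> (\<Sum>C\<in>?E. (1 - \<epsilon>) ^ Suc m * (x C / (1 - x C)))"
  proof (rule sum_mono)
    fix C assume C: "C \<in> ?E"
    have nn: "0 \<le> (1 - \<epsilon>) ^ Suc m * (x C / (1 - x C))"
      using assms C by (auto simp: lll_witness_def less_imp_le)
    have c: "card C > 0" using C finite_edge[OF C] hyper by (auto simp: hypergraph_def card_gt_0_iff)
    have "(\<Sum>i\<in>J C. chain_sum m (C, i)) \<le> (\<Sum>i\<in>J C. (1 - \<epsilon>) ^ Suc m * (x C / (1 - x C)) / (2 * card C))"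
    proof (rule sum_mono)
      fix i assume "i \<in> J C"
      then have "2 * card C * chain_sum m (C, i) \<le> (1 - \<epsilon>) ^ Suc m * (x C / (1 - x C))"
        using chain_sum_bound[OF assms C] by (simp add: J_def)
      then show "chain_sum m (C, i) \<le> (1 - \<epsilon>) ^ Suc m * (x C / (1 - x C)) / (2 * card C)"
        using c by (subst pos_le_divide_eq) (auto simp: mult.commute)
    qed
    also have "\<dots> = card (J C) * ((1 - \<epsilon>) ^ Suc m * (x C / (1 - x C)) / (2 * card C))" by simp
    also have "\<dots> \<le> (2 * card C) * ((1 - \<epsilon>) ^ Suc m * (x C / (1 - x C)) / (2 * card C))"
      using card_window[OF order_refl finite_edge[OF C]] unfolding J_def
      by (intro mult_right_mono divide_nonneg_nonneg nn) auto
    also have "\<dots> = (1 - \<epsilon>) ^ Suc m * (x C / (1 - x C))" using c by simp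
    finally show "(\<Sum>i\<in>J C. chain_sum m (C, i)) \<le> (1 - \<epsilon>) ^ Suc m * (x C / (1 - x C))" .
  qed
  finally show ?thesis by (simp only: sum_distrib_left)
qed

end

section \<open>Reasoning about machine programs\<close>

text \<open>Total correctness with a step budget, witnessed by a halting run; as execution is
  deterministic, this is the only run.\<close>

definition wp :: "com \<Rightarrow> nat \<Rightarrow> (state \<Rightarrow> bool) \<Rightarrow> state \<Rightarrow> bool" where
  "wp c T Q s \<longleftrightarrow> (\<exists>t s'. exec c s t s' \<and> t \<le> T \<and> Q s')"

lemma wp_mono: "wp c T Q s \<Longrightarrow> T \<le> T' \<Longrightarrow> (\<And>s. Q s \<Longrightarrow> Q' s) \<Longrightarrow> wp c T' Q' s"
  unfolding wp_def by (meson order.trans)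

lemma wp_Seq:
  assumes "wp c T\<^sub>1 P s" "\<And>s'. P s' \<Longrightarrow> wp d T\<^sub>2 Q s'" "T\<^sub>1 + T\<^sub>2 \<le> T"
  shows "wp (Seq c d) T Q s"
proof -
  obtain t s' u s'' where "exec c s t s'" "t \<le> T\<^sub>1" "exec d s' u s''" "u \<le> T\<^sub>2" "Q s''"
    using assms(1,2) unfolding wp_def by blast
  then show ?thesis using assms(3) exec.Seq[of c s t s' d u s''] unfolding wp_def
    by (intro exI[of _ "t + u"] exI[of _ s'']) auto
qed

lemma wp_If_nz:
  assumes "fst s r \<noteq> 0 \<Longrightarrow> wp c T Q s" "fst s r = 0 \<Longrightarrow> wp d T Q s" "T + 1 \<le> T'"
  shows "wp (If_nz r c d) T' Q s"
proof (cases "fst s r = 0")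
  case True
  then obtain t s' where "exec d s t s'" "t \<le> T" "Q s'" using assms(2) unfolding wp_def by blast
  then show ?thesis using True assms(3) exec.If_False[of s r d t s' c] unfolding wp_def
    by (intro exI[of _ "t + 1"] exI[of _ s']) auto
next
  case False
  then obtain t s' where "exec c s t s'" "t \<le> T" "Q s'" using assms(1) unfolding wp_def by blast
  then show ?thesis using False assms(3) exec.If_True[of s r c t s' d] unfolding wp_def
    by (intro exI[of _ "t + 1"] exI[of _ s']) auto
qed

text \<open>The invariant is indexed by the number of completed iterations, whose total
  \<open>n\<close> is known beforehand. Each iteration pays one extra step for its test, and the
  final 1 is the failing test.\<close>

lemma wp_While:
  assumes "I 0 s"
    and step: "\<And>k s. k < n \<Longrightarrow> I k s \<Longrightarrow> fst s r \<noteq> 0 \<and> wp c (f k) (I (Suc k)) s"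
    and exit: "\<And>s. I n s \<Longrightarrow> fst s r = 0 \<and> Q s"
    and T: "(\<Sum>k<n. f k + 1) + 1 \<le> T"
  shows "wp (While_nz r c) T Q s"
proof -
  have "\<exists>t s'. exec (While_nz r c) s t s' \<and> t \<le> (\<Sum>k\<in>{j..<n}. f k + 1) + 1 \<and> Q s'" if "j \<le> n" "I j s" for j s
    using that
  proof (induction "n - j" arbitrary: j s)
    case 0
    then have "I n s" by simp
    then have "exec (While_nz r c) s 1 s \<and> 1 \<le> (\<Sum>k\<in>{j..<n}. f k + 1) + 1 \<and> Q s"
      using exit[of s] exec.While_False[of s r c] by simp
    then show ?case by blast
  next
    case (Suc l)
    then have j: "j < n" by simp
    obtain t s' where t: "fst s r \<noteq> 0" "exec c s t s'" "t \<le> f j" "I (Suc j) s'"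
      using step[OF j Suc.prems(2)] unfolding wp_def by blast
    obtain u s'' where u: "exec (While_nz r c) s' u s''" "u \<le> (\<Sum>k\<in>{Suc j..<n}. f k + 1) + 1" "Q s''"
    proof -
      have "l = n - Suc j" using Suc.hyps(2) by simp
      then show ?thesis using Suc.hyps(1)[of "Suc j" s'] j t(4) that by (meson Suc_leI)
    qed
    have "t + u + 1 \<le> (\<Sum>k\<in>{j..<n}. f k + 1) + 1"
      using t(3) u(2) j by (simp add: sum.atLeast_Suc_lessThan)
    then show ?case using exec.While_True[OF t(1,2) u(1)] u(3) by blast
  qed
  from this[of 0 s] assms(1) T show ?thesis
    unfolding wp_def atLeast0LessThan using order.trans by fastforce
qed

text \<open>The trailing copy does nothing; it only makes the empty block a program.\<close>
fun instrs :: "instr list \<Rightarrow> com" where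
  "instrs [] = Instr (ICopy 0 0)"
| "instrs (i # is) = Seq (Instr i) (instrs is)"

lemma exec_instrs: "exec (instrs is) s (length is + 1) (fold instr_step is s)"
proof (induction "is" arbitrary: s)
  case Nil
  show ?case using exec.Instr[of "ICopy 0 0" s] by (cases s) simp
next
  case (Cons i "is")
  show ?case using exec.Seq[OF exec.Instr[of i s] Cons.IH[of "instr_step i s"]] by simp
qed

lemma wp_instrs: "Q (fold instr_step is s) \<Longrightarrow> length is + 1 \<le> T \<Longrightarrow> wp (instrs is) T Q s"
  unfolding wp_def using exec_instrs by blast

section \<open>The sampling program\<close>

text \<open>
  Registers 0 to 9 hold the base addresses \<open>k * R\<close> of ten arrays: 0 the input; 1 and 2 the heads and
  successors of the incidence lists, whose cells are the input positions of the vertices; 3 the edge of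
  a list cell; 4 and 5 the number of vertices of an edge that are missing from the lower and the upper
  bound; 6 and 7 the indicators of the two bounds; 8 the non-isolated vertices; 9 the coins.
  Register 10 is 1, register 11 the number of vertices, register 22 the number of non-isolated ones,
  register 23 is nonzero while the bounds differ, 24 counts the coins flipped and 25 those to be flipped
  next, 30 is the current vertex and 33 its coin. An update first removes
  the vertex from both bounds; an edge then blocks it exactly if the counter of the edge is 1.
\<close>

definition set_vertex_body :: "nat \<Rightarrow> nat \<Rightarrow> instr list" where
  "set_vertex_body kc r = [IAdd 42 3 41, ILoad 42 42, IAdd 42 kc 42, ILoad 43 42, IAdd 43 43 40,
     ISub 43 43 r, IStore 42 43, IAdd 41 2 41, ILoad 41 41]"

definition set_vertex :: "nat \<Rightarrow> nat \<Rightarrow> nat \<Rightarrow> com" where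
  "set_vertex kv kc r =
     Seq (instrs [IAdd 40 kv 30, ILoad 40 40, IAdd 41 1 30, ILoad 41 41])
    (Seq (While_nz 41 (instrs (set_vertex_body kc r)))
         (instrs [IAdd 42 kv 30, IStore 42 r]))"

text \<open>With truncated subtraction \<open>1 - (m - 1)\<close> is nonzero exactly for
  \<open>m \<le> 1\<close>. The tested vertex has been removed before, so \<open>m \<ge> 1\<close>,
  and \<open>m = 1\<close> says that it alone is missing.\<close>

definition test_blocked_body :: "nat \<Rightarrow> nat \<Rightarrow> instr list" where
  "test_blocked_body kc r = [IAdd 42 3 41, ILoad 42 42, IAdd 42 kc 42, ILoad 43 42, ISub 43 43 10,
     ISub 43 10 43, IAdd r r 43, IAdd 41 2 41, ILoad 41 41]"

definition test_blocked :: "nat \<Rightarrow> nat \<Rightarrow> com" where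
  "test_blocked kc r =
     Seq (instrs [IConst r 0, IAdd 41 1 30, ILoad 41 41])
         (While_nz 41 (instrs (test_blocked_body kc r)))"

text \<open>Register 0 is the base of array 0 and hence a constant zero. Truncated subtraction of
  the blocking count from the coin is the conjunction of heads with being unblocked.\<close>

definition update_pair :: com where
  "update_pair =
     Seq (set_vertex 6 4 0) (Seq (set_vertex 7 5 0) (Seq (test_blocked 4 31) (Seq (test_blocked 5 32)
    (Seq (instrs [ISub 34 33 32, ISub 35 33 31]) (Seq (set_vertex 6 4 34) (set_vertex 7 5 35))))))"

text \<open>The index in register 20 runs downwards, from the far past to the present. Register 21
  is that index modulo the length of the scan, maintained by a decrement that wraps around because
  the machine has no division.\<close>

definition sim_body :: com where
  "sim_body = Seq (instrs [ISub 20 20 10]) (Seq (If_nz 21 (instrs []) (instrs [ICopy 21 22]))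
     (Seq (instrs [ISub 21 21 10, IAdd 30 8 21, ILoad 30 30, IAdd 33 9 20, ILoad 33 33]) update_pair))"

definition init_body :: com where
  "init_body = Seq (instrs [ISub 20 20 10, IAdd 30 8 20, ILoad 30 30]) (Seq (set_vertex 6 4 0) (set_vertex 7 5 10))"

definition compare_body :: com where
  "compare_body = instrs [ISub 20 20 10, IAdd 30 8 20, ILoad 30 30, IAdd 34 6 30, ILoad 34 34,
     IAdd 35 7 30, ILoad 35 35, ISub 35 35 34, IAdd 23 23 35]"

definition flip_body :: com where
  "flip_body = instrs [IFlip 33, IAdd 34 9 24, IStore 34 33, IAdd 24 24 10, ISub 25 25 10]"

text \<open>The horizon is a multiple of the scan length, so register 21 may start at 0. The final
  copy makes the next round flip as many coins as exist already, which doubles the horizon.\<close>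

definition cftp_round :: com where
  "cftp_round = Seq (While_nz 25 flip_body) (Seq (instrs [ICopy 20 22]) (Seq (While_nz 20 init_body)
     (Seq (instrs [ICopy 20 24, IConst 21 0]) (Seq (While_nz 20 sim_body)
     (Seq (instrs [ICopy 20 22, IConst 23 0]) (Seq (While_nz 20 compare_body) (instrs [ICopy 25 24])))))))"

definition measure_body :: com where
  "measure_body = instrs [ILoad 15 13, IAdd 13 13 15, IAdd 13 13 10, ISub 14 14 10]"

text \<open>The stride of the arrays has to exceed all vertices, edge numbers and input positions.
  The length of the input is not given; following the edge headers finds its end, and repeated
  addition replaces multiplication.\<close>

definition prelude :: com where
  "prelude = Seq (instrs [IConst 10 1, ILoad 11 0, ILoad 12 10, IAdd 13 10 10, ICopy 14 12])
    (Seq (While_nz 14 measure_body)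
    (instrs [IAdd 1 13 11, IAdd 2 1 1, IAdd 3 2 1, IAdd 4 3 1, IAdd 5 4 1, IAdd 6 5 1, IAdd 7 6 1,
       IAdd 8 7 1, IAdd 9 8 1, IAdd 13 10 10, IConst 14 0, ICopy 15 12]))"

text \<open>The input position of an occurrence of a vertex doubles as its list cell, so nothing is
  allocated. Zero can mark the end of a list because positions 0 and 1 hold the two counts.\<close>

definition link_body :: com where
  "link_body = instrs [IAdd 13 13 10, ILoad 18 13, IAdd 19 1 18, ILoad 40 19, IAdd 41 2 13,
     IStore 41 40, IStore 19 13, IAdd 41 3 13, IStore 41 14, ISub 16 16 10]"

definition edge_body :: com where
  "edge_body = Seq (instrs [ILoad 16 13, IAdd 17 4 14, IStore 17 16, IAdd 17 5 14, IStore 17 16])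
    (Seq (While_nz 16 link_body) (instrs [IAdd 13 13 10, IAdd 14 14 10, ISub 15 15 10]))"

definition classify_body :: com where
  "classify_body = Seq (instrs [IAdd 34 1 20, ILoad 34 34])
    (Seq (If_nz 34 (instrs [IAdd 35 8 22, IStore 35 20, IAdd 22 22 10])
                   (instrs [IFlip 33, IAdd 35 6 20, IStore 35 33, IAdd 35 7 20, IStore 35 33]))
         (instrs [IAdd 20 20 10, ISub 21 21 10]))"

text \<open>Array 0 has base 0, so register 20 is itself the address; the vector overwrites the
  input.\<close>

definition output_body :: com where
  "output_body = instrs [ISub 20 20 10, IAdd 34 6 20, ILoad 34 34, IStore 20 34]"

definition sampler :: com where
  "sampler = Seq prelude (Seq (While_nz 15 edge_body)
    (Seq (instrs [IConst 20 0, ICopy 21 11, IConst 22 0]) (Seq (While_nz 21 classify_body)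
    (Seq (instrs [IConst 23 1, IConst 24 0, ICopy 25 22]) (Seq (While_nz 23 cftp_round)
    (Seq (instrs [ICopy 20 11]) (While_nz 20 output_body)))))))"

section \<open>Memory layout\<close>

locale layout =
  fixes n :: nat and es :: "nat list list" and R :: nat
  assumes wf: "e \<in> set es \<Longrightarrow> distinct e \<and> set e \<subseteq> {..<n}"
    and R: "R = length (encode n es) + n"
begin

definition adr :: "nat \<Rightarrow> nat \<Rightarrow> nat" where "adr k i = k * R + i"

text \<open>The coins, array 9, are the only array without a length bound.\<close>
definition cell :: "nat \<Rightarrow> nat \<Rightarrow> bool" where "cell k i \<longleftrightarrow> k < 9 \<and> i < R \<or> k = 9"

definition bases :: "(nat \<Rightarrow> nat) \<Rightarrow> bool" where
  "bases \<rho> \<longleftrightarrow> (\<forall>k\<le>9. \<rho> k = k * R) \<and> \<rho> 10 = 1 \<and> \<rho> 11 = n"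

text \<open>A frame condition: \<open>K\<close> lists the arrays that may have been written.\<close>

definition agree :: "nat set \<Rightarrow> (nat \<Rightarrow> nat) \<Rightarrow> (nat \<Rightarrow> nat) \<Rightarrow> bool" where
  "agree K \<mu> \<mu>' \<longleftrightarrow> (\<forall>k i. cell k i \<longrightarrow> k \<notin> K \<longrightarrow> \<mu>' (adr k i) = \<mu> (adr k i))"

definition edge :: "nat \<Rightarrow> nat set" where "edge k = set (es ! k)"

text \<open>Reversed, since cells are prepended while the edges are read in increasing
  order.\<close>

definition inc :: "nat \<Rightarrow> nat list" where
  "inc v = rev (filter (\<lambda>k. v \<in> edge k) [0..<length es])"

text \<open>The bound \<open>q\<close> on the cells serves the construction: with \<open>q\<close>
  the next input position, a new cell cannot lie on an old list.\<close>

fun linked :: "(nat \<Rightarrow> nat) \<Rightarrow> nat \<Rightarrow> nat \<Rightarrow> nat list \<Rightarrow> bool" where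
  "linked \<mu> q p [] \<longleftrightarrow> p = 0"
| "linked \<mu> q p (k # ks) \<longleftrightarrow> 0 < p \<and> p < q \<and> \<mu> (adr 3 p) = k \<and> linked \<mu> q (\<mu> (adr 2 p)) ks"

definition incidence :: "(nat \<Rightarrow> nat) \<Rightarrow> bool" where
  "incidence \<mu> \<longleftrightarrow> (\<forall>v<n. linked \<mu> R (\<mu> (adr 1 v)) (inc v))"

definition stores :: "nat \<Rightarrow> nat \<Rightarrow> (nat \<Rightarrow> nat) \<Rightarrow> nat set \<Rightarrow> bool" where
  "stores kv kc \<mu> X \<longleftrightarrow> (\<forall>v<n. \<mu> (adr kv v) = of_bool (v \<in> X)) \<and>
     (\<forall>k<length es. \<mu> (adr kc k) = card (edge k - X))"

definition stores2 :: "(nat \<Rightarrow> nat) \<Rightarrow> nat set \<times> nat set \<Rightarrow> bool" where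
  "stores2 \<mu> P \<longleftrightarrow> stores 6 4 \<mu> (fst P) \<and> stores 7 5 \<mu> (snd P)"

text \<open>Division with remainder by \<open>R\<close>; the unbounded coin array causes no overlap
  because it comes last.\<close>

lemma adr_inject [simp]: "cell k i \<Longrightarrow> cell k' i' \<Longrightarrow> adr k i = adr k' i' \<longleftrightarrow> k = k' \<and> i = i'"
proof -
  have main: "k = k'" if "cell k i" "cell k' i'" "k * R + i = k' * R + i'" "k \<le> k'" for k k' i i'
  proof (rule ccontr)
    assume "k \<noteq> k'"
    then have "k + 1 \<le> k'" using that(4) by simp
    then have "(k + 1) * R \<le> k' * R" by (rule mult_le_mono1)
    moreover have "i < R" using that \<open>k \<noteq> k'\<close> by (auto simp: cell_def)
    ultimately show False using that(3) by simp
  qed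
  show "cell k i \<Longrightarrow> cell k' i' \<Longrightarrow> adr k i = adr k' i' \<longleftrightarrow> k = k' \<and> i = i'"
    unfolding adr_def using main[of k i k' i'] main[of k' i' k i] by (cases "k \<le> k'") auto
qed

lemma length_encode: "length (encode n es) = 2 + (\<Sum>e\<leftarrow>es. length e + 1)"
  by (simp add: encode_def length_concat comp_def)

lemma n_less_R: "n < R" and len_less_R: "length es < R"
proof -
  have "length es \<le> (\<Sum>e\<leftarrow>es. length e + 1)" by (induction es) auto
  then show "length es < R" using R length_encode by simp
  show "n < R" using R length_encode by simp
qed

lemma cells [simp]:
  "k < 9 \<Longrightarrow> v < n \<Longrightarrow> cell k v" "k < 9 \<Longrightarrow> v < length es \<Longrightarrow> cell k v"
  "k < 9 \<Longrightarrow> v < R \<Longrightarrow> cell k v" "cell 9 v"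
  using n_less_R len_less_R by (auto simp: cell_def)

lemma base_add:
  assumes "bases \<rho>"
  shows "k \<le> 9 \<Longrightarrow> \<rho> k + x = adr k x" "\<rho> 10 = 1" "\<rho> 11 = n" "\<rho> 0 = 0"
  using assms by (auto simp: bases_def adr_def)

lemma bases_cong: "bases \<rho> \<Longrightarrow> (\<And>r. r < 12 \<Longrightarrow> \<rho>' r = \<rho> r) \<Longrightarrow> bases \<rho>'"
  by (simp add: bases_def)

lemma agree_refl: "agree K \<mu> \<mu>" by (simp add: agree_def)

lemma agree_trans: "agree K \<mu> \<mu>' \<Longrightarrow> agree K' \<mu>' \<mu>'' \<Longrightarrow> K \<subseteq> L \<Longrightarrow> K' \<subseteq> L \<Longrightarrow> agree L \<mu> \<mu>''"
  unfolding agree_def by (metis subsetD)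

lemma agreeD: "agree K \<mu> \<mu>' \<Longrightarrow> cell k i \<Longrightarrow> k \<notin> K \<Longrightarrow> \<mu>' (adr k i) = \<mu> (adr k i)"
  by (simp add: agree_def)

lemma agree_upd: "agree K \<mu> \<mu>' \<Longrightarrow> k \<in> K \<Longrightarrow> cell k i \<Longrightarrow> agree K \<mu> (\<mu>'(adr k i := x))"
  by (auto simp: agree_def)

lemma linked_agree:
  assumes "agree K \<mu> \<mu>'" "2 \<notin> K" "3 \<notin> K" "linked \<mu> q p ks" "q \<le> R"
  shows "linked \<mu>' q p ks"
  using assms by (induction ks arbitrary: p) (auto simp: agreeD)

lemma incidence_agree:
  assumes "agree K \<mu> \<mu>'" "1 \<notin> K" "2 \<notin> K" "3 \<notin> K" "incidence \<mu>"
  shows "incidence \<mu>'"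
  unfolding incidence_def
proof (intro allI impI)
  fix v assume "v < n"
  then show "linked \<mu>' R (\<mu>' (adr 1 v)) (inc v)"
    using assms agreeD[OF assms(1), of 1 v] by (auto simp: incidence_def intro: linked_agree[OF assms(1)])
qed

lemma stores_agree: "agree K \<mu> \<mu>' \<Longrightarrow> kv \<notin> K \<Longrightarrow> kc \<notin> K \<Longrightarrow> kv < 9 \<Longrightarrow> kc < 9 \<Longrightarrow> stores kv kc \<mu> X \<Longrightarrow> stores kv kc \<mu>' X"
  by (simp add: stores_def agreeD)

lemma linked_drop:
  assumes "linked \<mu> q p (drop j ks)" "j < length ks"
  shows "0 < p" "p < q" "\<mu> (adr 3 p) = ks ! j" "linked \<mu> q (\<mu> (adr 2 p)) (drop (Suc j) ks)"
  using assms by (simp_all add: Cons_nth_drop_Suc[symmetric])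

lemma finite_edge: "finite (edge k)"
  by (simp add: edge_def)

lemma inc_props: "distinct (inc v)" "k \<in> set (inc v) \<longleftrightarrow> k < length es \<and> v \<in> edge k"
  by (auto simp: inc_def)

section \<open>Moving one vertex\<close>

definition put :: "bool \<Rightarrow> nat \<Rightarrow> nat set \<Rightarrow> nat set" where
  "put b v X = (if b then insert v X else X - {v})"

text \<open>The truncated subtraction is exact: as \<open>v \<in> A\<close>, either
  \<open>v \<in> X\<close> or \<open>v\<close> is counted in \<open>card (A - X)\<close>, so the sum
  before it is positive.\<close>

lemma card_put:
  assumes "finite A" "v \<in> A"
  shows "card (A - put b v X) = card (A - X) + of_bool (v \<in> X) - of_bool b"
proof -
  have 1: "card (A - (X - {v})) = card (A - X) + of_bool (v \<in> X)"
  proof (cases "v \<in> X")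
    case True
    have "A - (X - {v}) = insert v (A - X)" using assms True by auto
    then show ?thesis using True assms by simp
  qed simp
  have "A - insert v X = (A - (X - {v})) - {v}" by auto
  then have "card (A - insert v X) = card (A - (X - {v})) - 1" using assms by simp
  then show ?thesis using 1 by (simp add: put_def)
qed

text \<open>Within the loop the counters of visited edges already belong to the new set and all
  others to the old one. Edges off the incidence list do not contain \<open>v\<close>, so their
  counts agree for both sets. Only registers from 40 on serve as scratch.\<close>

lemma wp_set_vertex:
  assumes b: "bases \<rho>" and i: "incidence \<mu>" and st: "stores kv kc \<mu> X"
    and v: "\<rho> 30 = v" "v < n" and r: "\<rho> r = of_bool b" "r < 40"
    and k: "4 \<le> kv" "kv \<le> 7" "4 \<le> kc" "kc \<le> 7" "kv \<noteq> kc"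
  shows "wp (set_vertex kv kc r) (11 * length (inc v) + 9)
    (\<lambda>(\<rho>', \<mu>', \<omega>'). \<omega>' = \<omega> \<and> (\<forall>r<40. \<rho>' r = \<rho> r) \<and> agree {kv, kc} \<mu> \<mu>' \<and> stores kv kc \<mu>' (put b v X)) (\<rho>, \<mu>, \<omega>)" (is "wp _ _ ?Q _")
proof -
  define I where "I j = (\<lambda>(\<rho>', \<mu>', \<omega>'). \<omega>' = \<omega> \<and> (\<forall>r<40. \<rho>' r = \<rho> r) \<and> agree {kc} \<mu> \<mu>' \<and>
     \<rho>' 40 = of_bool (v \<in> X) \<and> linked \<mu> R (\<rho>' 41) (drop j (inc v)) \<and>
     (\<forall>k<length es. \<mu>' (adr kc k) = card (edge k - (if k \<in> set (take j (inc v)) then put b v X else X))))" for j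
  note ba = base_add[OF b]
  have loop: "wp (While_nz 41 (instrs (set_vertex_body kc r))) (11 * length (inc v) + 1) (I (length (inc v))) s"
    if "I 0 s" for s
  proof (rule wp_While[where I = I and n = "length (inc v)" and f = "\<lambda>_. 10"])
    fix j and s :: state assume j: "j < length (inc v)" and I: "I j s"
    obtain \<rho>' \<mu>' \<omega>' where s: "s = (\<rho>', \<mu>', \<omega>')" by (cases s) auto
    have \<rho>: "\<forall>r<40. \<rho>' r = \<rho> r" and ag: "agree {kc} \<mu> \<mu>'" and old: "\<rho>' 40 = of_bool (v \<in> X)"
      and li: "linked \<mu> R (\<rho>' 41) (drop j (inc v))"
      and cn: "\<forall>k<length es. \<mu>' (adr kc k) = card (edge k - (if k \<in> set (take j (inc v)) then put b v X else X))"
      and om: "\<omega>' = \<omega>"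
      using I by (auto simp: I_def s)
    have "bases \<rho>'" using bases_cong[OF b] \<rho> by simp
    note ba' = base_add[OF this]
    define p where "p = \<rho>' 41"
    define e where "e = inc v ! j"
    note l = linked_drop[OF li j, folded p_def e_def]
    have e: "e < length es" "v \<in> edge e" using inc_props(2)[of e v] j nth_mem[OF j] by (auto simp: e_def)
    \<comment> \<open>Distinctness of the list guarantees that the counter about to be changed still
      holds its old value.\<close>
    have ntake: "e \<notin> set (take j (inc v))"
      using inc_props(1)[of v] j unfolding e_def
      by (auto simp: distinct_conv_nth in_set_conv_nth)
    have 3: "\<mu>' (adr 3 p) = e" using agreeD[OF ag, of 3 p] l k by simp
    have 2: "\<mu>' (adr 2 p) = \<mu> (adr 2 p)" using agreeD[OF ag, of 2 p] l k by simp
    have z: "\<mu>' (adr kc e) = card (edge e - X)" using cn e ntake by simp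
    have rr: "\<rho>' r = of_bool b" using \<rho> r by simp
    have rneq: "r \<noteq> 40" "r \<noteq> 41" "r \<noteq> 42" "r \<noteq> 43" "kc \<noteq> 41" "kc \<noteq> 42" "kc \<noteq> 43" "2 \<noteq> kc" "3 \<noteq> kc" using r k by auto
    let ?x = "card (edge e - X) + of_bool (v \<in> X) - of_bool b"
    have x: "?x = card (edge e - put b v X)" using card_put[OF finite_edge e(2)] by simp
    have st: "fold instr_step (set_vertex_body kc r) s =
       (\<rho>'(42 := adr kc e, 43 := ?x, 41 := \<mu> (adr 2 p)), \<mu>'(adr kc e := ?x), \<omega>')"
      using l e k rneq by (auto simp: set_vertex_body_def s ba' p_def[symmetric] 3 2 z rr old fun_upd_twist)
    have "I (Suc j) (fold instr_step (set_vertex_body kc r) s)"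
      unfolding I_def st prod.case
    proof (intro conjI allI impI)
      fix k' assume k': "k' < length es"
      have "set (take (Suc j) (inc v)) = insert e (set (take j (inc v)))"
        using j by (simp add: take_Suc_conv_app_nth e_def)
      then show "(\<mu>'(adr kc e := ?x)) (adr kc k') = card (edge k' - (if k' \<in> set (take (Suc j) (inc v)) then put b v X else X))"
        using cn k' e k x by auto
    qed (use om \<rho> old l e k in \<open>auto intro: agree_upd[OF ag]\<close>)
    then have "wp (instrs (set_vertex_body kc r)) 10 (I (Suc j)) s"
      by (rule wp_instrs) (simp add: set_vertex_body_def)
    then show "fst s 41 \<noteq> 0 \<and> wp (instrs (set_vertex_body kc r)) 10 (I (Suc j)) s"
      using l(1) by (simp add: s p_def)
  qed (use that in \<open>auto simp: I_def\<close>)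
  have kn: "kv \<noteq> 41" "kv \<noteq> 40" "kv \<noteq> 42" "kv \<le> 9" "kc \<le> 9" using k by auto
  have first: "wp (instrs [IAdd 40 kv 30, ILoad 40 40, IAdd 41 1 30, ILoad 41 41]) 5 (I 0) (\<rho>, \<mu>, \<omega>)"
  proof (rule wp_instrs)
    have "fold instr_step [IAdd 40 kv 30, ILoad 40 40, IAdd 41 1 30, ILoad 41 41] (\<rho>, \<mu>, \<omega>) =
        (\<rho>(40 := of_bool (v \<in> X), 41 := \<mu> (adr 1 v)), \<mu>, \<omega>)"
      using st v kn by (simp add: ba stores_def)
    then show "I 0 (fold instr_step [IAdd 40 kv 30, ILoad 40 40, IAdd 41 1 30, ILoad 41 41] (\<rho>, \<mu>, \<omega>))"
      using st i v by (auto simp: I_def agree_refl stores_def incidence_def)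
  qed simp
  have last: "wp (instrs [IAdd 42 kv 30, IStore 42 r]) 3
    ?Q s"
    if "I (length (inc v)) s" for s
  proof (rule wp_instrs)
    obtain \<rho>' \<mu>' \<omega>' where s': "s = (\<rho>', \<mu>', \<omega>')" by (cases s) auto
    then have s: "s = (\<rho>', \<mu>', \<omega>)" and \<rho>: "\<forall>r<40. \<rho>' r = \<rho> r" and ag: "agree {kc} \<mu> \<mu>'"
      and cn: "\<forall>k<length es. \<mu>' (adr kc k) = card (edge k - (if k \<in> set (inc v) then put b v X else X))"
      using that by (auto simp: I_def)
    have "bases \<rho>'" using bases_cong[OF b] \<rho> by simp
    note ba' = base_add[OF this]
    have eq: "fold instr_step [IAdd 42 kv 30, IStore 42 r] s = (\<rho>'(42 := adr kv v), \<mu>'(adr kv v := of_bool b), \<omega>)"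
      using \<rho> v r kn by (simp add: s ba)
    have "stores kv kc (\<mu>'(adr kv v := of_bool b)) (put b v X)"
      unfolding stores_def
    proof (intro conjI allI impI)
      fix u assume u: "u < n"
      have "\<mu>' (adr kv u) = of_bool (u \<in> X)" using agreeD[OF ag, of kv u] st u k by (simp add: stores_def)
      then show "(\<mu>'(adr kv v := of_bool b)) (adr kv u) = of_bool (u \<in> put b v X)"
        using u v(2) k by (auto simp: put_def)
    next
      fix k' assume k': "k' < length es"
      have "edge k' - put b v X = edge k' - X" if "k' \<notin> set (inc v)"
        using that inc_props(2)[of k' v] k' by (auto simp: put_def)
      then show "(\<mu>'(adr kv v := of_bool b)) (adr kc k') = card (edge k' - put b v X)"
        using cn k' k v(2) by auto
    qed
    moreover have "agree {kv, kc} \<mu> (\<mu>'(adr kv v := of_bool b))"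
      using agree_upd[OF agree_trans[OF ag agree_refl[of "{kv, kc}"], of "{kv, kc}"], of kv v "of_bool b"] k v by simp
    ultimately show "case fold instr_step [IAdd 42 kv 30, IStore 42 r] s of
        (\<rho>', \<mu>', \<omega>') \<Rightarrow> \<omega>' = \<omega> \<and> (\<forall>r<40. \<rho>' r = \<rho> r) \<and> agree {kv, kc} \<mu> \<mu>' \<and> stores kv kc \<mu>' (put b v X)"
      unfolding eq using \<rho> by auto
  qed simp
  show ?thesis
    unfolding set_vertex_def
    by (rule wp_Seq[OF first wp_Seq[OF loop last order_refl]]) simp_all
qed

definition blocked :: "nat \<Rightarrow> nat set \<Rightarrow> bool" where
  "blocked v X \<longleftrightarrow> (\<exists>k<length es. v \<in> edge k \<and> edge k - {v} \<subseteq> X)"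

lemma wp_test_blocked:
  assumes b: "bases \<rho>" and i: "incidence \<mu>" and st: "stores kv kc \<mu> X"
    and v: "\<rho> 30 = v" "v < n" "v \<notin> X" and r: "30 < r" "r < 40" and k: "4 \<le> kc" "kc \<le> 7"
  shows "wp (test_blocked kc r) (11 * length (inc v) + 5)
    (\<lambda>(\<rho>', \<mu>', \<omega>'). \<omega>' = \<omega> \<and> \<mu>' = \<mu> \<and> (\<forall>q<40. q \<noteq> r \<longrightarrow> \<rho>' q = \<rho> q) \<and> (\<rho>' r \<noteq> 0 \<longleftrightarrow> blocked v X)) (\<rho>, \<mu>, \<omega>)" (is "wp _ _ ?Q _")
proof -
  define I where "I j = (\<lambda>(\<rho>', \<mu>', \<omega>'). \<omega>' = \<omega> \<and> \<mu>' = \<mu> \<and> (\<forall>q<40. q \<noteq> r \<longrightarrow> \<rho>' q = \<rho> q) \<and>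
     linked \<mu> R (\<rho>' 41) (drop j (inc v)) \<and>
     (\<rho>' r \<noteq> 0 \<longleftrightarrow> (\<exists>k\<in>set (take j (inc v)). edge k - {v} \<subseteq> X)))" for j
  note ba = base_add[OF b]
  have loop: "wp (While_nz 41 (instrs (test_blocked_body kc r))) (11 * length (inc v) + 1)
    ?Q s"
    if "I 0 s" for s
  proof (rule wp_While[where I = I and n = "length (inc v)" and f = "\<lambda>_. 10"])
    fix j and s :: state assume j: "j < length (inc v)" and I: "I j s"
    obtain \<rho>' \<mu>' \<omega>' where s': "s = (\<rho>', \<mu>', \<omega>')" by (cases s) auto
    then have \<rho>: "\<forall>q<40. q \<noteq> r \<longrightarrow> \<rho>' q = \<rho> q" and s: "s = (\<rho>', \<mu>, \<omega>)"
      and li: "linked \<mu> R (\<rho>' 41) (drop j (inc v))"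
      and acc: "\<rho>' r \<noteq> 0 \<longleftrightarrow> (\<exists>k\<in>set (take j (inc v)). edge k - {v} \<subseteq> X)"
      using I by (auto simp: I_def)
    have "bases \<rho>'" using bases_cong[OF b] \<rho> r by simp
    note ba' = base_add[OF this]
    define p where "p = \<rho>' 41"
    define e where "e = inc v ! j"
    note l = linked_drop[OF li j, folded p_def e_def]
    have e: "e < length es" "v \<in> edge e" using inc_props(2)[of e v] j nth_mem[OF j] by (auto simp: e_def)
    have z: "\<mu> (adr kc e) = card (edge e - X)" using st e by (simp add: stores_def)
    have rneq: "r \<noteq> 41" "r \<noteq> 42" "r \<noteq> 43" "r \<noteq> 2" "r \<noteq> 10" "kc \<noteq> 41" "kc \<noteq> 42" "kc \<noteq> 43" using r k by auto
    let ?x = "1 - (card (edge e - X) - 1)"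
    \<comment> \<open>The vertex \<open>v\<close> itself is missing from \<open>X\<close>; what is
      left decides whether the edge blocks.\<close>
    have "card (edge e - X) = Suc (card (edge e - X - {v}))"
      using e v finite_edge[of e] by (intro card.remove) auto
    moreover have "card (edge e - X - {v}) = 0 \<longleftrightarrow> edge e - {v} \<subseteq> X"
      using finite_edge[of e] by auto
    ultimately have x: "?x \<noteq> 0 \<longleftrightarrow> edge e - {v} \<subseteq> X" by linarith
    have st: "fold instr_step (test_blocked_body kc r) s =
       (\<rho>'(42 := adr kc e, 43 := ?x, r := \<rho>' r + ?x, 41 := \<mu> (adr 2 p)), \<mu>, \<omega>)"
      using l k rneq by (simp add: test_blocked_body_def s ba' p_def[symmetric] z)
    have "I (Suc j) (fold instr_step (test_blocked_body kc r) s)"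
    proof -
      have "set (take (Suc j) (inc v)) = insert e (set (take j (inc v)))"
        using j by (simp add: take_Suc_conv_app_nth e_def)
      then show ?thesis unfolding I_def st prod.case using \<rho> l rneq acc x by auto
    qed
    then have "wp (instrs (test_blocked_body kc r)) 10 (I (Suc j)) s"
      by (rule wp_instrs) (simp add: test_blocked_body_def)
    then show "fst s 41 \<noteq> 0 \<and> wp (instrs (test_blocked_body kc r)) 10 (I (Suc j)) s"
      using l(1) by (simp add: s p_def)
  next
    fix s assume "I (length (inc v)) s"
    then show "fst s 41 = 0 \<and> ?Q s"
      by (auto simp: I_def blocked_def inc_props)
  qed (use that in auto)
  have first: "wp (instrs [IConst r 0, IAdd 41 1 30, ILoad 41 41]) 4 (I 0) (\<rho>, \<mu>, \<omega>)"
    by (rule wp_instrs) (use i v r in \<open>auto simp: I_def incidence_def ba\<close>)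
  show ?thesis unfolding test_blocked_def by (rule wp_Seq[OF first loop]) simp_all
qed

section \<open>One update of the bounding pair\<close>

definition Es :: "nat set set" where "Es = set ` set es"

lemma Es_eq: "Es = edge ` {..<length es}"
proof -
  have "set es = (!) es ` {..<length es}" by (auto simp: set_conv_nth)
  then show ?thesis by (simp add: Es_def edge_def image_image)
qed

lemma blocked_iff: "blocked v X \<longleftrightarrow> (\<exists>C\<in>Es. v \<in> C \<and> C - {v} \<subseteq> X)"
  unfolding blocked_def Es_eq by auto

text \<open>Removing \<open>v\<close> first does not affect blocking, which only looks at
  \<open>C - {v}\<close>, and both tests precede both insertions, as the simultaneous update
  demands. Four moves and two tests give \<open>66 = 6 * 11\<close> and
  \<open>49 = 4 * 9 + 2 * 5 + 3\<close>.\<close>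

lemma wp_update_pair:
  assumes b: "bases \<rho>" and i: "incidence \<mu>" and st: "stores2 \<mu> P"
    and v: "\<rho> 30 = v" "v < n" and c: "\<rho> 33 = of_bool c"
  shows "wp update_pair (66 * length (inc v) + 49)
    (\<lambda>(\<rho>', \<mu>', \<omega>'). \<omega>' = \<omega> \<and> (\<forall>r\<le>30. \<rho>' r = \<rho> r) \<and> agree {4, 5, 6, 7} \<mu> \<mu>' \<and> stores2 \<mu>' (upd2 Es v c P)) (\<rho>, \<mu>, \<omega>)"
proof -
  obtain L U where P: "P = (L, U)" by fastforce
  have put2: "put c' v (X - {v}) = put c' v X" for c' X by (auto simp: put_def)
  define J where "J \<mu>' A B = (incidence \<mu>' \<and> agree {4, 5, 6, 7} \<mu> \<mu>' \<and> stores 6 4 \<mu>' A \<and> stores 7 5 \<mu>' B)" for \<mu>' A B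
  have J_lower: "J \<mu>' A' B" if "J \<mu>1 A B" "agree {6, 4} \<mu>1 \<mu>'" "stores 6 4 \<mu>' A'" for \<mu>1 \<mu>' A A' B
    using that incidence_agree[OF that(2)] stores_agree[OF that(2), of 7 5 B] agree_trans[OF _ that(2), of "{4,5,6,7}" \<mu>]
    by (simp add: J_def)
  have J_upper: "J \<mu>' A B'" if "J \<mu>1 A B" "agree {7, 5} \<mu>1 \<mu>'" "stores 7 5 \<mu>' B'" for \<mu>1 \<mu>' A B B'
    using that incidence_agree[OF that(2)] stores_agree[OF that(2), of 6 4 A] agree_trans[OF _ that(2), of "{4,5,6,7}" \<mu>]
    by (simp add: J_def)
  have JD: "incidence \<mu>'" "stores 6 4 \<mu>' A" "stores 7 5 \<mu>' B" if "J \<mu>' A B" for \<mu>' A B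
    using that by (auto simp: J_def)
  have lower: "wp (set_vertex 6 4 r) (11 * length (inc v) + 9) (\<lambda>(\<rho>', \<mu>', \<omega>'). \<omega>' = \<omega> \<and> (\<forall>r<40. \<rho>' r = \<rho>1 r) \<and> J \<mu>' (put b' v A) B) (\<rho>1, \<mu>1, \<omega>)"
    if "bases \<rho>1" "J \<mu>1 A B" "\<rho>1 30 = v" "\<rho>1 r = of_bool b'" "r < 40" for r b' A B \<rho>1 \<mu>1
    by (rule wp_mono[OF wp_set_vertex[OF that(1) JD(1,2)[OF that(2)] that(3) v(2) that(4,5)] order_refl])
      (use J_lower[OF that(2)] in auto)
  have upper: "wp (set_vertex 7 5 r) (11 * length (inc v) + 9) (\<lambda>(\<rho>', \<mu>', \<omega>'). \<omega>' = \<omega> \<and> (\<forall>r<40. \<rho>' r = \<rho>1 r) \<and> J \<mu>' A (put b' v B)) (\<rho>1, \<mu>1, \<omega>)"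
    if "bases \<rho>1" "J \<mu>1 A B" "\<rho>1 30 = v" "\<rho>1 r = of_bool b'" "r < 40" for r b' A B \<rho>1 \<mu>1
    by (rule wp_mono[OF wp_set_vertex[OF that(1) JD(1,3)[OF that(2)] that(3) v(2) that(4,5)] order_refl])
      (use J_upper[OF that(2)] in auto)
  define Q where "Q A B = (\<lambda>(\<rho>', \<mu>', \<omega>'). \<omega>' = \<omega> \<and> (\<forall>r\<le>30. \<rho>' r = \<rho> r) \<and> \<rho>' 33 = of_bool c \<and> J \<mu>' A B)" for A B
  have Q_bases: "bases \<rho>1" if "Q A B (\<rho>1, \<mu>1, \<omega>1)" for A B \<rho>1 \<mu>1 \<omega>1
    using that bases_cong[OF b, of \<rho>1] by (auto simp: Q_def)
  let ?L0 = "put False v L" and ?U0 = "put False v U"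
  let ?nl = "c \<and> \<not> blocked v U" and ?nu = "c \<and> \<not> blocked v L"
  have 1: "wp (set_vertex 6 4 0) (11 * length (inc v) + 9) (Q ?L0 U) (\<rho>, \<mu>, \<omega>)"
    by (rule wp_mono[OF lower[where A = L and B = U and b' = False] order_refl])
      (use b i st v c P in \<open>auto simp: Q_def J_def agree_refl stores2_def base_add\<close>)
  have 2: "wp (set_vertex 7 5 0) (11 * length (inc v) + 9) (Q ?L0 ?U0) s" if "Q ?L0 U s" for s
  proof -
    obtain \<rho>1 \<mu>1 where s: "s = (\<rho>1, \<mu>1, \<omega>)" using \<open>Q ?L0 U s\<close> by (cases s) (auto simp: Q_def)
    show ?thesis unfolding s
      by (rule wp_mono[OF upper[where A = ?L0 and B = U and b' = False] order_refl])
        (use that Q_bases[of ?L0 U \<rho>1 \<mu>1 \<omega>] v c in \<open>auto simp: s Q_def base_add\<close>)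
  qed
  define Q1 where "Q1 = (\<lambda>(\<rho>', \<mu>', \<omega>'). Q ?L0 ?U0 (\<rho>', \<mu>', \<omega>') \<and> (\<rho>' 31 \<noteq> 0 \<longleftrightarrow> blocked v L))"
  define Q2 where "Q2 = (\<lambda>(\<rho>', \<mu>', \<omega>'). Q1 (\<rho>', \<mu>', \<omega>') \<and> (\<rho>' 32 \<noteq> 0 \<longleftrightarrow> blocked v U))"
  define Q3 where "Q3 A B = (\<lambda>(\<rho>', \<mu>', \<omega>'). Q A B (\<rho>', \<mu>', \<omega>') \<and> \<rho>' 34 = of_bool ?nl \<and> \<rho>' 35 = of_bool ?nu)" for A B
  have bl0: "blocked v (put False v X) \<longleftrightarrow> blocked v X" for X by (auto simp: blocked_def put_def)
  have 3: "wp (test_blocked 4 31) (11 * length (inc v) + 5) Q1 s" if "Q ?L0 ?U0 s" for s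
  proof -
    obtain \<rho>1 \<mu>1 where s: "s = (\<rho>1, \<mu>1, \<omega>)" using \<open>Q ?L0 ?U0 s\<close> by (cases s) (auto simp: Q_def)
    show ?thesis unfolding s
      by (rule wp_mono[OF wp_test_blocked[where X = ?L0 and v = v and kv = 6] order_refl])
        (use that Q_bases[of ?L0 ?U0 \<rho>1 \<mu>1 \<omega>] v c bl0 in \<open>auto simp: s Q_def Q1_def J_def put_def\<close>)
  qed
  have 4: "wp (test_blocked 5 32) (11 * length (inc v) + 5) Q2 s" if "Q1 s" for s
  proof -
    obtain \<rho>1 \<mu>1 where s: "s = (\<rho>1, \<mu>1, \<omega>)" using \<open>Q1 s\<close> by (cases s) (auto simp: Q1_def Q_def)
    show ?thesis unfolding s
      by (rule wp_mono[OF wp_test_blocked[where X = ?U0 and v = v and kv = 7] order_refl])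
        (use that Q_bases[of ?L0 ?U0 \<rho>1 \<mu>1 \<omega>] v c bl0 in \<open>auto simp: s Q_def Q1_def Q2_def J_def put_def\<close>)
  qed
  have 5: "wp (instrs [ISub 34 33 32, ISub 35 33 31]) 3 (Q3 ?L0 ?U0) s" if "Q2 s" for s
  proof (rule wp_instrs)
    obtain \<rho>1 \<mu>1 where s: "s = (\<rho>1, \<mu>1, \<omega>)" using \<open>Q2 s\<close> by (cases s) (auto simp: Q2_def Q1_def Q_def)
    show "Q3 ?L0 ?U0 (fold instr_step [ISub 34 33 32, ISub 35 33 31] s)"
      using that by (auto simp: s Q_def Q1_def Q2_def Q3_def)
  qed simp
  have 6: "wp (set_vertex 6 4 34) (11 * length (inc v) + 9) (Q3 (put ?nl v L) ?U0) s" if "Q3 ?L0 ?U0 s" for s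
  proof -
    obtain \<rho>1 \<mu>1 where s: "s = (\<rho>1, \<mu>1, \<omega>)" using \<open>Q3 ?L0 ?U0 s\<close> by (cases s) (auto simp: Q3_def Q_def)
    have eq: "put ?nl v ?L0 = put ?nl v L" by (auto simp: put_def)
    show ?thesis unfolding s
      by (rule wp_mono[OF lower[where A = ?L0 and B = ?U0 and b' = ?nl] order_refl])
        (use that Q_bases[of ?L0 ?U0 \<rho>1 \<mu>1 \<omega>] v c eq in \<open>auto simp: s Q_def Q3_def\<close>)
  qed
  have 7: "wp (set_vertex 7 5 35) (11 * length (inc v) + 9) (Q3 (put ?nl v L) (put ?nu v U)) s" if "Q3 (put ?nl v L) ?U0 s" for s
  proof -
    obtain \<rho>1 \<mu>1 where s: "s = (\<rho>1, \<mu>1, \<omega>)" using \<open>Q3 (put ?nl v L) ?U0 s\<close> by (cases s) (auto simp: Q3_def Q_def)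
    have eq: "put ?nu v ?U0 = put ?nu v U" by (auto simp: put_def)
    show ?thesis unfolding s
      by (rule wp_mono[OF upper[where A = "put ?nl v L" and B = ?U0 and b' = ?nu] order_refl])
        (use that Q_bases[of "put ?nl v L" ?U0 \<rho>1 \<mu>1 \<omega>] v c eq in \<open>auto simp: s Q_def Q3_def\<close>)
  qed
  have upd: "upd2 Es v c P = (put ?nl v L, put ?nu v U)"
    by (auto simp: upd2_def upd_def P put_def blocked_iff)
  have "wp update_pair (66 * length (inc v) + 49) (Q3 (put ?nl v L) (put ?nu v U)) (\<rho>, \<mu>, \<omega>)"
    unfolding update_pair_def
    by (rule wp_Seq[OF 1 wp_Seq[OF 2 wp_Seq[OF 3 wp_Seq[OF 4 wp_Seq[OF 5 wp_Seq[OF 6 7 order_refl] order_refl] order_refl] order_refl] order_refl]]) simp_all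
  then show ?thesis
    by (rule wp_mono) (auto simp: Q3_def Q_def J_def upd stores2_def)
qed

section \<open>One round of the sampler\<close>

definition ords :: "nat list" where "ords = filter (\<lambda>v. inc v \<noteq> []) [0..<n]"
definition isos :: "nat list" where "isos = filter (\<lambda>v. inc v = []) [0..<n]"
definition cyc :: "nat \<Rightarrow> nat" where "cyc i = ords ! (i mod length ords)"
text \<open>The total length of the incidence lists visited in a scan, plus one unit per vertex for
  the constant overhead.\<close>

definition scan_cost :: nat where "scan_cost = (\<Sum>j<length ords. length (inc (ords ! j)) + 1)"

lemma ords_less: "j < length ords \<Longrightarrow> ords ! j < n"
  using nth_mem[of j ords] by (auto simp: ords_def)

lemma length_ords_le: "length ords \<le> n"
  using length_filter_le[of "\<lambda>v. inc v \<noteq> []" "[0..<n]"] by (simp add: ords_def)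

definition ready :: "(nat \<Rightarrow> nat) \<Rightarrow> bool" where
  "ready \<mu> \<longleftrightarrow> incidence \<mu> \<and> (\<forall>j<length ords. \<mu> (adr 8 j) = ords ! j)"

definition coins :: "(nat \<Rightarrow> nat) \<Rightarrow> (nat \<Rightarrow> bool) \<Rightarrow> nat \<Rightarrow> bool" where
  "coins \<mu> c l \<longleftrightarrow> (\<forall>i<l. \<mu> (adr 9 i) = of_bool (c i))"

lemma ready_agree:
  assumes "agree K \<mu> \<mu>'" "K \<inter> {1, 2, 3, 8} = {}" "ready \<mu>"
  shows "ready \<mu>'"
  using assms incidence_agree[OF assms(1)] length_ords_le by (auto simp: ready_def agreeD)

lemma coins_agree: "agree K \<mu> \<mu>' \<Longrightarrow> 9 \<notin> K \<Longrightarrow> coins \<mu> c l \<Longrightarrow> coins \<mu>' c l"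
  by (simp add: coins_def agreeD)

lemma ord_cell [simp]: "j < length ords \<Longrightarrow> cell 8 j"
  using length_ords_le by simp

lemma sum_mod_periodic:
  fixes g :: "nat \<Rightarrow> nat"
  shows "(\<Sum>i<T * N. g (i mod N)) = T * (\<Sum>j<N. g j)"
proof -
  have "(\<Sum>i\<in>{m * N..<m * N + N}. g (i mod N)) = (\<Sum>j<N. g j)" for m
    using sum.shift_bounds_nat_ivl[of "\<lambda>i. g (i mod N)" 0 "m * N" N]
    by (simp add: add.commute atLeast0LessThan)
  then show ?thesis using sum.nat_group[of "\<lambda>i. g (i mod N)" N T] by simp
qed

text \<open>After \<open>t\<close> iterations the machine holds the pair at index
  \<open>l - t\<close>. That \<open>l\<close> is a multiple of the scan length makes the initial 0
  in register 21 the correct residue.\<close>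

lemma wp_sim:
  assumes b: "bases \<rho>" and rd: "ready \<mu>" and co: "coins \<mu> c l" and st: "stores2 \<mu> P"
    and r: "\<rho> 20 = l" "\<rho> 21 = 0" "\<rho> 22 = length ords" and l: "l = T * length ords"
  shows "wp (While_nz 20 sim_body) (71 * T * scan_cost + 1)
    (\<lambda>(\<rho>', \<mu>', \<omega>'). \<omega>' = \<omega> \<and> (\<forall>r<30. r \<notin> {20, 21} \<longrightarrow> \<rho>' r = \<rho> r) \<and> agree {4, 5, 6, 7} \<mu> \<mu>' \<and>
       stores2 \<mu>' (bsim Es cyc c 0 l P)) (\<rho>, \<mu>, \<omega>)" (is "wp _ _ ?Q _")
proof -
  define I where "I t = (\<lambda>(\<rho>', \<mu>', \<omega>'). \<omega>' = \<omega> \<and> (\<forall>r<30. r \<notin> {20, 21} \<longrightarrow> \<rho>' r = \<rho> r) \<and> agree {4, 5, 6, 7} \<mu> \<mu>' \<and>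
    \<rho>' 20 = l - t \<and> \<rho>' 21 = (l - t) mod length ords \<and> stores2 \<mu>' (bsim Es cyc c (l - t) t P))" for t
  define f where "f t = 66 * length (inc (cyc (l - Suc t))) + 60" for t
  show ?thesis
  proof (rule wp_While[where I = I and n = l and f = f])
    show "I 0 (\<rho>, \<mu>, \<omega>)" using r l st by (simp add: I_def agree_refl)
  next
    fix t and s :: state assume t: "t < l" and I: "I t s"
    obtain \<rho>1 \<mu>1 \<omega>1 where s: "s = (\<rho>1, \<mu>1, \<omega>1)" by (cases s) auto
    have om: "\<omega>1 = \<omega>" and \<rho>1: "\<forall>r<30. r \<notin> {20, 21} \<longrightarrow> \<rho>1 r = \<rho> r" and ag: "agree {4, 5, 6, 7} \<mu> \<mu>1"
      and r1: "\<rho>1 20 = l - t" "\<rho>1 21 = (l - t) mod length ords" and st1: "stores2 \<mu>1 (bsim Es cyc c (l - t) t P)"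
      using I by (auto simp: I_def s)
    have b1: "bases \<rho>1" using bases_cong[OF b] \<rho>1 by simp
    have rd1: "ready \<mu>1" using ready_agree[OF ag _ rd] by simp
    have co1: "coins \<mu>1 c l" using coins_agree[OF ag _ co] by simp
    define i where "i = l - Suc t"
    define j where "j = i mod length ords"
    have N: "0 < length ords" using t l by (cases "length ords") auto
    have jN: "j < length ords" using N by (simp add: j_def)
    have i: "l - t = Suc i" "i < l" using t by (auto simp: i_def)
    have cyc: "cyc i = ords ! j" by (simp add: cyc_def j_def)
    \<comment> \<open>A residue 0 is replaced by the scan length before the decrement, so that it
      wraps around to the last vertex of the scan.\<close>
    have js: "(if \<rho>1 21 = 0 then length ords else \<rho>1 21) - 1 = j"
      using r1(2) N by (auto simp: i j_def mod_Suc split: if_splits)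
    define \<rho>2 where "\<rho>2 = \<rho>1(20 := i, 21 := j, 30 := ords ! j, 33 := of_bool (c i))"
    have A1: "wp (instrs [ISub 20 20 10]) 2 (\<lambda>s. s = (\<rho>1(20 := i), \<mu>1, \<omega>)) s"
      using b1 r1 i by (intro wp_instrs) (auto simp: s om base_add)
    have A2: "wp (If_nz 21 (instrs []) (instrs [ICopy 21 22])) 3
        (\<lambda>s. s = (\<rho>1(20 := i, 21 := if \<rho>1 21 = 0 then length ords else \<rho>1 21), \<mu>1, \<omega>)) s'"
      if "s' = (\<rho>1(20 := i), \<mu>1, \<omega>)" for s'
      by (rule wp_If_nz[where T = 2]; (rule wp_instrs)?) (use that \<rho>1 r(3) in \<open>auto simp: fun_eq_iff\<close>)
    have A3: "wp (instrs [ISub 21 21 10, IAdd 30 8 21, ILoad 30 30, IAdd 33 9 20, ILoad 33 33]) 6 (\<lambda>s. s = (\<rho>2, \<mu>1, \<omega>)) s'"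
      if "s' = (\<rho>1(20 := i, 21 := if \<rho>1 21 = 0 then length ords else \<rho>1 21), \<mu>1, \<omega>)" for s'
    proof (rule wp_instrs)
      show "fold instr_step [ISub 21 21 10, IAdd 30 8 21, ILoad 30 30, IAdd 33 9 20, ILoad 33 33] s' = (\<rho>2, \<mu>1, \<omega>)"
        using js jN i rd1 co1 unfolding that
        by (simp add: base_add[OF b1] \<rho>2_def ready_def coins_def fun_upd_twist del: One_nat_def)
    qed simp
    have A4: "wp update_pair (66 * length (inc (ords ! j)) + 49) (I (Suc t)) s'" if "s' = (\<rho>2, \<mu>1, \<omega>)" for s'
    proof -
      have b2: "bases \<rho>2" using bases_cong[OF b1] by (simp add: \<rho>2_def)
      have in1: "incidence \<mu>1" using rd1 by (simp add: ready_def)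
      have "wp update_pair (66 * length (inc (ords ! j)) + 49)
        (\<lambda>(\<rho>', \<mu>', \<omega>'). \<omega>' = \<omega> \<and> (\<forall>r\<le>30. \<rho>' r = \<rho>2 r) \<and> agree {4, 5, 6, 7} \<mu>1 \<mu>' \<and>
          stores2 \<mu>' (upd2 Es (ords ! j) (c i) (bsim Es cyc c (l - t) t P))) (\<rho>2, \<mu>1, \<omega>)"
        by (rule wp_update_pair[OF b2 in1 st1 _ ords_less[OF jN]]) (simp_all add: \<rho>2_def)
      then show ?thesis unfolding that
      proof (rule wp_mono)
        fix s assume H: "case s of (\<rho>', \<mu>', \<omega>') \<Rightarrow> \<omega>' = \<omega> \<and> (\<forall>r\<le>30. \<rho>' r = \<rho>2 r) \<and> agree {4, 5, 6, 7} \<mu>1 \<mu>' \<and>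
          stores2 \<mu>' (upd2 Es (ords ! j) (c i) (bsim Es cyc c (l - t) t P))"
        have "upd2 Es (ords ! j) (c i) (bsim Es cyc c (l - t) t P) = bsim Es cyc c (l - Suc t) (Suc t) P"
          using i by (simp add: cyc i_def[symmetric])
        then show "I (Suc t) s"
          using H \<rho>1 agree_trans[OF ag, of "{4,5,6,7}" _ "{4,5,6,7}"]
          by (auto simp: I_def \<rho>2_def i_def[symmetric] j_def[symmetric])
      qed simp
    qed
    have "wp sim_body (f t) (I (Suc t)) s"
      unfolding sim_body_def
      by (rule wp_Seq[OF A1 wp_Seq[OF A2 wp_Seq[OF A3 A4 order_refl] order_refl]]) (simp_all add: f_def cyc i_def[symmetric])
    then show "fst s 20 \<noteq> 0 \<and> wp sim_body (f t) (I (Suc t)) s" using r1 t by (simp add: s)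
  next
    fix s :: state assume "I l s"
    then show "fst s 20 = 0 \<and> ?Q s"
      by (auto simp: I_def)
  next
    have f1: "f t + 1 = 66 * length (inc (cyc (l - Suc t))) + 61" for t by (simp add: f_def)
    have "(\<Sum>t<l. f t + 1) = (\<Sum>i<l. 66 * length (inc (cyc i)) + 61)"
      unfolding f1 by (rule sum.nat_diff_reindex)
    also have "\<dots> \<le> (\<Sum>i<l. 71 * (length (inc (ords ! (i mod length ords))) + 1))"
      by (intro sum_mono) (simp add: cyc_def)
    also have "\<dots> = T * (\<Sum>j<length ords. 71 * (length (inc (ords ! j)) + 1))"
      unfolding l by (rule sum_mod_periodic)
    also have "\<dots> = 71 * T * scan_cost" by (simp add: scan_cost_def sum_distrib_left algebra_simps)
    finally show "(\<Sum>t<l. f t + 1) + 1 \<le> 71 * T * scan_cost + 1" by simp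
  qed
qed

text \<open>Only the vertices of the scan are reset; the isolated ones keep the coins drawn in
  preprocessing.\<close>

lemma wp_init:
  assumes b: "bases \<rho>" and rd: "ready \<mu>" and st: "stores2 \<mu> (L, U)" and r: "\<rho> 20 = length ords"
  shows "wp (While_nz 20 init_body) (23 * scan_cost + 1)
    (\<lambda>(\<rho>', \<mu>', \<omega>'). \<omega>' = \<omega> \<and> (\<forall>r<30. r \<noteq> 20 \<longrightarrow> \<rho>' r = \<rho> r) \<and> agree {4, 5, 6, 7} \<mu> \<mu>' \<and>
       stores2 \<mu>' (L - set ords, U \<union> set ords)) (\<rho>, \<mu>, \<omega>)" (is "wp _ _ ?Q _")
proof -
  let ?N = "length ords"
  define I where "I t = (\<lambda>(\<rho>', \<mu>', \<omega>'). \<omega>' = \<omega> \<and> (\<forall>r<30. r \<noteq> 20 \<longrightarrow> \<rho>' r = \<rho> r) \<and> agree {4, 5, 6, 7} \<mu> \<mu>' \<and>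
    \<rho>' 20 = ?N - t \<and> stores2 \<mu>' (L - set (drop (?N - t) ords), U \<union> set (drop (?N - t) ords)))" for t
  define f where "f t = 22 * (length (inc (ords ! (?N - Suc t))) + 1)" for t
  show ?thesis
  proof (rule wp_While[where I = I and n = ?N and f = f])
    show "I 0 (\<rho>, \<mu>, \<omega>)" using r st by (simp add: I_def agree_refl)
  next
    fix t and s :: state assume t: "t < ?N" and I: "I t s"
    obtain \<rho>1 \<mu>1 \<omega>1 where s: "s = (\<rho>1, \<mu>1, \<omega>1)" by (cases s) auto
    let ?L = "L - set (drop (?N - t) ords)" and ?U = "U \<union> set (drop (?N - t) ords)"
    have om: "\<omega>1 = \<omega>" and \<rho>1: "\<forall>r<30. r \<noteq> 20 \<longrightarrow> \<rho>1 r = \<rho> r" and ag: "agree {4, 5, 6, 7} \<mu> \<mu>1"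
      and r1: "\<rho>1 20 = ?N - t" and st1: "stores 6 4 \<mu>1 ?L" "stores 7 5 \<mu>1 ?U"
      using I by (auto simp: I_def s stores2_def)
    have b1: "bases \<rho>1" using bases_cong[OF b] \<rho>1 by simp
    have rd1: "ready \<mu>1" using ready_agree[OF ag _ rd] by simp
    then have in1: "incidence \<mu>1" by (simp add: ready_def)
    define i where "i = ?N - Suc t"
    have i: "?N - t = Suc i" "i < ?N" using t by (auto simp: i_def)
    define v where "v = ords ! i"
    have vn: "v < n" using ords_less[OF i(2)] by (simp add: v_def)
    define \<rho>2 where "\<rho>2 = \<rho>1(20 := i, 30 := v)"
    have b2: "bases \<rho>2" using bases_cong[OF b1] by (simp add: \<rho>2_def)
    have A1: "wp (instrs [ISub 20 20 10, IAdd 30 8 20, ILoad 30 30]) 4 (\<lambda>s. s = (\<rho>2, \<mu>1, \<omega>)) s"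
      using r1 i rd1 by (intro wp_instrs) (auto simp: s om base_add[OF b1] \<rho>2_def ready_def v_def)
    have A2: "wp (set_vertex 6 4 0) (11 * length (inc v) + 9)
        (\<lambda>(\<rho>', \<mu>', \<omega>'). \<omega>' = \<omega> \<and> (\<forall>r<40. \<rho>' r = \<rho>2 r) \<and> agree {6, 4} \<mu>1 \<mu>' \<and> stores 6 4 \<mu>' (put False v ?L)) s'"
      if "s' = (\<rho>2, \<mu>1, \<omega>)" for s'
      unfolding that by (rule wp_set_vertex[OF b2 in1 st1(1) _ vn]) (auto simp: \<rho>2_def base_add[OF b1])
    have A3: "wp (set_vertex 7 5 10) (11 * length (inc v) + 9) (I (Suc t)) s'"
      if H: "(\<lambda>(\<rho>', \<mu>', \<omega>'). \<omega>' = \<omega> \<and> (\<forall>r<40. \<rho>' r = \<rho>2 r) \<and> agree {6, 4} \<mu>1 \<mu>' \<and> stores 6 4 \<mu>' (put False v ?L)) s'" for s'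
    proof -
      obtain \<rho>3 \<mu>3 where s': "s' = (\<rho>3, \<mu>3, \<omega>)" and \<rho>3: "\<forall>r<40. \<rho>3 r = \<rho>2 r" and ag3: "agree {6, 4} \<mu>1 \<mu>3"
        and st3: "stores 6 4 \<mu>3 (put False v ?L)" using H by (cases s') auto
      have b3: "bases \<rho>3" using bases_cong[OF b2] \<rho>3 by simp
      have in3: "incidence \<mu>3" using incidence_agree[OF ag3 _ _ _ in1] by simp
      have u3: "stores 7 5 \<mu>3 ?U" using stores_agree[OF ag3 _ _ _ _ st1(2)] by simp
      have "wp (set_vertex 7 5 10) (11 * length (inc v) + 9)
        (\<lambda>(\<rho>', \<mu>', \<omega>'). \<omega>' = \<omega> \<and> (\<forall>r<40. \<rho>' r = \<rho>3 r) \<and> agree {7, 5} \<mu>3 \<mu>' \<and> stores 7 5 \<mu>' (put True v ?U)) (\<rho>3, \<mu>3, \<omega>)"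
        by (rule wp_set_vertex[OF b3 in3 u3 _ vn]) (use \<rho>3 base_add[OF b3] in \<open>auto simp: \<rho>2_def\<close>)
      then show ?thesis unfolding s'
      proof (rule wp_mono)
        fix s assume H: "case s of (\<rho>', \<mu>', \<omega>') \<Rightarrow> \<omega>' = \<omega> \<and> (\<forall>r<40. \<rho>' r = \<rho>3 r) \<and> agree {7, 5} \<mu>3 \<mu>' \<and> stores 7 5 \<mu>' (put True v ?U)"
        obtain \<rho>4 \<mu>4 where s: "s = (\<rho>4, \<mu>4, \<omega>)" and \<rho>4: "\<forall>r<40. \<rho>4 r = \<rho>3 r" and ag4: "agree {7, 5} \<mu>3 \<mu>4"
          and st4: "stores 7 5 \<mu>4 (put True v ?U)" using H by (cases s) auto
        have "stores 6 4 \<mu>4 (put False v ?L)" using stores_agree[OF ag4 _ _ _ _ st3] by simp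
        moreover have "agree {4, 5, 6, 7} \<mu>1 \<mu>4" using agree_trans[OF ag3 ag4, of "{4,5,6,7}"] by simp
        then have "agree {4, 5, 6, 7} \<mu> \<mu>4" using agree_trans[OF ag, of "{4,5,6,7}" \<mu>4 "{4,5,6,7}"] by simp
        moreover have "drop i ords = v # drop (Suc i) ords" using i by (simp add: Cons_nth_drop_Suc v_def)
        then have "put False v ?L = L - set (drop i ords)" "put True v ?U = U \<union> set (drop i ords)"
          by (auto simp: put_def i)
        ultimately show "I (Suc t) s"
          using st4 \<rho>4 \<rho>3 \<rho>1 by (simp add: I_def s stores2_def \<rho>2_def i_def[symmetric])
      qed simp
    qed
    have "wp init_body (f t) (I (Suc t)) s"
      unfolding init_body_def by (rule wp_Seq[OF A1 wp_Seq[OF A2 A3 order_refl]]) (simp_all add: f_def i_def[symmetric] v_def)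
    then show "fst s 20 \<noteq> 0 \<and> wp init_body (f t) (I (Suc t)) s" using r1 t by (simp add: s)
  next
    fix s :: state assume "I ?N s"
    then show "fst s 20 = 0 \<and> ?Q s"
      by (auto simp: I_def)
  next
    have "(\<Sum>t<?N. f t + 1) = (\<Sum>i<?N. 22 * (length (inc (ords ! i)) + 1) + 1)"
      unfolding f_def by (rule sum.nat_diff_reindex)
    also have "\<dots> \<le> 23 * scan_cost" unfolding scan_cost_def sum_distrib_left by (intro sum_mono) simp
    finally show "(\<Sum>t<?N. f t + 1) + 1 \<le> 23 * scan_cost + 1" by simp
  qed
qed

text \<open>Register 23 accumulates truncated differences and thus detects one direction of
  disagreement only, which is enough as the lower bound is contained in the upper one.\<close>

lemma wp_compare:
  assumes b: "bases \<rho>" and rd: "ready \<mu>" and st: "stores2 \<mu> P" and r: "\<rho> 20 = length ords" "\<rho> 23 = 0"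
  shows "wp (While_nz 20 compare_body) (11 * length ords + 1)
    (\<lambda>(\<rho>', \<mu>', \<omega>'). \<omega>' = \<omega> \<and> (\<forall>r<30. r \<notin> {20, 23} \<longrightarrow> \<rho>' r = \<rho> r) \<and> \<mu>' = \<mu> \<and>
       (\<rho>' 23 \<noteq> 0 \<longleftrightarrow> (\<exists>v\<in>set ords. v \<in> snd P \<and> v \<notin> fst P))) (\<rho>, \<mu>, \<omega>)" (is "wp _ _ ?Q _")
proof -
  let ?N = "length ords"
  define I where "I t = (\<lambda>(\<rho>', \<mu>', \<omega>'). \<omega>' = \<omega> \<and> (\<forall>r<30. r \<notin> {20, 23} \<longrightarrow> \<rho>' r = \<rho> r) \<and> \<mu>' = \<mu> \<and>
    \<rho>' 20 = ?N - t \<and> (\<rho>' 23 \<noteq> 0 \<longleftrightarrow> (\<exists>v\<in>set (drop (?N - t) ords). v \<in> snd P \<and> v \<notin> fst P)))" for t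
  show ?thesis
  proof (rule wp_While[where I = I and n = ?N and f = "\<lambda>_. 10"])
    show "I 0 (\<rho>, \<mu>, \<omega>)" using r by (simp add: I_def)
  next
    fix t and s :: state assume t: "t < ?N" and I: "I t s"
    obtain \<rho>1 \<mu>1 \<omega>1 where s1: "s = (\<rho>1, \<mu>1, \<omega>1)" by (cases s) auto
    have \<rho>1: "\<forall>r<30. r \<notin> {20, 23} \<longrightarrow> \<rho>1 r = \<rho> r" and s: "s = (\<rho>1, \<mu>, \<omega>)"
      and r1: "\<rho>1 20 = ?N - t" "\<rho>1 23 \<noteq> 0 \<longleftrightarrow> (\<exists>v\<in>set (drop (?N - t) ords). v \<in> snd P \<and> v \<notin> fst P)"
      using I by (auto simp: I_def s1)
    have b1: "bases \<rho>1" using bases_cong[OF b] \<rho>1 by simp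
    define i where "i = ?N - Suc t"
    have i: "?N - t = Suc i" "i < ?N" using t by (auto simp: i_def)
    define v where "v = ords ! i"
    have vn: "v < n" using ords_less[OF i(2)] by (simp add: v_def)
    have m: "\<mu> (adr 8 i) = v" "\<mu> (adr 6 v) = of_bool (v \<in> fst P)" "\<mu> (adr 7 v) = of_bool (v \<in> snd P)"
      using rd st vn i by (auto simp: ready_def stores2_def stores_def v_def)
    have d: "drop i ords = v # drop (Suc i) ords" using i by (simp add: Cons_nth_drop_Suc v_def)
    let ?is = "[ISub 20 20 10, IAdd 30 8 20, ILoad 30 30, IAdd 34 6 30, ILoad 34 34,
     IAdd 35 7 30, ILoad 35 35, ISub 35 35 34, IAdd 23 23 35]"
    have "fold instr_step ?is s = (\<rho>1(20 := i, 30 := v, 34 := of_bool (v \<in> fst P),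
        35 := of_bool (v \<in> snd P) - of_bool (v \<in> fst P), 23 := \<rho>1 23 + (of_bool (v \<in> snd P) - of_bool (v \<in> fst P))), \<mu>, \<omega>)"
      using r1(1) i by (simp add: s base_add[OF b1] m fun_upd_twist)
    then have "I (Suc t) (fold instr_step ?is s)"
      using r1(2) \<rho>1 d by (auto simp: I_def i i_def[symmetric])
    then have "wp compare_body 10 (I (Suc t)) s"
      unfolding compare_body_def by (rule wp_instrs) simp
    then show "fst s 20 \<noteq> 0 \<and> wp compare_body 10 (I (Suc t)) s" using r1 t by (simp add: s)
  next
    fix s :: state assume "I ?N s"
    then show "fst s 20 = 0 \<and> ?Q s"
      by (auto simp: I_def)
  qed simp
qed

text \<open>The remaining stream lacks exactly the \<open>l\<close> coins already stored, so new
  coins get the same numbers as in the original stream, and the old ones are reused as coupling from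
  the past requires.\<close>

lemma wp_flip:
  assumes b: "bases \<rho>" and co: "coins \<mu> (snth \<omega>) l" and r: "\<rho> 24 = l" "\<rho> 25 = d"
  shows "wp (While_nz 25 flip_body) (7 * d + 1)
    (\<lambda>(\<rho>', \<mu>', \<omega>'). \<omega>' = sdrop (l + d) \<omega> \<and> (\<forall>r<30. r \<notin> {24, 25} \<longrightarrow> \<rho>' r = \<rho> r) \<and> \<rho>' 24 = l + d \<and>
       agree {9} \<mu> \<mu>' \<and> coins \<mu>' (snth \<omega>) (l + d)) (\<rho>, \<mu>, sdrop l \<omega>)" (is "wp _ _ ?Q _")
proof -
  define I where "I t = (\<lambda>(\<rho>', \<mu>', \<omega>'). \<omega>' = sdrop (l + t) \<omega> \<and> (\<forall>r<30. r \<notin> {24, 25} \<longrightarrow> \<rho>' r = \<rho> r) \<and> \<rho>' 24 = l + t \<and>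
    \<rho>' 25 = d - t \<and> agree {9} \<mu> \<mu>' \<and> coins \<mu>' (snth \<omega>) (l + t))" for t
  show ?thesis
  proof (rule wp_While[where I = I and n = d and f = "\<lambda>_. 6"])
    show "I 0 (\<rho>, \<mu>, sdrop l \<omega>)" using r co by (simp add: I_def agree_refl)
  next
    fix t and s :: state assume t: "t < d" and I: "I t s"
    obtain \<rho>1 \<mu>1 \<omega>1 where s: "s = (\<rho>1, \<mu>1, \<omega>1)" by (cases s) auto
    have om: "\<omega>1 = sdrop (l + t) \<omega>" and \<rho>1: "\<forall>r<30. r \<notin> {24, 25} \<longrightarrow> \<rho>1 r = \<rho> r"
      and r1: "\<rho>1 24 = l + t" "\<rho>1 25 = d - t" and ag: "agree {9} \<mu> \<mu>1" and co1: "coins \<mu>1 (snth \<omega>) (l + t)"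
      using I by (auto simp: I_def s)
    have b1: "bases \<rho>1" using bases_cong[OF b] \<rho>1 by simp
    let ?\<mu> = "\<mu>1(adr 9 (l + t) := of_bool (\<omega> !! (l + t)))"
    have eq: "fold instr_step [IFlip 33, IAdd 34 9 24, IStore 34 33, IAdd 24 24 10, ISub 25 25 10] s =
      (\<rho>1(33 := of_bool (\<omega> !! (l + t)), 34 := adr 9 (l + t), 24 := Suc (l + t), 25 := d - Suc t), ?\<mu>, sdrop (Suc (l + t)) \<omega>)"
      using r1 by (simp add: s om base_add[OF b1])
    have "coins ?\<mu> (snth \<omega>) (Suc (l + t))"
      unfolding coins_def
    proof (intro allI impI)
      fix i assume "i < Suc (l + t)"
      then show "?\<mu> (adr 9 i) = of_bool (\<omega> !! i)" using co1 by (cases "i = l + t") (auto simp: coins_def)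
    qed
    moreover have "agree {9} \<mu> ?\<mu>" using agree_upd[OF ag] by simp
    ultimately have "I (Suc t) (fold instr_step [IFlip 33, IAdd 34 9 24, IStore 34 33, IAdd 24 24 10, ISub 25 25 10] s)"
      unfolding eq using \<rho>1 by (simp add: I_def)
    then have "wp flip_body 6 (I (Suc t)) s" unfolding flip_body_def by (rule wp_instrs) simp
    then show "fst s 25 \<noteq> 0 \<and> wp flip_body 6 (I (Suc t)) s" using r1 t by (simp add: s)
  next
    fix s :: state assume "I d s"
    then show "fst s 25 = 0 \<and> ?Q s"
      by (auto simp: I_def)
  qed simp
qed

lemma length_ords_le_scan_cost: "length ords \<le> scan_cost"
proof -
  have "length ords = (\<Sum>j<length ords. 1)" by simp
  also have "\<dots> \<le> scan_cost" unfolding scan_cost_def by (rule sum_mono) simp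
  finally show ?thesis .
qed

lemma stores2_agree: "agree K \<mu> \<mu>' \<Longrightarrow> K \<inter> {4, 5, 6, 7} = {} \<Longrightarrow> stores2 \<mu> P \<Longrightarrow> stores2 \<mu>' P"
  using stores_agree[of K \<mu> \<mu>' 6 4] stores_agree[of K \<mu> \<mu>' 7 5] by (auto simp: stores2_def)

text \<open>The constants add up: \<open>112 = 7 + 23 + 71 + 11\<close> for flipping, resetting,
  simulating and comparing, and 14 for the overheads. Resetting and comparing are charged to
  \<open>T * scan_cost\<close> because \<open>1 \<le> T\<close>.\<close>

lemma wp_cftp_round:
  assumes b: "bases \<rho>" and rd: "ready \<mu>" and co: "coins \<mu> (snth \<omega>) l" and st: "stores2 \<mu> (L, U)"
    and r: "\<rho> 22 = length ords" "\<rho> 24 = l" "\<rho> 25 = d" and T: "l + d = T * length ords" "1 \<le> T"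
    and B: "B = bsim Es cyc (snth \<omega>) 0 (T * length ords) (L - set ords, U \<union> set ords)"
  shows "wp cftp_round (112 * T * scan_cost + 14)
    (\<lambda>(\<rho>', \<mu>', \<omega>'). \<omega>' = sdrop (T * length ords) \<omega> \<and> (\<forall>r<20. \<rho>' r = \<rho> r) \<and> \<rho>' 22 = length ords \<and>
       \<rho>' 24 = T * length ords \<and> \<rho>' 25 = T * length ords \<and> (\<rho>' 23 \<noteq> 0 \<longleftrightarrow> (\<exists>v\<in>set ords. v \<in> snd B \<and> v \<notin> fst B)) \<and>
       agree {4, 5, 6, 7, 9} \<mu> \<mu>' \<and> coins \<mu>' (snth \<omega>) (T * length ords) \<and> stores2 \<mu>' B) (\<rho>, \<mu>, sdrop l \<omega>)"
proof -
  let ?N = "length ords"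
  let ?K = "{4, 5, 6, 7, 9} :: nat set"
  define Q where "Q P x = (\<lambda>(\<rho>', \<mu>', \<omega>'). \<omega>' = sdrop (T * ?N) \<omega> \<and> (\<forall>r<20. \<rho>' r = \<rho> r) \<and> \<rho>' 22 = ?N \<and>
    \<rho>' 24 = T * ?N \<and> agree ?K \<mu> \<mu>' \<and> coins \<mu>' (snth \<omega>) (T * ?N) \<and> stores2 \<mu>' P \<and> x \<rho>')" for P and x :: "(nat \<Rightarrow> nat) \<Rightarrow> bool"
  have QD: "bases \<rho>1" "ready \<mu>1" "coins \<mu>1 (snth \<omega>) (T * ?N)" "stores2 \<mu>1 P" "\<rho>1 22 = ?N" "\<rho>1 24 = T * ?N" "\<omega>1 = sdrop (T * ?N) \<omega>"
    "x \<rho>1"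
    if "Q P x (\<rho>1, \<mu>1, \<omega>1)" for P x \<rho>1 \<mu>1 \<omega>1
    using that bases_cong[OF b, of \<rho>1] ready_agree[OF _ _ rd, of ?K \<mu>1] by (auto simp: Q_def)
  have step: "Q P' y (\<rho>2, \<mu>2, \<omega>1)"
    if "Q P x (\<rho>1, \<mu>1, \<omega>1)" "\<forall>r<30. r \<notin> {20, 21, 23, 25} \<longrightarrow> \<rho>2 r = \<rho>1 r" "agree {4, 5, 6, 7} \<mu>1 \<mu>2" "stores2 \<mu>2 P'" "y \<rho>2"
    for P P' x y \<rho>1 \<rho>2 \<mu>1 \<mu>2 \<omega>1
    using that agree_trans[of ?K \<mu> \<mu>1 "{4, 5, 6, 7}" \<mu>2 ?K] coins_agree[OF that(3), of "snth \<omega>" "T * ?N"]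
    by (auto simp: Q_def)
  let ?P0 = "(L - set ords, U \<union> set ords)"
  define neq where "neq = (\<lambda>\<rho>' :: nat \<Rightarrow> nat. \<rho>' 23 \<noteq> 0 \<longleftrightarrow> (\<exists>v\<in>set ords. v \<in> snd B \<and> v \<notin> fst B))"
  have 1: "wp (While_nz 25 flip_body) (7 * d + 1) (Q (L, U) (\<lambda>_. True)) (\<rho>, \<mu>, sdrop l \<omega>)"
  proof (rule wp_mono[OF wp_flip[OF b co r(2,3)] order_refl])
    fix s assume H: "case s of (\<rho>', \<mu>', \<omega>') \<Rightarrow> \<omega>' = sdrop (l + d) \<omega> \<and> (\<forall>r<30. r \<notin> {24, 25} \<longrightarrow> \<rho>' r = \<rho> r) \<and> \<rho>' 24 = l + d \<and>
       agree {9} \<mu> \<mu>' \<and> coins \<mu>' (snth \<omega>) (l + d)"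
    obtain \<rho>1 \<mu>1 \<omega>1 where s: "s = (\<rho>1, \<mu>1, \<omega>1)" by (cases s) auto
    have ag: "agree {9} \<mu> \<mu>1" using H by (simp add: s)
    show "Q (L, U) (\<lambda>_. True) s"
      using H T(1) r(1) agree_trans[OF ag agree_refl, of ?K "{}"] stores2_agree[OF ag _ st] by (simp add: s Q_def)
  qed
  have 2: "wp (instrs [ICopy 20 22]) 2 (Q (L, U) (\<lambda>\<rho>'. \<rho>' 20 = ?N)) s" if "Q (L, U) (\<lambda>_. True) s" for s
    using that by (intro wp_instrs) (cases s, auto simp: Q_def)
  have 3: "wp (While_nz 20 init_body) (23 * scan_cost + 1) (Q ?P0 (\<lambda>_. True)) s" if "Q (L, U) (\<lambda>\<rho>'. \<rho>' 20 = ?N) s" for s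
  proof -
    obtain \<rho>1 \<mu>1 \<omega>1 where s: "s = (\<rho>1, \<mu>1, \<omega>1)" by (cases s) auto
    note q = that[unfolded s]
    show ?thesis unfolding s
      by (rule wp_mono[OF wp_init[OF QD(1,2,4,8)[OF q]] order_refl]) (use step[OF q, of _ _ ?P0] in auto)
  qed
  have 4: "wp (instrs [ICopy 20 24, IConst 21 0]) 3 (Q ?P0 (\<lambda>\<rho>'. \<rho>' 20 = T * ?N \<and> \<rho>' 21 = 0)) s" if "Q ?P0 (\<lambda>_. True) s" for s
    using that by (intro wp_instrs) (cases s, auto simp: Q_def)
  have 5: "wp (While_nz 20 sim_body) (71 * T * scan_cost + 1) (Q B (\<lambda>_. True)) s"
    if "Q ?P0 (\<lambda>\<rho>'. \<rho>' 20 = T * ?N \<and> \<rho>' 21 = 0) s" for s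
  proof -
    obtain \<rho>1 \<mu>1 \<omega>1 where s: "s = (\<rho>1, \<mu>1, \<omega>1)" by (cases s) auto
    note q = that[unfolded s]
    show ?thesis unfolding s
      by (rule wp_mono[OF wp_sim[OF QD(1,2,3,4)[OF q] _ _ QD(5)[OF q] refl] order_refl])
        (use QD(8)[OF q] step[OF q, of _ _ B] B in auto)
  qed
  have 6: "wp (instrs [ICopy 20 22, IConst 23 0]) 3 (Q B (\<lambda>\<rho>'. \<rho>' 20 = ?N \<and> \<rho>' 23 = 0)) s" if "Q B (\<lambda>_. True) s" for s
    using that by (intro wp_instrs) (cases s, auto simp: Q_def)
  have 7: "wp (While_nz 20 compare_body) (11 * ?N + 1) (Q B neq) s"
    if "Q B (\<lambda>\<rho>'. \<rho>' 20 = ?N \<and> \<rho>' 23 = 0) s" for s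
  proof -
    obtain \<rho>1 \<mu>1 \<omega>1 where s: "s = (\<rho>1, \<mu>1, \<omega>1)" by (cases s) auto
    note q = that[unfolded s]
    show ?thesis unfolding s
    proof (rule wp_mono[OF wp_compare[OF QD(1,2,4)[OF q]] order_refl])
      fix s assume "case s of (\<rho>', \<mu>', \<omega>') \<Rightarrow> \<omega>' = \<omega>1 \<and> (\<forall>r<30. r \<notin> {20, 23} \<longrightarrow> \<rho>' r = \<rho>1 r) \<and> \<mu>' = \<mu>1 \<and>
       (\<rho>' 23 \<noteq> 0 \<longleftrightarrow> (\<exists>v\<in>set ords. v \<in> snd B \<and> v \<notin> fst B))"
      then obtain \<rho>2 where s: "s = (\<rho>2, \<mu>1, \<omega>1)" and \<rho>2: "\<forall>r<30. r \<notin> {20, 23} \<longrightarrow> \<rho>2 r = \<rho>1 r" and "neq \<rho>2"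
        by (cases s) (auto simp: neq_def)
      then show "Q B neq s"
        unfolding s by (intro step[OF q]) (use QD(4)[OF q] agree_refl in auto)
    qed (use QD(8)[OF q] in auto)
  qed
  have 8: "wp (instrs [ICopy 25 24]) 2 (Q B (\<lambda>\<rho>'. neq \<rho>' \<and> \<rho>' 25 = T * ?N)) s" if "Q B neq s" for s
    using that by (intro wp_instrs) (cases s, auto simp: Q_def neq_def)
  have "?N \<le> T * scan_cost" "scan_cost \<le> T * scan_cost"
    using length_ords_le_scan_cost T(2) mult_le_mono[of 1 T scan_cost scan_cost] mult_le_mono[of 1 T ?N scan_cost] by auto
  moreover have "d \<le> T * scan_cost"
    using T(1) mult_le_mono2[OF length_ords_le_scan_cost, of T] by linarith
  ultimately have time: "(7 * d + 1) + (2 + ((23 * scan_cost + 1) + (3 + ((71 * T * scan_cost + 1) + (3 + ((11 * ?N + 1) + 2))))))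
      \<le> 112 * T * scan_cost + 14" unfolding mult.assoc by linarith
  have "wp cftp_round (112 * T * scan_cost + 14) (Q B (\<lambda>\<rho>'. neq \<rho>' \<and> \<rho>' 25 = T * ?N)) (\<rho>, \<mu>, sdrop l \<omega>)"
    unfolding cftp_round_def
    by (rule wp_Seq[OF 1 wp_Seq[OF 2 wp_Seq[OF 3 wp_Seq[OF 4 wp_Seq[OF 5 wp_Seq[OF 6 wp_Seq[OF 7 8 order_refl]
      order_refl] order_refl] order_refl] order_refl] order_refl] time])
  then show ?thesis by (rule wp_mono) (auto simp: Q_def neq_def)
qed

section \<open>The doubling loop\<close>

lemma bsim_outside:
  assumes "\<And>j. i \<le> j \<Longrightarrow> j < i + k \<Longrightarrow> \<sigma> j \<noteq> v"
  shows "(v \<in> fst (bsim E \<sigma> c i k P) \<longleftrightarrow> v \<in> fst P) \<and> (v \<in> snd (bsim E \<sigma> c i k P) \<longleftrightarrow> v \<in> snd P)"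
  using assms
proof (induction k arbitrary: i)
  case (Suc k)
  have "v \<noteq> \<sigma> i" using Suc.prems[of i] by auto
  then show ?case using Suc.IH[of "Suc i"] Suc.prems by (auto simp: upd2_def upd_def)
qed simp

definition round_pair :: "bool stream \<Rightarrow> nat set \<Rightarrow> nat \<Rightarrow> nat set \<times> nat set" where
  "round_pair \<omega> I k = bsim Es cyc (snth \<omega>) 0 (2 ^ k * length ords) (I, I \<union> set ords)"

text \<open>The scan never touches vertices outside \<open>ords\<close>; hence a round can be
  restarted from whatever the previous one left, and comparing the bounds on \<open>ords\<close>
  decides their equality.\<close>

lemma round_pair_props:
  assumes "I \<inter> set ords = {}"
  shows "fst (round_pair \<omega> I k) - set ords = I" "snd (round_pair \<omega> I k) - set ords = I"
    "(\<exists>v\<in>set ords. v \<in> snd (round_pair \<omega> I k) \<and> v \<notin> fst (round_pair \<omega> I k)) \<longleftrightarrow> fst (round_pair \<omega> I k) \<noteq> snd (round_pair \<omega> I k)"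
proof -
  have out: "(v \<in> fst (round_pair \<omega> I k) \<longleftrightarrow> v \<in> I) \<and> (v \<in> snd (round_pair \<omega> I k) \<longleftrightarrow> v \<in> I)" if "v \<notin> set ords" for v
  proof -
    have "cyc j \<noteq> v" if "j < 2 ^ k * length ords" for j
    proof -
      have "0 < length ords" using that by (cases "length ords") auto
      then have "cyc j \<in> set ords" by (simp add: cyc_def)
      then show ?thesis using \<open>v \<notin> set ords\<close> by auto
    qed
    then show ?thesis using bsim_outside[of 0 "2 ^ k * length ords" cyc v Es "snth \<omega>" "(I, I \<union> set ords)"] that
      by (simp add: round_pair_def)
  qed
  show 1: "fst (round_pair \<omega> I k) - set ords = I" "snd (round_pair \<omega> I k) - set ords = I"
    using out assms by auto
  have "fst (round_pair \<omega> I k) \<subseteq> snd (round_pair \<omega> I k)"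
    unfolding round_pair_def by (rule bsim_subset) simp
  then show "(\<exists>v\<in>set ords. v \<in> snd (round_pair \<omega> I k) \<and> v \<notin> fst (round_pair \<omega> I k)) \<longleftrightarrow> fst (round_pair \<omega> I k) \<noteq> snd (round_pair \<omega> I k)"
    using out by blast
qed

text \<open>\<open>J\<close> is the first successful round. The sum of registers 24 and 25 is the
  invariant horizon: \<open>0 + N\<close> at the start, and two equal halves from then on.\<close>

lemma wp_doubling:
  assumes b: "bases \<rho>" and rd: "ready \<mu>" and st: "stores2 \<mu> (I, I)" and I: "I \<inter> set ords = {}"
    and r: "\<rho> 22 = length ords" "\<rho> 23 = 1" "\<rho> 24 = 0" "\<rho> 25 = length ords"
    and J: "fst (round_pair \<omega> I J) = snd (round_pair \<omega> I J)" "\<And>k. k < J \<Longrightarrow> fst (round_pair \<omega> I k) \<noteq> snd (round_pair \<omega> I k)"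
  shows "wp (While_nz 23 cftp_round) (\<Sum>k\<le>J. 112 * 2 ^ k * scan_cost + 16)
    (\<lambda>(\<rho>', \<mu>', \<omega>'). (\<forall>r<20. \<rho>' r = \<rho> r) \<and> stores2 \<mu>' (round_pair \<omega> I J)) (\<rho>, \<mu>, \<omega>)" (is "wp _ _ ?Q _")
proof -
  let ?N = "length ords"
  let ?K = "{4, 5, 6, 7, 9} :: nat set"
  define Inv where "Inv k = (\<lambda>(\<rho>', \<mu>', \<omega>'). (\<forall>r<20. \<rho>' r = \<rho> r) \<and> \<rho>' 22 = ?N \<and> \<rho>' 24 + \<rho>' 25 = 2 ^ k * ?N \<and>
    \<omega>' = sdrop (\<rho>' 24) \<omega> \<and> coins \<mu>' (snth \<omega>) (\<rho>' 24) \<and> agree ?K \<mu> \<mu>' \<and>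
    (if k = 0 then \<rho>' 23 \<noteq> 0 \<and> stores2 \<mu>' (I, I)
     else stores2 \<mu>' (round_pair \<omega> I (k - 1)) \<and> (\<rho>' 23 \<noteq> 0 \<longleftrightarrow> fst (round_pair \<omega> I (k - 1)) \<noteq> snd (round_pair \<omega> I (k - 1)))))" for k
  show ?thesis
  proof (rule wp_While[where I = Inv and n = "Suc J" and f = "\<lambda>k. 112 * 2 ^ k * scan_cost + 14"])
    show "Inv 0 (\<rho>, \<mu>, \<omega>)" using r st by (simp add: Inv_def agree_refl coins_def)
  next
    fix k and s :: state assume k: "k < Suc J" and inv: "Inv k s"
    obtain \<rho>1 \<mu>1 \<omega>1 where s: "s = (\<rho>1, \<mu>1, \<omega>1)" by (cases s) auto
    have \<rho>1: "\<forall>r<20. \<rho>1 r = \<rho> r" and r1: "\<rho>1 22 = ?N" "\<rho>1 24 + \<rho>1 25 = 2 ^ k * ?N" and om: "\<omega>1 = sdrop (\<rho>1 24) \<omega>"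
      and co: "coins \<mu>1 (snth \<omega>) (\<rho>1 24)" and ag: "agree ?K \<mu> \<mu>1"
      using inv by (auto simp: Inv_def s)
    \<comment> \<open>The pair left by the previous round matters only off the scan, where both of
      its sets equal \<open>I\<close>.\<close>
    obtain L U where st1: "stores2 \<mu>1 (L, U)" and LU: "L - set ords = I" "U \<union> set ords = I \<union> set ords"
    proof (cases "k = 0")
      case True
      then show ?thesis using that[of I I] inv I by (auto simp: Inv_def s)
    next
      case False
      let ?B = "round_pair \<omega> I (k - 1)"
      have "snd ?B \<union> set ords = I \<union> set ords" using round_pair_props(2)[OF I, of \<omega> "k - 1"] by blast
      then show ?thesis using that[of "fst ?B" "snd ?B"] False inv round_pair_props(1)[OF I, of \<omega> "k - 1"] by (auto simp: Inv_def s)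
    qed
    have b1: "bases \<rho>1" using bases_cong[OF b] \<rho>1 by simp
    have rd1: "ready \<mu>1" using ready_agree[OF ag _ rd] by simp
    have B: "round_pair \<omega> I k = bsim Es cyc (snth \<omega>) 0 (2 ^ k * ?N) (L - set ords, U \<union> set ords)"
      by (simp add: round_pair_def LU)
    have "wp cftp_round (112 * 2 ^ k * scan_cost + 14) (Inv (Suc k)) s"
      unfolding s om
    proof (rule wp_mono[OF wp_cftp_round[OF b1 rd1 co st1 r1(1) refl refl r1(2) _ B] order_refl])
      fix s' :: state
      assume H: "case s' of (\<rho>', \<mu>', \<omega>') \<Rightarrow> \<omega>' = sdrop (2 ^ k * ?N) \<omega> \<and> (\<forall>r<20. \<rho>' r = \<rho>1 r) \<and> \<rho>' 22 = ?N \<and>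
       \<rho>' 24 = 2 ^ k * ?N \<and> \<rho>' 25 = 2 ^ k * ?N \<and> (\<rho>' 23 \<noteq> 0 \<longleftrightarrow> (\<exists>v\<in>set ords. v \<in> snd (round_pair \<omega> I k) \<and> v \<notin> fst (round_pair \<omega> I k))) \<and>
       agree ?K \<mu>1 \<mu>' \<and> coins \<mu>' (snth \<omega>) (2 ^ k * ?N) \<and> stores2 \<mu>' (round_pair \<omega> I k)"
      obtain \<rho>2 \<mu>2 \<omega>2 where s': "s' = (\<rho>2, \<mu>2, \<omega>2)" by (cases s') auto
      have "agree ?K \<mu> \<mu>2" using H agree_trans[OF ag, of ?K \<mu>2 ?K] by (simp add: s')
      then show "Inv (Suc k) s'"
        using H \<rho>1 unfolding round_pair_props(3)[OF I] by (simp add: Inv_def s')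
    qed simp
    moreover have "\<rho>1 23 \<noteq> 0"
      using inv J(2)[of "k - 1"] k by (cases k) (auto simp: Inv_def s)
    ultimately show "fst s 23 \<noteq> 0 \<and> wp cftp_round (112 * 2 ^ k * scan_cost + 14) (Inv (Suc k)) s" by (simp add: s)
  next
    fix s :: state assume "Inv (Suc J) s"
    then show "fst s 23 = 0 \<and> ?Q s"
      using J(1) by (auto simp: Inv_def)
  next
    \<comment> \<open>The allowance of 16 exceeds body and test by one in each round, and this
      surplus pays for the final test.\<close>
    have "(\<Sum>k\<le>J. 112 * 2 ^ k * scan_cost + 16) = (\<Sum>k<Suc J. 112 * 2 ^ k * scan_cost + 14 + 1) + (\<Sum>k<Suc J. 1)"
      unfolding sum.distrib[symmetric] lessThan_Suc_atMost by (rule sum.cong) simp_all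
    then show "(\<Sum>k<Suc J. 112 * 2 ^ k * scan_cost + 14 + 1) + 1 \<le> (\<Sum>k\<le>J. 112 * 2 ^ k * scan_cost + 16)"
      by simp
  qed
qed

section \<open>Preprocessing\<close>

definition heads :: "nat list \<Rightarrow> bool stream \<Rightarrow> nat set" where
  "heads vs \<omega> = {vs ! i |i. i < length vs \<and> \<omega> !! i}"

lemma heads_append: "heads (vs @ [v]) \<omega> = (if \<omega> !! length vs then insert v (heads vs \<omega>) else heads vs \<omega>)"
proof -
  have "x \<in> heads (vs @ [v]) \<omega> \<longleftrightarrow> x \<in> heads vs \<omega> \<or> \<omega> !! length vs \<and> x = v" for x
  proof
    assume "x \<in> heads (vs @ [v]) \<omega>"
    then obtain i where "i < Suc (length vs)" "\<omega> !! i" "x = (vs @ [v]) ! i" by (auto simp: heads_def)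
    then show "x \<in> heads vs \<omega> \<or> \<omega> !! length vs \<and> x = v"
      by (cases "i = length vs") (auto simp: heads_def nth_append)
  next
    assume "x \<in> heads vs \<omega> \<or> \<omega> !! length vs \<and> x = v"
    then show "x \<in> heads (vs @ [v]) \<omega>"
    proof
      assume "x \<in> heads vs \<omega>"
      then obtain i where "i < length vs" "\<omega> !! i" "x = vs ! i" by (auto simp: heads_def)
      then show ?thesis unfolding heads_def by (auto simp: nth_append intro!: exI[of _ i])
    next
      assume "\<omega> !! length vs \<and> x = v"
      then show ?thesis unfolding heads_def by (auto intro!: exI[of _ "length vs"])
    qed
  qed
  then show ?thesis by auto
qed

lemma linked_zero_iff: "linked \<mu> q p ks \<Longrightarrow> p = 0 \<longleftrightarrow> ks = []"
  by (cases ks) auto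

text \<open>An isolated vertex receives its final value at once, in both bounds: nothing can block
  it, and as it lies in no edge no counter has to change.\<close>

lemma wp_classify:
  assumes b: "bases \<rho>" and i: "incidence \<mu>" and st: "stores2 \<mu> ({}, {})"
    and r: "\<rho> 20 = 0" "\<rho> 21 = n" "\<rho> 22 = 0"
  shows "wp (While_nz 21 classify_body) (14 * n + 1)
    (\<lambda>(\<rho>', \<mu>', \<omega>'). \<omega>' = sdrop (length isos) \<omega> \<and> (\<forall>r<20. \<rho>' r = \<rho> r) \<and> \<rho>' 22 = length ords \<and>
       ready \<mu>' \<and> stores2 \<mu>' (heads isos \<omega>, heads isos \<omega>)) (\<rho>, \<mu>, \<omega>)" (is "wp _ _ ?Q _")
proof -
  define D where "D t = filter (\<lambda>v. inc v \<noteq> []) [0..<t]" for t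
  define S where "S t = filter (\<lambda>v. inc v = []) [0..<t]" for t
  define I where "I t = (\<lambda>(\<rho>', \<mu>', \<omega>'). \<omega>' = sdrop (length (S t)) \<omega> \<and> (\<forall>r<20. \<rho>' r = \<rho> r) \<and>
    \<rho>' 20 = t \<and> \<rho>' 21 = n - t \<and> \<rho>' 22 = length (D t) \<and> agree {6, 7, 8} \<mu> \<mu>' \<and>
    (\<forall>j<length (D t). \<mu>' (adr 8 j) = D t ! j) \<and> stores2 \<mu>' (heads (S t) \<omega>, heads (S t) \<omega>))" for t
  show ?thesis
  proof (rule wp_While[where I = I and n = n and f = "\<lambda>_. 13"])
    show "I 0 (\<rho>, \<mu>, \<omega>)" using r st by (simp add: I_def D_def S_def agree_refl heads_def)
  next
    fix t and s :: state assume t: "t < n" and inv: "I t s"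
    obtain \<rho>1 \<mu>1 \<omega>1 where s: "s = (\<rho>1, \<mu>1, \<omega>1)" by (cases s) auto
    have \<rho>1: "\<forall>r<20. \<rho>1 r = \<rho> r" and r1: "\<rho>1 20 = t" "\<rho>1 21 = n - t" "\<rho>1 22 = length (D t)"
      and om: "\<omega>1 = sdrop (length (S t)) \<omega>" and ag: "agree {6, 7, 8} \<mu> \<mu>1"
      and od: "\<forall>j<length (D t). \<mu>1 (adr 8 j) = D t ! j" and st1: "stores2 \<mu>1 (heads (S t) \<omega>, heads (S t) \<omega>)"
      using inv by (auto simp: I_def s)
    have b1: "bases \<rho>1" using bases_cong[OF b] \<rho>1 by simp
    have lenO: "length (D t) \<le> t" using length_filter_le[of "\<lambda>v. inc v \<noteq> []" "[0..<t]"] by (simp add: D_def)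
    have head: "\<mu>1 (adr 1 t) = 0 \<longleftrightarrow> inc t = []"
      using i t agreeD[OF ag, of 1 t] linked_zero_iff[of \<mu> R "\<mu> (adr 1 t)" "inc t"] by (simp add: incidence_def)
    define \<rho>2 where "\<rho>2 = \<rho>1(34 := \<mu>1 (adr 1 t))"
    have b2: "bases \<rho>2" using bases_cong[OF b1] by (simp add: \<rho>2_def)
    have A1: "wp (instrs [IAdd 34 1 20, ILoad 34 34]) 3 (\<lambda>s. s = (\<rho>2, \<mu>1, \<omega>1)) s"
      using r1 by (intro wp_instrs) (auto simp: s base_add[OF b1] \<rho>2_def)
    define I' where "I' = (\<lambda>(\<rho>', \<mu>', \<omega>'). \<omega>' = sdrop (length (S (Suc t))) \<omega> \<and> (\<forall>r<20. \<rho>' r = \<rho> r) \<and>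
      \<rho>' 20 = t \<and> \<rho>' 21 = n - t \<and> \<rho>' 22 = length (D (Suc t)) \<and> agree {6, 7, 8} \<mu> \<mu>' \<and>
      (\<forall>j<length (D (Suc t)). \<mu>' (adr 8 j) = D (Suc t) ! j) \<and> stores2 \<mu>' (heads (S (Suc t)) \<omega>, heads (S (Suc t)) \<omega>))"
    have A2: "wp (If_nz 34 (instrs [IAdd 35 8 22, IStore 35 20, IAdd 22 22 10])
                   (instrs [IFlip 33, IAdd 35 6 20, IStore 35 33, IAdd 35 7 20, IStore 35 33])) 7 I' s'"
      if s': "s' = (\<rho>2, \<mu>1, \<omega>1)" for s'
      unfolding s'
    proof (rule wp_If_nz[where T = 6])
      assume "fst (\<rho>2, \<mu>1, \<omega>1) 34 \<noteq> 0"
      then have ne: "inc t \<noteq> []" using head by (simp add: \<rho>2_def)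
      then have OS: "D (Suc t) = D t @ [t]" "S (Suc t) = S t" by (simp_all add: D_def S_def)
      let ?\<mu> = "\<mu>1(adr 8 (length (D t)) := t)"
      have c8: "cell 8 (length (D t))" using lenO t by simp
      have eq: "fold instr_step [IAdd 35 8 22, IStore 35 20, IAdd 22 22 10] (\<rho>2, \<mu>1, \<omega>1) =
        (\<rho>2(35 := adr 8 (length (D t)), 22 := Suc (length (D t))), ?\<mu>, \<omega>1)"
        using r1 by (simp add: base_add[OF b2]) (simp add: \<rho>2_def base_add[OF b1])
      have "\<forall>j<length (D (Suc t)). ?\<mu> (adr 8 j) = D (Suc t) ! j"
        using od lenO t c8 by (auto simp: OS nth_append less_Suc_eq)
      moreover have "stores2 ?\<mu> (heads (S t) \<omega>, heads (S t) \<omega>)"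
        using stores2_agree[OF agree_upd[OF agree_refl, of 8 "{8}"] _ st1, of "length (D t)" t] c8 by simp
      ultimately have "I' (fold instr_step [IAdd 35 8 22, IStore 35 20, IAdd 22 22 10] (\<rho>2, \<mu>1, \<omega>1))"
        unfolding eq using r1 \<rho>1 om agree_upd[OF ag, of 8 "length (D t)" t] c8 by (simp add: I'_def OS \<rho>2_def)
      then show "wp (instrs [IAdd 35 8 22, IStore 35 20, IAdd 22 22 10]) 6 I' (\<rho>2, \<mu>1, \<omega>1)"
        by (rule wp_instrs) simp
    next
      assume "fst (\<rho>2, \<mu>1, \<omega>1) 34 = 0"
      then have e: "inc t = []" using head by (simp add: \<rho>2_def)
      then have OS: "D (Suc t) = D t" "S (Suc t) = S t @ [t]" by (simp_all add: D_def S_def)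
      let ?c = "\<omega> !! length (S t)"
      let ?\<mu> = "\<mu>1(adr 6 t := of_bool ?c, adr 7 t := of_bool ?c)"
      have eq: "fold instr_step [IFlip 33, IAdd 35 6 20, IStore 35 33, IAdd 35 7 20, IStore 35 33] (\<rho>2, \<mu>1, \<omega>1) =
        (\<rho>2(33 := of_bool ?c, 35 := adr 7 t), ?\<mu>, sdrop (Suc (length (S t))) \<omega>)"
        using r1 by (simp add: base_add[OF b2] om) (simp add: \<rho>2_def base_add[OF b1] fun_upd_twist)
      have "S t ! j < t" if "j < length (S t)" for j using nth_mem[OF that] by (simp add: S_def)
      then have tS: "t \<notin> heads (S t) \<omega>" by (fastforce simp: heads_def)
      have ne: "t \<notin> edge k" if "k < length es" for k using inc_props(2)[of k t] e that by simp
      have "stores2 ?\<mu> (heads (S (Suc t)) \<omega>, heads (S (Suc t)) \<omega>)"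
        unfolding stores2_def fst_conv snd_conv
      proof (intro conjI)
        have diff: "edge k - heads (S (Suc t)) \<omega> = edge k - heads (S t) \<omega>" if "k < length es" for k
          using ne[OF that] by (auto simp: OS heads_append)
        show "stores 6 4 ?\<mu> (heads (S (Suc t)) \<omega>)" "stores 7 5 ?\<mu> (heads (S (Suc t)) \<omega>)"
          using st1 t tS diff by (auto simp: stores2_def stores_def OS heads_append)
      qed
      moreover have "agree {6, 7, 8} \<mu> ?\<mu>" using agree_upd[OF agree_upd[OF ag]] t by simp
      moreover have "\<forall>j<length (D t). ?\<mu> (adr 8 j) = D t ! j" using od lenO t by auto
      ultimately have "I' (fold instr_step [IFlip 33, IAdd 35 6 20, IStore 35 33, IAdd 35 7 20, IStore 35 33] (\<rho>2, \<mu>1, \<omega>1))"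
        unfolding eq using r1 \<rho>1 by (simp add: I'_def OS \<rho>2_def)
      then show "wp (instrs [IFlip 33, IAdd 35 6 20, IStore 35 33, IAdd 35 7 20, IStore 35 33]) 6 I' (\<rho>2, \<mu>1, \<omega>1)"
        by (rule wp_instrs) simp
    qed simp
    have A3: "wp (instrs [IAdd 20 20 10, ISub 21 21 10]) 3 (I (Suc t)) s'" if I': "I' s'" for s'
    proof (rule wp_instrs)
      obtain \<rho>3 \<mu>3 \<omega>3 where s': "s' = (\<rho>3, \<mu>3, \<omega>3)" by (cases s') auto
      have "\<forall>r<20. \<rho>3 r = \<rho> r" using I' by (simp add: I'_def s')
      then have "\<rho>3 10 = 1" using base_add(2)[OF b] by simp
      then show "I (Suc t) (fold instr_step [IAdd 20 20 10, ISub 21 21 10] s')"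
        using I' by (simp add: I_def I'_def s')
    qed simp
    have "wp classify_body 13 (I (Suc t)) s"
      unfolding classify_body_def by (rule wp_Seq[OF A1 wp_Seq[OF A2 A3 order_refl]]) simp_all
    then show "fst s 21 \<noteq> 0 \<and> wp classify_body 13 (I (Suc t)) s" using r1 t by (simp add: s)
  next
    fix s :: state assume inv: "I n s"
    obtain \<rho>1 \<mu>1 \<omega>1 where s: "s = (\<rho>1, \<mu>1, \<omega>1)" by (cases s) auto
    have "D n = ords" "S n = isos" by (simp_all add: D_def S_def ords_def isos_def)
    then show "fst s 21 = 0 \<and> ?Q s"
      using inv incidence_agree[OF _ _ _ _ i, of "{6, 7, 8}" \<mu>1] by (auto simp: I_def s ready_def)
  qed simp
qed

section \<open>Reading the input and building the incidence lists\<close>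

abbreviation input :: "nat list" where "input \<equiv> encode n es"

definition pos :: "nat \<Rightarrow> nat" where "pos k = 2 + (\<Sum>i<k. length (es ! i) + 1)"

lemma concat_nth:
  "k < length xss \<Longrightarrow> j < length (xss ! k) \<Longrightarrow>
    (\<Sum>i<k. length (xss ! i)) + j < length (concat xss) \<and> concat xss ! ((\<Sum>i<k. length (xss ! i)) + j) = xss ! k ! j"
proof (induction xss arbitrary: k)
  case (Cons xs xss)
  show ?case
  proof (cases k)
    case 0
    then show ?thesis using Cons.prems by (simp add: nth_append)
  next
    case (Suc k')
    have "(\<Sum>i<k. length ((xs # xss) ! i)) = length xs + (\<Sum>i<k'. length (xss ! i))"
      unfolding Suc by (subst sum.lessThan_Suc_shift) simp
    then show ?thesis using Cons.IH[of k'] Cons.prems Suc by (simp add: nth_append)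
  qed
qed simp

lemma input_nth:
  assumes "k < length es" "j \<le> length (es ! k)"
  shows "pos k + j < length input" "input ! (pos k + j) = (length (es ! k) # es ! k) ! j"
proof -
  let ?xss = "map (\<lambda>e. length e # e) es"
  have s: "(\<Sum>i<k. length (?xss ! i)) = (\<Sum>i<k. length (es ! i) + 1)" using assms(1) by (intro sum.cong) auto
  have "(\<Sum>i<k. length (es ! i) + 1) + j < length (concat ?xss) \<and>
      concat ?xss ! ((\<Sum>i<k. length (es ! i) + 1) + j) = ?xss ! k ! j"
    using concat_nth[of k ?xss j] assms unfolding s by simp
  then show "pos k + j < length input" "input ! (pos k + j) = (length (es ! k) # es ! k) ! j"
    using assms(1) by (auto simp: encode_def pos_def)
qed

lemma pos_Suc: "pos (Suc k) = pos k + length (es ! k) + 1"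
  by (simp add: pos_def)

lemma pos_end: "pos (length es) = length input"
  by (simp add: pos_def length_encode sum_list_sum_nth atLeast0LessThan)

definition start_mem :: "nat \<Rightarrow> nat" where
  "start_mem a = (if a < length input then input ! a else 0)"

lemma start_mem_pos:
  assumes "k < length es"
  shows "start_mem (pos k) = length (es ! k)" "j < length (es ! k) \<Longrightarrow> start_mem (pos k + 1 + j) = es ! k ! j"
  using input_nth[OF assms, of 0] input_nth[OF assms, of "Suc j"] by (simp_all add: start_mem_def)

text \<open>All arrays but the input start out as zero, which already encodes empty lists and empty
  sets.\<close>

lemma start_mem_zero:
  assumes "1 \<le> k" shows "start_mem (adr k i) = 0"
proof -
  have "length input \<le> 1 * R + i" using R by simp
  also have "\<dots> \<le> adr k i" unfolding adr_def using assms by (intro add_mono mult_right_mono) auto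
  finally show ?thesis by (simp add: start_mem_def)
qed

lemma wp_prelude:
  "wp prelude (6 * length es + 20)
    (\<lambda>(\<rho>', \<mu>', \<omega>'). \<omega>' = \<omega> \<and> \<mu>' = start_mem \<and> bases \<rho>' \<and> \<rho>' 13 = 2 \<and> \<rho>' 14 = 0 \<and> \<rho>' 15 = length es)
    (init_state input \<omega>)"
proof -
  define I where "I t = (\<lambda>(\<rho>' :: nat \<Rightarrow> nat, \<mu>', \<omega>'). \<omega>' = \<omega> \<and> \<mu>' = start_mem \<and> \<rho>' 0 = 0 \<and> \<rho>' 10 = 1 \<and> \<rho>' 11 = n \<and>
    \<rho>' 12 = length es \<and> \<rho>' 13 = pos t \<and> \<rho>' 14 = length es - t)" for t
  have init: "init_state input \<omega> = (\<lambda>_. 0, start_mem, \<omega>)"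
    by (simp add: init_state_def start_mem_def fun_eq_iff)
  have m: "start_mem 0 = n" "start_mem 1 = length es"
    by (simp_all add: start_mem_def encode_def)
  have 1: "wp (instrs [IConst 10 1, ILoad 11 0, ILoad 12 10, IAdd 13 10 10, ICopy 14 12]) 6 (I 0) (init_state input \<omega>)"
    using m by (intro wp_instrs) (auto simp: init I_def pos_def)
  have 2: "wp (While_nz 14 measure_body) (6 * length es + 1) (I (length es)) s" if "I 0 s" for s
  proof (rule wp_While[where I = I and n = "length es" and f = "\<lambda>_. 5"])
    fix t and s :: state assume t: "t < length es" and inv: "I t s"
    obtain \<rho>1 \<mu>1 \<omega>1 where s: "s = (\<rho>1, \<mu>1, \<omega>1)" by (cases s) auto
    have "wp measure_body 5 (I (Suc t)) s"
      unfolding measure_body_def using inv t start_mem_pos(1)[OF t]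
      by (intro wp_instrs) (auto simp: s I_def pos_Suc)
    then show "fst s 14 \<noteq> 0 \<and> wp measure_body 5 (I (Suc t)) s" using inv t by (auto simp: s I_def)
  qed (use that in \<open>auto simp: I_def\<close>)
  have 3: "wp (instrs [IAdd 1 13 11, IAdd 2 1 1, IAdd 3 2 1, IAdd 4 3 1, IAdd 5 4 1, IAdd 6 5 1, IAdd 7 6 1,
       IAdd 8 7 1, IAdd 9 8 1, IAdd 13 10 10, IConst 14 0, ICopy 15 12]) 13
    (\<lambda>(\<rho>', \<mu>', \<omega>'). \<omega>' = \<omega> \<and> \<mu>' = start_mem \<and> bases \<rho>' \<and> \<rho>' 13 = 2 \<and> \<rho>' 14 = 0 \<and> \<rho>' 15 = length es) s"
    if "I (length es) s" for s
  proof (rule wp_instrs)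
    obtain \<rho>1 where s: "s = (\<rho>1, start_mem, \<omega>)" and \<rho>1: "\<rho>1 0 = 0" "\<rho>1 10 = 1" "\<rho>1 11 = n" "\<rho>1 12 = length es" "\<rho>1 13 + n = R"
      using \<open>I (length es) s\<close> R by (cases s) (auto simp: I_def pos_end)
    define \<rho>2 where "\<rho>2 = \<rho>1(1 := R, 2 := 2 * R, 3 := 3 * R, 4 := 4 * R, 5 := 5 * R, 6 := 6 * R, 7 := 7 * R, 8 := 8 * R, 9 := 9 * R,
      13 := 2, 14 := 0, 15 := length es)"
    have "fold instr_step [IAdd 1 13 11, IAdd 2 1 1, IAdd 3 2 1, IAdd 4 3 1, IAdd 5 4 1, IAdd 6 5 1, IAdd 7 6 1,
       IAdd 8 7 1, IAdd 9 8 1, IAdd 13 10 10, IConst 14 0, ICopy 15 12] s = (\<rho>2, start_mem, \<omega>)"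
    proof -
      have ar: "R + R = 2 * R" "2 * R + R = 3 * R" "3 * R + R = 4 * R" "4 * R + R = 5 * R" "5 * R + R = 6 * R"
        "6 * R + R = 7 * R" "7 * R + R = 8 * R" "8 * R + R = 9 * R" "1 + 1 = (2 :: nat)" by simp_all
      show ?thesis using \<rho>1 by (simp add: s \<rho>2_def ar del: One_nat_def)
    qed
    moreover have "bases \<rho>2"
      unfolding bases_def
    proof (intro conjI allI impI)
      fix k :: nat assume "k \<le> 9"
      then have "k \<in> {0, 1, 2, 3, 4, 5, 6, 7, 8, 9}" by auto
      then show "\<rho>2 k = k * R" using \<rho>1(1) by (auto simp: \<rho>2_def)
    qed (simp_all add: \<rho>2_def \<rho>1)
    ultimately show "case fold instr_step [IAdd 1 13 11, IAdd 2 1 1, IAdd 3 2 1, IAdd 4 3 1, IAdd 5 4 1, IAdd 6 5 1, IAdd 7 6 1,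
       IAdd 8 7 1, IAdd 9 8 1, IAdd 13 10 10, IConst 14 0, ICopy 15 12] s of
      (\<rho>', \<mu>', \<omega>') \<Rightarrow> \<omega>' = \<omega> \<and> \<mu>' = start_mem \<and> bases \<rho>' \<and> \<rho>' 13 = 2 \<and> \<rho>' 14 = 0 \<and> \<rho>' 15 = length es"
      by (simp add: \<rho>2_def del: fold.simps fold_simps)
  qed simp
  show ?thesis unfolding prelude_def by (rule wp_Seq[OF 1 wp_Seq[OF 2 3 order_refl]]) simp_all
qed

definition part :: "nat \<Rightarrow> nat \<Rightarrow> nat \<Rightarrow> nat list" where
  "part v k j = (if v \<in> set (take j (es ! k)) then [k] else []) @ rev (filter (\<lambda>i. v \<in> edge i) [0..<k])"

text \<open>The position bound is the input position of the next vertex to be read, so the cell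
  about to be used is fresh.\<close>

definition partial :: "(nat \<Rightarrow> nat) \<Rightarrow> nat \<Rightarrow> nat \<Rightarrow> bool" where
  "partial \<mu> k j \<longleftrightarrow> (\<forall>v<n. linked \<mu> (pos k + 1 + j) (\<mu> (adr 1 v)) (part v k j))"

lemma linked_upd:
  assumes "linked \<mu> q p ks" "q \<le> q'" "\<And>i. i < q \<Longrightarrow> \<mu>' (adr 2 i) = \<mu> (adr 2 i) \<and> \<mu>' (adr 3 i) = \<mu> (adr 3 i)"
  shows "linked \<mu>' q' p ks"
  using assms by (induction ks arbitrary: p) auto

lemma agree_start:
  assumes "agree {1, 2, 3, 4, 5} start_mem \<mu>" "a < length input"
  shows "\<mu> a = start_mem a"
proof -
  have "a < R" using assms(2) R by linarith
  then show ?thesis using agreeD[OF assms(1), of 0 a] by (simp add: adr_def)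
qed

text \<open>All existing cells lie before the current position \<open>q\<close>, so writing the cell
  \<open>q\<close> damages no list; the vertex at \<open>q\<close> has not occurred in this edge
  yet, by distinctness, so its list grows by exactly \<open>k\<close>.\<close>

lemma wp_link:
  assumes b: "bases \<rho>" and k: "k < length es" and p: "partial \<mu> k 0" and ag: "agree {1, 2, 3, 4, 5} start_mem \<mu>"
    and r: "\<rho> 13 = pos k" "\<rho> 14 = k" "\<rho> 16 = length (es ! k)"
  shows "wp (While_nz 16 link_body) (12 * length (es ! k) + 1)
    (\<lambda>(\<rho>', \<mu>', \<omega>'). \<omega>' = \<omega> \<and> (\<forall>r<16. r \<noteq> 13 \<longrightarrow> \<rho>' r = \<rho> r) \<and> \<rho>' 13 = pos k + length (es ! k) \<and>
      partial \<mu>' k (length (es ! k)) \<and> agree {1, 2, 3} \<mu> \<mu>') (\<rho>, \<mu>, \<omega>)" (is "wp _ _ ?Q _")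
proof -
  let ?e = "es ! k"
  define I where "I t = (\<lambda>(\<rho>', \<mu>', \<omega>'). \<omega>' = \<omega> \<and> (\<forall>r<16. r \<noteq> 13 \<longrightarrow> \<rho>' r = \<rho> r) \<and> \<rho>' 13 = pos k + t \<and>
      \<rho>' 16 = length ?e - t \<and> partial \<mu>' k t \<and> agree {1, 2, 3} \<mu> \<mu>')" for t
  show ?thesis
  proof (rule wp_While[where I = I and n = "length ?e" and f = "\<lambda>_. 11"])
    show "I 0 (\<rho>, \<mu>, \<omega>)" using r p by (simp add: I_def agree_refl)
  next
    fix t and s :: state assume t: "t < length ?e" and inv: "I t s"
    obtain \<rho>1 \<mu>1 \<omega>1 where s: "s = (\<rho>1, \<mu>1, \<omega>1)" by (cases s) auto
    have \<rho>1: "\<forall>r<16. r \<noteq> 13 \<longrightarrow> \<rho>1 r = \<rho> r" and r1: "\<rho>1 13 = pos k + t" "\<rho>1 16 = length ?e - t"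
      and p1: "partial \<mu>1 k t" and ag1: "agree {1, 2, 3} \<mu> \<mu>1" and om: "\<omega>1 = \<omega>"
      using inv by (auto simp: I_def s)
    have b1: "bases \<rho>1" using bases_cong[OF b] \<rho>1 by simp
    define q where "q = pos k + 1 + t"
    have qin: "q < length input" using input_nth(1)[OF k, of "Suc t"] t by (simp add: q_def)
    then have qR: "q < R" using R by simp
    define v where "v = ?e ! t"
    have "agree {1, 2, 3, 4, 5} start_mem \<mu>1" using agree_trans[OF ag ag1, of "{1,2,3,4,5}"] by simp
    then have "\<mu>1 q = start_mem q" using agree_start qin by blast
    then have mq: "\<mu>1 q = v" using start_mem_pos(2)[OF k t] by (simp add: q_def v_def)
    have "distinct ?e" "set ?e \<subseteq> {..<n}" using wf[of ?e] k by auto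
    then have vn: "v < n" using nth_mem[OF t] by (auto simp: v_def)
    have vt: "v \<notin> set (take t ?e)"
      using \<open>distinct ?e\<close> t by (auto simp: v_def distinct_conv_nth in_set_conv_nth)
    let ?\<mu> = "\<mu>1(adr 2 q := \<mu>1 (adr 1 v), adr 1 v := q, adr 3 q := k)"
    let ?is = "[IAdd 13 13 10, ILoad 18 13, IAdd 19 1 18, ILoad 40 19, IAdd 41 2 13,
     IStore 41 40, IStore 19 13, IAdd 41 3 13, IStore 41 14, ISub 16 16 10]"
    have "\<rho>1 14 = k" using \<rho>1 r(2) by simp
    have eq: "fold instr_step ?is s =
      (\<rho>1(13 := q, 18 := v, 19 := adr 1 v, 40 := \<mu>1 (adr 1 v), 41 := adr 3 q, 16 := length ?e - Suc t), ?\<mu>, \<omega>)"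
    proof -
      have "pos k + t + 1 = q" "length ?e - t - 1 = length ?e - Suc t" by (simp_all add: q_def)
      with \<open>\<rho>1 14 = k\<close> show ?thesis using r1 mq by (simp add: s om base_add[OF b1] del: One_nat_def add_Suc_right)
    qed
    have upd: "?\<mu> (adr 2 i) = \<mu>1 (adr 2 i) \<and> ?\<mu> (adr 3 i) = \<mu>1 (adr 3 i)" if "i < q" for i
      using that qR vn by simp
    have "partial ?\<mu> k (Suc t)"
      unfolding partial_def
    proof (intro allI impI)
      fix u assume u: "u < n"
      have l: "linked \<mu>1 q (\<mu>1 (adr 1 u)) (part u k t)" using p1 u by (simp add: partial_def q_def)
      have l': "linked ?\<mu> (pos k + 1 + Suc t) (\<mu>1 (adr 1 u)) (part u k t)"
        by (rule linked_upd[OF l _ upd]) (simp_all add: q_def)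
      have tk: "set (take (Suc t) ?e) = insert v (set (take t ?e))"
        using t by (simp add: take_Suc_conv_app_nth v_def)
      show "linked ?\<mu> (pos k + 1 + Suc t) (?\<mu> (adr 1 u)) (part u k (Suc t))"
      proof (cases "u = v")
        case True
        have "part u k (Suc t) = k # part u k t" using True vt by (simp add: part_def tk)
        moreover have "?\<mu> (adr 1 u) = q" "?\<mu> (adr 3 q) = k" "?\<mu> (adr 2 q) = \<mu>1 (adr 1 u)"
          using True vn qR by simp_all
        moreover have "0 < q" "q < pos k + 1 + Suc t" by (simp_all add: q_def)
        ultimately show ?thesis using l' by (simp only: linked.simps)
      next
        case False
        have "part u k (Suc t) = part u k t" using False by (simp add: part_def tk)
        moreover have "?\<mu> (adr 1 u) = \<mu>1 (adr 1 u)" using False u vn qR by simp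
        ultimately show ?thesis using l' by (simp only:)
      qed
    qed
    moreover have "agree {1, 2, 3} \<mu> ?\<mu>"
      by (intro agree_upd ag1) (use vn qR in auto)
    ultimately have "I (Suc t) (fold instr_step ?is s)"
      unfolding eq using \<rho>1 by (simp add: I_def q_def)
    then have "wp link_body 11 (I (Suc t)) s" unfolding link_body_def by (rule wp_instrs) simp
    then show "fst s 16 \<noteq> 0 \<and> wp link_body 11 (I (Suc t)) s" using r1 t by (simp add: s)
  next
    fix s :: state assume "I (length ?e) s"
    then show "fst s 16 = 0 \<and> ?Q s"
      by (auto simp: I_def)
  qed simp
qed

text \<open>Both counters of an edge start at its size because both sets start empty; the edge lists
  have no repetitions, so length and cardinality agree.\<close>

lemma wp_edges:
  assumes b: "bases \<rho>" and r: "\<rho> 13 = 2" "\<rho> 14 = 0" "\<rho> 15 = length es"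
  shows "wp (While_nz 15 edge_body) ((\<Sum>k<length es. 12 * length (es ! k) + 12) + 1)
    (\<lambda>(\<rho>', \<mu>', \<omega>'). \<omega>' = \<omega> \<and> (\<forall>r<12. \<rho>' r = \<rho> r) \<and> incidence \<mu>' \<and> stores2 \<mu>' ({}, {})) (\<rho>, start_mem, \<omega>)" (is "wp _ _ ?Q _")
proof -
  let ?K = "{1, 2, 3, 4, 5} :: nat set"
  define I where "I t = (\<lambda>(\<rho>', \<mu>', \<omega>'). \<omega>' = \<omega> \<and> (\<forall>r<12. \<rho>' r = \<rho> r) \<and> \<rho>' 13 = pos t \<and> \<rho>' 14 = t \<and>
      \<rho>' 15 = length es - t \<and> partial \<mu>' t 0 \<and> agree ?K start_mem \<mu>' \<and>
      (\<forall>k<t. \<mu>' (adr 4 k) = length (es ! k) \<and> \<mu>' (adr 5 k) = length (es ! k)))" for t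
  show ?thesis
  proof (rule wp_While[where I = I and n = "length es" and f = "\<lambda>t. 12 * length (es ! t) + 11"])
    show "I 0 (\<rho>, start_mem, \<omega>)"
      using r start_mem_zero by (simp add: I_def agree_refl pos_def partial_def part_def)
  next
    fix t and s :: state assume t: "t < length es" and inv: "I t s"
    obtain \<rho>1 \<mu>1 \<omega>1 where s: "s = (\<rho>1, \<mu>1, \<omega>1)" by (cases s) auto
    have \<rho>1: "\<forall>r<12. \<rho>1 r = \<rho> r" and r1: "\<rho>1 13 = pos t" "\<rho>1 14 = t" "\<rho>1 15 = length es - t"
      and p1: "partial \<mu>1 t 0" and ag1: "agree ?K start_mem \<mu>1" and om: "\<omega>1 = \<omega>"
      and c1: "\<forall>k<t. \<mu>1 (adr 4 k) = length (es ! k) \<and> \<mu>1 (adr 5 k) = length (es ! k)"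
      using inv by (auto simp: I_def s)
    have b1: "bases \<rho>1" using bases_cong[OF b] \<rho>1 by simp
    let ?l = "length (es ! t)"
    have ml: "\<mu>1 (pos t) = ?l"
      using agree_start[OF ag1, of "pos t"] input_nth(1)[OF t, of 0] start_mem_pos(1)[OF t] by simp
    define \<rho>2 where "\<rho>2 = \<rho>1(16 := ?l, 17 := adr 5 t)"
    define \<mu>2 where "\<mu>2 = \<mu>1(adr 4 t := ?l, adr 5 t := ?l)"
    have b2: "bases \<rho>2" using bases_cong[OF b1] by (simp add: \<rho>2_def)
    have A1: "wp (instrs [ILoad 16 13, IAdd 17 4 14, IStore 17 16, IAdd 17 5 14, IStore 17 16]) 6 (\<lambda>s. s = (\<rho>2, \<mu>2, \<omega>)) s"
      using r1 ml by (intro wp_instrs) (simp_all add: s om base_add[OF b1] \<rho>2_def \<mu>2_def)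
    have ag2': "agree {4, 5} \<mu>1 \<mu>2" unfolding \<mu>2_def by (intro agree_upd agree_refl) (use t in auto)
    then have ag2: "agree ?K start_mem \<mu>2" using agree_trans[OF ag1, of "{4, 5}" \<mu>2 ?K] by simp
    have p2: "partial \<mu>2 t 0"
      unfolding partial_def
    proof (intro allI impI)
      fix v assume v: "v < n"
      have "\<mu>2 (adr 1 v) = \<mu>1 (adr 1 v)" using v t by (simp add: \<mu>2_def)
      moreover have "linked \<mu>1 (pos t + 1 + 0) (\<mu>1 (adr 1 v)) (part v t 0)" using p1 v by (simp only: partial_def)
      moreover have "pos t + 1 + 0 \<le> R" using input_nth(1)[OF t, of 0] R by simp
      ultimately show "linked \<mu>2 (pos t + 1 + 0) (\<mu>2 (adr 1 v)) (part v t 0)"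
        using linked_agree[OF ag2'] by simp
    qed
    have c2: "\<forall>k<Suc t. \<mu>2 (adr 4 k) = length (es ! k) \<and> \<mu>2 (adr 5 k) = length (es ! k)"
      using c1 t by (auto simp: \<mu>2_def less_Suc_eq)
    have A2: "wp (While_nz 16 link_body) (12 * ?l + 1)
       (\<lambda>(\<rho>', \<mu>', \<omega>'). \<omega>' = \<omega> \<and> (\<forall>r<16. r \<noteq> 13 \<longrightarrow> \<rho>' r = \<rho>2 r) \<and> \<rho>' 13 = pos t + ?l \<and>
         partial \<mu>' t ?l \<and> agree {1, 2, 3} \<mu>2 \<mu>') s'" if "s' = (\<rho>2, \<mu>2, \<omega>)" for s'
      unfolding that by (rule wp_link[OF b2 t p2 ag2]) (simp_all add: \<rho>2_def r1)
    have A3: "wp (instrs [IAdd 13 13 10, IAdd 14 14 10, ISub 15 15 10]) 4 (I (Suc t)) s'"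
      if H: "(\<lambda>(\<rho>', \<mu>', \<omega>'). \<omega>' = \<omega> \<and> (\<forall>r<16. r \<noteq> 13 \<longrightarrow> \<rho>' r = \<rho>2 r) \<and> \<rho>' 13 = pos t + ?l \<and>
         partial \<mu>' t ?l \<and> agree {1, 2, 3} \<mu>2 \<mu>') s'" for s'
    proof (rule wp_instrs)
      obtain \<rho>3 \<mu>3 where s': "s' = (\<rho>3, \<mu>3, \<omega>)" and \<rho>3: "\<forall>r<16. r \<noteq> 13 \<longrightarrow> \<rho>3 r = \<rho>2 r" and p13: "\<rho>3 13 = pos t + ?l"
        and p3: "partial \<mu>3 t ?l" and ag3: "agree {1, 2, 3} \<mu>2 \<mu>3" using H by (cases s') auto
      have "part v t ?l = part v (Suc t) 0" for v by (simp add: part_def edge_def)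
      then have "partial \<mu>3 (Suc t) 0"
        using p3 linked_upd[of \<mu>3 "pos t + 1 + ?l" _ _ "pos (Suc t) + 1 + 0" \<mu>3] by (simp add: partial_def pos_Suc)
      moreover have "agree ?K start_mem \<mu>3" using agree_trans[OF ag2 ag3, of ?K] by simp
      moreover have "\<forall>k<Suc t. \<mu>3 (adr 4 k) = length (es ! k) \<and> \<mu>3 (adr 5 k) = length (es ! k)"
        using c2 agreeD[OF ag3] t by simp
      moreover have "\<rho>3 10 = 1" "\<rho>3 14 = t" "\<rho>3 15 = length es - t" "\<forall>r<12. \<rho>3 r = \<rho> r"
        using \<rho>3 \<rho>1 r1 base_add(2)[OF b2] by (simp_all add: \<rho>2_def)
      ultimately show "I (Suc t) (fold instr_step [IAdd 13 13 10, IAdd 14 14 10, ISub 15 15 10] s')"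
        using p13 by (simp add: I_def s' pos_Suc)
    qed simp
    have "wp edge_body (12 * ?l + 11) (I (Suc t)) s"
      unfolding edge_body_def by (rule wp_Seq[OF A1 wp_Seq[OF A2 A3 order_refl]]) simp_all
    then show "fst s 15 \<noteq> 0 \<and> wp edge_body (12 * ?l + 11) (I (Suc t)) s" using r1 t by (simp add: s)
  next
    fix s :: state assume inv: "I (length es) s"
    obtain \<rho>1 \<mu>1 \<omega>1 where s: "s = (\<rho>1, \<mu>1, \<omega>1)" by (cases s) auto
    have p1: "partial \<mu>1 (length es) 0" and ag1: "agree ?K start_mem \<mu>1"
      and c1: "\<forall>k<length es. \<mu>1 (adr 4 k) = length (es ! k) \<and> \<mu>1 (adr 5 k) = length (es ! k)"
      using inv by (auto simp: I_def s)
    have "incidence \<mu>1"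
      unfolding incidence_def
    proof (intro allI impI)
      fix v assume v: "v < n"
      have "part v (length es) 0 = inc v" by (simp add: part_def inc_def)
      then have "linked \<mu>1 (pos (length es) + 1 + 0) (\<mu>1 (adr 1 v)) (inc v)" using p1 v by (metis partial_def)
      then show "linked \<mu>1 R (\<mu>1 (adr 1 v)) (inc v)"
        by (rule linked_upd) (use v R pos_end in auto)
    qed
    moreover have "\<mu>1 (adr 6 v) = 0 \<and> \<mu>1 (adr 7 v) = 0" if "v < n" for v
      using agreeD[OF ag1, of 6 v] agreeD[OF ag1, of 7 v] that start_mem_zero by simp
    moreover have "card (edge k) = length (es ! k)" if "k < length es" for k
      using wf[of "es ! k"] that distinct_card by (auto simp: edge_def)
    ultimately show "fst s 15 = 0 \<and> ?Q s"
      using inv c1 by (auto simp: I_def s stores2_def stores_def)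
  next
    have "(\<Sum>k<length es. 12 * length (es ! k) + 11 + 1) = (\<Sum>k<length es. 12 * length (es ! k) + 12)"
      by (rule sum.cong) simp_all
    then show "(\<Sum>k<length es. 12 * length (es ! k) + 11 + 1) + 1 \<le> (\<Sum>k<length es. 12 * length (es ! k) + 12) + 1" by simp
  qed
qed

lemma wp_output:
  assumes b: "bases \<rho>" and st: "stores2 \<mu> P" and r: "\<rho> 20 = n"
  shows "wp (While_nz 20 output_body) (6 * n + 1) (\<lambda>(\<rho>', \<mu>', \<omega>'). \<forall>v<n. \<mu>' v = of_bool (v \<in> fst P)) (\<rho>, \<mu>, \<omega>)" (is "wp _ _ ?Q _")
proof -
  define I where "I t = (\<lambda>(\<rho>', \<mu>', \<omega>' :: bool stream). (\<forall>r<12. \<rho>' r = \<rho> r) \<and> \<rho>' 20 = n - t \<and> agree {0} \<mu> \<mu>' \<and>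
    (\<forall>v<n. n - t \<le> v \<longrightarrow> \<mu>' (adr 0 v) = of_bool (v \<in> fst P)))" for t
  show ?thesis
  proof (rule wp_While[where I = I and n = n and f = "\<lambda>_. 5"])
    show "I 0 (\<rho>, \<mu>, \<omega>)" using r by (simp add: I_def agree_refl)
  next
    fix t and s :: state assume t: "t < n" and inv: "I t s"
    obtain \<rho>1 \<mu>1 \<omega>1 where s: "s = (\<rho>1, \<mu>1, \<omega>1)" by (cases s) auto
    have \<rho>1: "\<forall>r<12. \<rho>1 r = \<rho> r" and r1: "\<rho>1 20 = n - t" and ag: "agree {0} \<mu> \<mu>1"
      and o1: "\<forall>v<n. n - t \<le> v \<longrightarrow> \<mu>1 (adr 0 v) = of_bool (v \<in> fst P)"
      using inv by (auto simp: I_def s)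
    have b1: "bases \<rho>1" using bases_cong[OF b] \<rho>1 by simp
    define v where "v = n - Suc t"
    have v: "n - t = Suc v" "v < n" using t by (auto simp: v_def)
    have mv: "\<mu>1 (adr 6 v) = of_bool (v \<in> fst P)"
      using agreeD[OF ag, of 6 v] v st by (simp add: stores2_def stores_def)
    let ?\<mu> = "\<mu>1(adr 0 v := of_bool (v \<in> fst P))"
    have eq: "fold instr_step [ISub 20 20 10, IAdd 34 6 20, ILoad 34 34, IStore 20 34] s =
      (\<rho>1(20 := v, 34 := of_bool (v \<in> fst P)), ?\<mu>, \<omega>1)"
      using r1 v mv by (simp add: s base_add[OF b1]) (simp add: adr_def)
    have "\<forall>u<n. v \<le> u \<longrightarrow> ?\<mu> (adr 0 u) = of_bool (u \<in> fst P)"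
    proof (intro allI impI)
      fix u assume "u < n" "v \<le> u"
      then show "?\<mu> (adr 0 u) = of_bool (u \<in> fst P)"
        using o1 v by (cases "u = v") auto
    qed
    then have "I (Suc t) (fold instr_step [ISub 20 20 10, IAdd 34 6 20, ILoad 34 34, IStore 20 34] s)"
      unfolding eq using \<rho>1 agree_upd[OF ag] v by (simp add: I_def v_def[symmetric])
    then have "wp output_body 5 (I (Suc t)) s" unfolding output_body_def by (rule wp_instrs) simp
    then show "fst s 20 \<noteq> 0 \<and> wp output_body 5 (I (Suc t)) s" using r1 t by (simp add: s)
  next
    fix s :: state assume "I n s"
    then show "fst s 20 = 0 \<and> ?Q s"
      by (auto simp: I_def adr_def)
  qed simp
qed

section \<open>The sampler\<close>

definition setup_cost :: nat where
  "setup_cost = 6 * length es + (\<Sum>k<length es. 12 * length (es ! k) + 12) + 20 * n + 34"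

lemma heads_isos: "heads isos \<omega> \<inter> set ords = {}"
  using nth_mem[of _ isos] by (auto simp: heads_def isos_def ords_def)

lemma wp_sampler:
  fixes \<omega> :: "bool stream"
  defines "B \<equiv> round_pair (sdrop (length isos) \<omega>) (heads isos \<omega>)"
  assumes J: "fst (B J) = snd (B J)" "\<And>k. k < J \<Longrightarrow> fst (B k) \<noteq> snd (B k)"
  shows "wp sampler (setup_cost + (\<Sum>k\<le>J. 112 * 2 ^ k * scan_cost + 16))
    (\<lambda>(\<rho>', \<mu>', \<omega>'). \<forall>v<n. \<mu>' v = of_bool (v \<in> fst (B J))) (init_state input \<omega>)" (is "wp _ _ ?Q _")
proof -
  let ?\<omega> = "sdrop (length isos) \<omega>" and ?I = "heads isos \<omega>"
  define Q1 where "Q1 = (\<lambda>(\<rho>', \<mu>', \<omega>'). \<omega>' = \<omega> \<and> bases \<rho>' \<and> incidence \<mu>' \<and> stores2 \<mu>' ({}, {}))"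
  define Q2 where "Q2 = (\<lambda>(\<rho>', \<mu>', \<omega>'). \<omega>' = ?\<omega> \<and> bases \<rho>' \<and> \<rho>' 22 = length ords \<and> ready \<mu>' \<and> stores2 \<mu>' (?I, ?I))"
  define Q3 where "Q3 = (\<lambda>(\<rho>', \<mu>', \<omega>' :: bool stream). bases \<rho>' \<and> stores2 \<mu>' (B J))"
  have 2: "wp (While_nz 15 edge_body) ((\<Sum>k<length es. 12 * length (es ! k) + 12) + 1) Q1 s"
    if H: "(\<lambda>(\<rho>', \<mu>', \<omega>'). \<omega>' = \<omega> \<and> \<mu>' = start_mem \<and> bases \<rho>' \<and> \<rho>' 13 = 2 \<and> \<rho>' 14 = 0 \<and> \<rho>' 15 = length es) s" for s
  proof -
    obtain \<rho>1 where s: "s = (\<rho>1, start_mem, \<omega>)" and b: "bases \<rho>1" and r: "\<rho>1 13 = 2" "\<rho>1 14 = 0" "\<rho>1 15 = length es"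
      using H by (cases s) auto
    show ?thesis unfolding s
      by (rule wp_mono[OF wp_edges[OF b r] order_refl]) (auto simp: Q1_def intro: bases_cong[OF b])
  qed
  have 3: "wp (instrs [IConst 20 0, ICopy 21 11, IConst 22 0]) 4 (\<lambda>s. Q1 s \<and> fst s 20 = 0 \<and> fst s 21 = n \<and> fst s 22 = 0) s" if "Q1 s" for s
    using that by (intro wp_instrs) (cases s, auto simp: Q1_def bases_def)
  have 4: "wp (While_nz 21 classify_body) (14 * n + 1) Q2 s" if H: "Q1 s \<and> fst s 20 = 0 \<and> fst s 21 = n \<and> fst s 22 = 0" for s
  proof -
    obtain \<rho>1 \<mu>1 where s: "s = (\<rho>1, \<mu>1, \<omega>)" and b: "bases \<rho>1" and i: "incidence \<mu>1" and st: "stores2 \<mu>1 ({}, {})"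
      and r: "\<rho>1 20 = 0" "\<rho>1 21 = n" "\<rho>1 22 = 0"
      using H by (cases s) (auto simp: Q1_def)
    show ?thesis unfolding s
      by (rule wp_mono[OF wp_classify[OF b i st r] order_refl]) (auto simp: Q2_def intro: bases_cong[OF b])
  qed
  have 5: "wp (instrs [IConst 23 1, IConst 24 0, ICopy 25 22]) 4 (\<lambda>s. Q2 s \<and> fst s 23 = 1 \<and> fst s 24 = 0 \<and> fst s 25 = length ords) s" if "Q2 s" for s
    using that by (intro wp_instrs) (cases s, auto simp: Q2_def bases_def)
  have 6: "wp (While_nz 23 cftp_round) (\<Sum>k\<le>J. 112 * 2 ^ k * scan_cost + 16) Q3 s"
    if H: "Q2 s \<and> fst s 23 = 1 \<and> fst s 24 = 0 \<and> fst s 25 = length ords" for s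
  proof -
    obtain \<rho>1 \<mu>1 where s: "s = (\<rho>1, \<mu>1, ?\<omega>)" and b: "bases \<rho>1" and rd: "ready \<mu>1" and st: "stores2 \<mu>1 (?I, ?I)"
      and r: "\<rho>1 22 = length ords" "\<rho>1 23 = 1" "\<rho>1 24 = 0" "\<rho>1 25 = length ords"
      using H by (cases s) (auto simp: Q2_def)
    show ?thesis unfolding s
      by (rule wp_mono[OF wp_doubling[OF b rd st heads_isos r J[unfolded B_def]] order_refl])
        (auto simp: Q3_def B_def intro: bases_cong[OF b])
  qed
  have 7: "wp (instrs [ICopy 20 11]) 2 (\<lambda>s. Q3 s \<and> fst s 20 = n) s" if "Q3 s" for s
    using that by (intro wp_instrs) (cases s, auto simp: Q3_def bases_def)
  have 8: "wp (While_nz 20 output_body) (6 * n + 1) ?Q s"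
    if "Q3 s \<and> fst s 20 = n" for s
    using that wp_output[of "fst s" "fst (snd s)" "B J" "snd (snd s)"] by (cases s) (auto simp: Q3_def)
  show ?thesis
    unfolding sampler_def
    by (rule wp_Seq[OF wp_prelude wp_Seq[OF 2 wp_Seq[OF 3 wp_Seq[OF 4 wp_Seq[OF 5 wp_Seq[OF 6 wp_Seq[OF 7 8 order_refl]
      order_refl] order_refl] order_refl] order_refl] order_refl]]) (simp_all add: setup_cost_def)
qed

end

section \<open>Programs read finitely many coins\<close>

text \<open>A halting run consumes some number \<open>k\<close> of coins, and every stream with the
  same first \<open>k\<close> coins leads to the same run; only the unread rest of the stream
  differs.\<close>

lemma exec_prefix:
  assumes "exec c s t s'"
  shows "\<exists>k. snd (snd s') = sdrop k (snd (snd s)) \<and>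
    (\<forall>\<omega>'. stake k \<omega>' = stake k (snd (snd s)) \<longrightarrow> exec c (fst s, fst (snd s), \<omega>') t (fst s', fst (snd s'), sdrop k \<omega>'))"
  using assms
proof (induction rule: exec.induct)
  case (Instr i s)
  obtain \<rho> \<mu> \<omega> where s: "s = (\<rho>, \<mu>, \<omega>)" by (cases s) auto
  define k :: nat where "k = (case i of IFlip _ \<Rightarrow> 1 | _ \<Rightarrow> 0)"
  have st: "snd (snd (instr_step i s)) = sdrop k \<omega>" by (cases i) (simp_all add: s k_def)
  have eq: "instr_step i (\<rho>, \<mu>, \<omega>') = (fst (instr_step i s), fst (snd (instr_step i s)), sdrop k \<omega>')"
    if "stake k \<omega>' = stake k \<omega>" for \<omega>'
    using that by (cases i) (simp_all add: s k_def)
  show ?case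
  proof (intro exI[of _ k] conjI allI impI)
    fix \<omega>' assume "stake k \<omega>' = stake k (snd (snd s))"
    then have h: "stake k \<omega>' = stake k \<omega>" by (simp add: s)
    show "exec (Instr i) (fst s, fst (snd s), \<omega>') 1 (fst (instr_step i s), fst (snd (instr_step i s)), sdrop k \<omega>')"
      using exec.Instr[of i "(\<rho>, \<mu>, \<omega>')"] unfolding eq[OF h] by (simp add: s)
  qed (use st in \<open>simp add: s\<close>)
next
  case (Seq c\<^sub>1 s t\<^sub>1 s1 c\<^sub>2 t\<^sub>2 s2)
  obtain k where k: "snd (snd s1) = sdrop k (snd (snd s))"
    "\<And>\<omega>'. stake k \<omega>' = stake k (snd (snd s)) \<Longrightarrow> exec c\<^sub>1 (fst s, fst (snd s), \<omega>') t\<^sub>1 (fst s1, fst (snd s1), sdrop k \<omega>')"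
    using Seq.IH(1) by blast
  obtain l where l: "snd (snd s2) = sdrop l (snd (snd s1))"
    "\<And>\<omega>'. stake l \<omega>' = stake l (snd (snd s1)) \<Longrightarrow> exec c\<^sub>2 (fst s1, fst (snd s1), \<omega>') t\<^sub>2 (fst s2, fst (snd s2), sdrop l \<omega>')"
    using Seq.IH(2) by blast
  show ?case
  proof (intro exI[of _ "k + l"] conjI allI impI)
    fix \<omega>' assume H: "stake (k + l) \<omega>' = stake (k + l) (snd (snd s))"
    have "stake k \<omega>' @ stake l (sdrop k \<omega>') = stake k (snd (snd s)) @ stake l (snd (snd s1))"
      unfolding k(1) stake_add by (rule H)
    then have "stake k \<omega>' = stake k (snd (snd s))" "stake l (sdrop k \<omega>') = stake l (snd (snd s1))"
      by (simp_all del: stake_add)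
    from exec.Seq[OF k(2)[OF this(1)] l(2)[OF this(2)]]
    show "exec (Seq c\<^sub>1 c\<^sub>2) (fst s, fst (snd s), \<omega>') (t\<^sub>1 + t\<^sub>2) (fst s2, fst (snd s2), sdrop (k + l) \<omega>')"
      by (simp add: sdrop_add)
  qed (simp add: k l sdrop_add)
next
  case (If_True s r c\<^sub>1 t s' c\<^sub>2)
  then show ?case using exec.If_True[of "(fst s, fst (snd s), _)" r c\<^sub>1 t _ c\<^sub>2] by fastforce
next
  case (If_False s r c\<^sub>2 t s' c\<^sub>1)
  then show ?case using exec.If_False[of "(fst s, fst (snd s), _)" r c\<^sub>2 t _ c\<^sub>1] by fastforce
next
  case (While_False s r c)
  then show ?case using exec.While_False[of "(fst s, fst (snd s), _)" r c] by (intro exI[of _ 0]) simp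
next
  case (While_True s r c t\<^sub>1 s1 t\<^sub>2 s2)
  obtain k where k: "snd (snd s1) = sdrop k (snd (snd s))"
    "\<And>\<omega>'. stake k \<omega>' = stake k (snd (snd s)) \<Longrightarrow> exec c (fst s, fst (snd s), \<omega>') t\<^sub>1 (fst s1, fst (snd s1), sdrop k \<omega>')"
    using While_True.IH(1) by blast
  obtain l where l: "snd (snd s2) = sdrop l (snd (snd s1))"
    "\<And>\<omega>'. stake l \<omega>' = stake l (snd (snd s1)) \<Longrightarrow> exec (While_nz r c) (fst s1, fst (snd s1), \<omega>') t\<^sub>2 (fst s2, fst (snd s2), sdrop l \<omega>')"
    using While_True.IH(2) by blast
  show ?case
  proof (intro exI[of _ "k + l"] conjI allI impI)
    fix \<omega>' assume H: "stake (k + l) \<omega>' = stake (k + l) (snd (snd s))"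
    have "stake k \<omega>' @ stake l (sdrop k \<omega>') = stake k (snd (snd s)) @ stake l (snd (snd s1))"
      unfolding k(1) stake_add by (rule H)
    then have "stake k \<omega>' = stake k (snd (snd s))" "stake l (sdrop k \<omega>') = stake l (snd (snd s1))"
      by (simp_all del: stake_add)
    from exec.While_True[OF _ k(2)[OF this(1)] l(2)[OF this(2)]] While_True.hyps(1)
    show "exec (While_nz r c) (fst s, fst (snd s), \<omega>') (t\<^sub>1 + t\<^sub>2 + 1) (fst s2, fst (snd s2), sdrop (k + l) \<omega>')"
      by (simp add: sdrop_add)
  qed (simp add: k l sdrop_add)
qed

text \<open>Halting depends on finitely many coins of each halting stream, so the event is a
  countable union of cylinder sets. The condition concerns memory only, since the unread coins vary
  within a cylinder.\<close>

lemma halting_event: "{\<omega>. \<exists>t s. exec P (init_state xs \<omega>) t s \<and> Q (fst (snd s))} \<in> sets coin_space" (is "?H \<in> _")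
proof -
  have "?H = (\<Union>k. {\<omega>. \<forall>\<omega>'. stake k \<omega>' = stake k \<omega> \<longrightarrow> \<omega>' \<in> ?H})"
  proof (intro set_eqI iffI)
    fix \<omega> assume "\<omega> \<in> ?H"
    then obtain t s where e: "exec P (init_state xs \<omega>) t s" and q: "Q (fst (snd s))" by blast
    obtain k where k: "\<And>\<omega>'. stake k \<omega>' = stake k \<omega> \<Longrightarrow> exec P (init_state xs \<omega>') t (fst s, fst (snd s), sdrop k \<omega>')"
      using exec_prefix[OF e] by (auto simp: init_state_def)
    have "\<omega>' \<in> ?H" if "stake k \<omega>' = stake k \<omega>" for \<omega>'
      using k[OF that] q by (auto intro!: exI)
    then show "\<omega> \<in> (\<Union>k. {\<omega>. \<forall>\<omega>'. stake k \<omega>' = stake k \<omega> \<longrightarrow> \<omega>' \<in> ?H})" by blast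
  qed blast
  also have "\<dots> \<in> sets coin_space"
  proof (rule sets.countable_UN)
    have "{\<omega>. \<forall>\<omega>'. stake k \<omega>' = stake k \<omega> \<longrightarrow> \<omega>' \<in> ?H} \<in> sets coin_space" for k
      by (rule stake_event[of "\<lambda>ys. \<forall>\<omega>'. stake k \<omega>' = ys \<longrightarrow> \<omega>' \<in> ?H"])
    then show "range (\<lambda>k. {\<omega>. \<forall>\<omega>'. stake k \<omega>' = stake k \<omega> \<longrightarrow> \<omega>' \<in> ?H}) \<subseteq> sets coin_space" by blast
  qed
  finally show ?thesis .
qed

section \<open>The schedule of the sampler\<close>

lemma mod_window:
  fixes a d N :: nat
  assumes "a < N" shows "\<exists>j\<in>{d..<d + N}. j mod N = a"
proof (induction d)
  case 0
  then show ?case using assms by (intro bexI[of _ a]) auto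
next
  case (Suc d)
  then obtain j where j: "d \<le> j" "j < d + N" "j mod N = a" by auto
  show ?case
  proof (cases "j = d")
    case True
    then show ?thesis using j assms by (intro bexI[of _ "d + N"]) auto
  next
    case False
    then show ?thesis using j by (intro bexI[of _ j]) auto
  qed
qed

lemma inj_on_mod_window: "inj_on (\<lambda>j::nat. j mod N) {d..<d + N}"
proof (rule inj_onI)
  have main: "j = j'" if "j \<in> {d..<d + N}" "j' \<in> {d..<d + N}" "j mod N = j' mod N" "j \<le> j'" for j j' :: nat
  proof -
    have "N dvd j' - j" using that mod_eq_dvd_iff_nat[of j j' N] by (metis mod_eq_dvd_iff_nat)
    moreover have "j' - j < N" using that by auto
    ultimately show ?thesis using that(4) by (metis diff_is_0_eq' dvd_imp_le le_antisym not_gr_zero not_less zero_less_diff)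
  qed
  fix j j' :: nat assume "j \<in> {d..<d + N}" "j' \<in> {d..<d + N}" "j mod N = j' mod N"
  then show "j = j'" using main[of j j'] main[of j' j] by (cases "j \<le> j'") auto
qed

locale hypergraph_input = layout +
  assumes nonempty: "e \<in> set es \<Longrightarrow> e \<noteq> []"
    and distinct_edges: "distinct (map set es)"
begin

definition hg :: "nat hypergraph" where "hg = ({..<n}, Es)"

lemma hg_simps [simp]: "verts hg = {..<n}" "edges hg = Es"
  by (simp_all add: hg_def)

lemma hypergraph_hg: "hypergraph hg"
  using wf nonempty by (auto simp: hypergraph_def Es_def)

lemma inc_Nil_iff: "inc v = [] \<longleftrightarrow> v \<notin> \<Union>Es"
proof -
  have "inc v = [] \<longleftrightarrow> (\<forall>k<length es. v \<notin> edge k)" by (auto simp: inc_def filter_empty_conv)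
  then show ?thesis by (auto simp: Es_eq)
qed

lemma set_isos: "set isos = {..<n} - \<Union>Es" and set_ords: "set ords = \<Union>Es"
proof -
  show "set isos = {..<n} - \<Union>Es" by (auto simp: isos_def inc_Nil_iff)
  have "\<Union>Es \<subseteq> {..<n}" using wf by (auto simp: Es_def)
  then show "set ords = \<Union>Es" by (auto simp: ords_def inc_Nil_iff)
qed

text \<open>The value \<open>isos ! 0\<close> keeps the schedule inside the vertex set when there is
  nothing to scan; this requires at least one vertex.\<close>

definition sched :: "nat \<Rightarrow> nat" where
  "sched i = (if i < length isos then isos ! i else if ords = [] then isos ! 0
     else ords ! ((i - length isos) mod length ords))"

lemma sched_schedule:
  assumes "0 < n" shows "schedule hg sched (length isos) (length ords)"
proof
  let ?s = "length isos" and ?N = "length ords"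
  have all: "set isos \<union> set ords = {..<n}" by (auto simp: isos_def ords_def)
  show "hypergraph hg" by (rule hypergraph_hg)
  show "sched i \<in> verts hg" for i
  proof (cases "i < ?s")
    case True
    have "isos ! i \<in> {..<n}" using nth_mem[OF True] all by blast
    then show ?thesis using True by (simp add: sched_def)
  next
    case False
    show ?thesis
    proof (cases "ords = []")
      case True
      then have si: "set isos = {..<n}" using all by simp
      have "0 < length isos"
      proof (rule ccontr)
        assume "\<not> 0 < length isos"
        then have "{..<n} = {}" unfolding si[symmetric] by simp
        then show False using assms by (simp add: lessThan_empty_iff)
      qed
      then have "isos ! 0 \<in> set isos" by (rule nth_mem)
      then have "isos ! 0 \<in> {..<n}" using all by blast
      then show ?thesis using False True by (simp add: sched_def)
    next
      case ne: False
      then have "ords ! ((i - ?s) mod ?N) \<in> set ords" by (intro nth_mem) simp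
      then have "ords ! ((i - ?s) mod ?N) \<in> {..<n}" using all by blast
      then show ?thesis using False ne by (simp add: sched_def)
    qed
  qed
  have late: "sched i = ords ! ((i - ?s) mod ?N)" if "?s \<le> i" "ords \<noteq> []" for i
    using that by (simp add: sched_def)
  show "\<exists>i<?s + ?N. sched i = v" if v: "v \<in> verts hg" for v
  proof (cases "v \<in> set isos")
    case True
    then obtain i where "i < ?s" "isos ! i = v" by (auto simp: in_set_conv_nth)
    then show ?thesis by (intro exI[of _ i]) (simp add: sched_def)
  next
    case False
    moreover have "v \<in> set isos \<union> set ords" unfolding all using v by simp
    ultimately have "v \<in> set ords" by blast
    then obtain i where i: "i < ?N" "ords ! i = v" by (auto simp: in_set_conv_nth)
    moreover from i have "ords \<noteq> []" by auto
    ultimately show ?thesis using late[of "?s + i"] by (intro exI[of _ "?s + i"]) simp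
  qed
  show "sched i \<notin> \<Union>(edges hg)" if "i < ?s" for i
    using nth_mem[OF that] set_isos that by (simp add: sched_def)
  show "\<exists>j\<in>{i..<i + ?N}. sched j = v" if v: "v \<in> \<Union>(edges hg)" and i: "?s \<le> i" for v i
  proof -
    obtain a where a: "a < ?N" "ords ! a = v" 
      using v unfolding hg_simps set_ords[symmetric] by (auto simp: in_set_conv_nth)
    obtain j where j: "j \<in> {i - ?s..<i - ?s + ?N}" "j mod ?N = a" using mod_window[OF a(1)] by blast
    from a have "ords \<noteq> []" by auto
    then have "sched (j + ?s) = v" using late[of "j + ?s"] a j by simp
    then show ?thesis using j i by (intro bexI[of _ "j + ?s"]) auto
  qed
  show "inj_on sched {i..<i + ?N}" if i: "?s \<le> i" for i
  proof (rule inj_onI)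
    fix j j' assume j: "j \<in> {i..<i + ?N}" "j' \<in> {i..<i + ?N}" "sched j = sched j'"
    then have ne: "ords \<noteq> []" by auto
    have "distinct ords" by (simp add: ords_def)
    then have "(j - ?s) mod ?N = (j' - ?s) mod ?N"
      using j late[of j] late[of j'] ne i by (simp add: nth_eq_iff_index_eq)
    moreover have "j - ?s \<in> {i - ?s..<i - ?s + ?N}" "j' - ?s \<in> {i - ?s..<i - ?s + ?N}" using j i by auto
    ultimately have "j - ?s = j' - ?s" using inj_on_mod_window[of ?N "i - ?s"] by (auto simp: inj_on_def)
    then show "j = j'" using j i by auto
  qed
qed

section \<open>Isolated vertices decouple from the scan\<close>

lemma upd_isolated: "v \<notin> \<Union>Es \<Longrightarrow> upd Es v b Z X = put b v X"
  by (auto simp: upd_def put_def)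

text \<open>Such an update copies its coin into both bounds, so the final block of the schedule
  overwrites the isolated part by the heads and does nothing else.\<close>

lemma bsim_isolated:
  assumes "i + k = length isos"
  shows "bsim Es sched c i k (A, B) =
    ((A - set (drop i isos)) \<union> {isos ! j |j. i \<le> j \<and> j < length isos \<and> c j},
     (B - set (drop i isos)) \<union> {isos ! j |j. i \<le> j \<and> j < length isos \<and> c j})"
  using assms
proof (induction k arbitrary: i)
  case 0
  then show ?case by auto
next
  case (Suc k)
  let ?H = "\<lambda>i. {isos ! j |j. i \<le> j \<and> j < length isos \<and> c j}"
  have i: "i < length isos" using Suc.prems by simp
  define v where "v = isos ! i"
  have d: "set (drop i isos) = insert v (set (drop (Suc i) isos))" using i by (simp add: Cons_nth_drop_Suc[symmetric] v_def)
  have "v \<notin> set (drop (Suc i) isos)"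
    using i distinct_drop[of isos i] by (simp add: Cons_nth_drop_Suc[symmetric] v_def isos_def)
  moreover have "?H (Suc i) \<subseteq> set (drop (Suc i) isos)"
  proof
    fix x assume "x \<in> ?H (Suc i)"
    then obtain j where "Suc i \<le> j" "j < length isos" "x = isos ! j" by auto
    then show "x \<in> set (drop (Suc i) isos)" by (auto simp: in_set_conv_nth intro!: exI[of _ "j - Suc i"])
  qed
  ultimately have vH: "v \<notin> ?H (Suc i)" by blast
  have H: "?H i = (if c i then insert v (?H (Suc i)) else ?H (Suc i))"
    using i by (auto simp: v_def Suc_le_eq le_less)
  have vE: "v \<notin> \<Union>Es" using nth_mem[OF i] set_isos by (simp add: v_def)
  have sv: "sched i = v" using i by (simp add: sched_def v_def)
  have "put (c i) v (X - set (drop (Suc i) isos) \<union> ?H (Suc i)) = X - set (drop i isos) \<union> ?H i" for X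
    unfolding d H put_def using vH by auto
  then show ?case using Suc.IH[of "Suc i"] Suc.prems by (simp add: upd2_def sv upd_isolated[OF vE])
qed

text \<open>If no edge meets \<open>S\<close> and no update hits \<open>S\<close>, then the test for
  blocking cannot see \<open>S\<close>.\<close>

lemma bsim_cong_off:
  assumes "\<And>j. i \<le> j \<Longrightarrow> j < i + k \<Longrightarrow> \<sigma> j \<notin> S" "\<And>C. C \<in> E \<Longrightarrow> C \<inter> S = {}"
    "fst P - S = fst P' - S" "snd P - S = snd P' - S"
  shows "fst (bsim E \<sigma> c i k P) - S = fst (bsim E \<sigma> c i k P') - S \<and> snd (bsim E \<sigma> c i k P) - S = snd (bsim E \<sigma> c i k P') - S"
  using assms(1)
proof (induction k arbitrary: i)
  case 0
  then show ?case using assms by simp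
next
  case (Suc k)
  have step: "upd E v b Z X - S = upd E v b Z' X' - S" if "Z - S = Z' - S" "X - S = X' - S" "v \<notin> S" for v b Z Z' X X'
  proof -
    have "C - {v} \<subseteq> Z \<longleftrightarrow> C - {v} \<subseteq> Z'" if "C \<in> E" for C
      using assms(2)[OF that] \<open>Z - S = Z' - S\<close> by blast
    then have "(\<forall>C\<in>E. v \<in> C \<longrightarrow> \<not> C - {v} \<subseteq> Z) \<longleftrightarrow> (\<forall>C\<in>E. v \<in> C \<longrightarrow> \<not> C - {v} \<subseteq> Z')" by blast
    then show ?thesis using that by (auto simp: upd_def)
  qed
  have "\<sigma> i \<notin> S" using Suc.prems[of i] by simp
  moreover have "fst (bsim E \<sigma> c (Suc i) k P) - S = fst (bsim E \<sigma> c (Suc i) k P') - S"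
    "snd (bsim E \<sigma> c (Suc i) k P) - S = snd (bsim E \<sigma> c (Suc i) k P') - S"
    using Suc.IH[of "Suc i"] Suc.prems by auto
  ultimately show ?case unfolding bsim.simps upd2_def fst_conv snd_conv by (intro conjI step)
qed

text \<open>The machine draws the isolated vertices before all scans, while the schedule updates
  them last. The two parts do not interact, so the pairs agree: off the isolated vertices by
  \<open>bsim_cong_off\<close>, on them by \<open>bsim_isolated\<close>.\<close>

lemma bsim_round_pair:
  "bsim Es sched (snth \<omega>) 0 (length isos + 2 ^ k * length ords) ({}, {..<n}) =
    round_pair (sdrop (length isos) \<omega>) (heads isos \<omega>) k"
proof -
  let ?s = "length isos" and ?len = "2 ^ k * length ords" and ?S = "set isos"
  let ?c = "snth (sdrop ?s \<omega>)" and ?I = "heads isos \<omega>"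
  have "bsim Es sched (snth \<omega>) (0 + ?s) ?len ({}, {..<n}) = bsim Es cyc ?c 0 ?len ({}, {..<n})"
    unfolding bsim_shift
  proof (rule bsim_cong)
    fix j assume j: "j < 0 + ?len"
    then have "ords \<noteq> []" by auto
    then show "\<omega> !! (j + ?s) = ?c j \<and> sched (j + ?s) = cyc j"
      by (simp add: sched_def cyc_def sdrop_snth add.commute)
  qed
  then have eq: "bsim Es sched (snth \<omega>) 0 (?s + ?len) ({}, {..<n}) =
      bsim Es sched (snth \<omega>) 0 ?s (bsim Es cyc ?c 0 ?len ({}, {..<n}))"
    by (simp add: bsim_append)
  obtain A B where AB: "bsim Es cyc ?c 0 ?len ({}, {..<n}) = (A, B)" by fastforce
  have H: "{isos ! j |j. 0 \<le> j \<and> j < ?s \<and> \<omega> !! j} = ?I" by (auto simp: heads_def)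
  have IS: "?I \<subseteq> ?S" using nth_mem[of _ isos] by (auto simp: heads_def)
  have cyc_ords: "cyc j \<in> set ords" if "j < ?len" for j
    using that by (cases "ords = []") (auto simp: cyc_def)
  have disj: "set ords \<inter> ?S = {}" using set_isos set_ords by blast
  have VS: "{..<n} - ?S = set ords" using set_isos set_ords wf by (auto simp: Es_def)
  have "fst (bsim Es cyc ?c 0 ?len ({}, {..<n})) - ?S = fst (bsim Es cyc ?c 0 ?len (?I, ?I \<union> set ords)) - ?S \<and>
      snd (bsim Es cyc ?c 0 ?len ({}, {..<n})) - ?S = snd (bsim Es cyc ?c 0 ?len (?I, ?I \<union> set ords)) - ?S"
  proof (rule bsim_cong_off)
    show "cyc j \<notin> ?S" if "0 \<le> j" "j < 0 + ?len" for j using cyc_ords[of j] that disj by auto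
    show "C \<inter> ?S = {}" if "C \<in> Es" for C using that set_isos by auto
    show "fst ({}, {..<n}) - ?S = fst (?I, ?I \<union> set ords) - ?S" using IS by auto
    show "snd ({}, {..<n}) - ?S = snd (?I, ?I \<union> set ords) - ?S" using IS VS disj by auto
  qed
  then have off: "fst (round_pair (sdrop ?s \<omega>) ?I k) - ?S = A - ?S" "snd (round_pair (sdrop ?s \<omega>) ?I k) - ?S = B - ?S"
    by (simp_all add: AB round_pair_def)
  have dI: "?I \<inter> set ords = {}" by (rule heads_isos)
  have on: "X = (X - ?S) \<union> ?I" if "X - set ords = ?I" for X using that IS disj by blast
  have "bsim Es sched (snth \<omega>) 0 ?s (A, B) = (A - ?S \<union> ?I, B - ?S \<union> ?I)"
    using bsim_isolated[of 0 ?s "snth \<omega>" A B] H by simp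
  also have "\<dots> = round_pair (sdrop ?s \<omega>) ?I k"
    using on[OF round_pair_props(1)[OF dI]] on[OF round_pair_props(2)[OF dI]] off by (metis prod.collapse)
  finally show ?thesis using eq AB by simp
qed

definition coal :: "bool stream \<Rightarrow> nat \<Rightarrow> bool" where
  "coal \<omega> k \<longleftrightarrow> coalesced hg sched (snth \<omega>) (length isos + 2 ^ k * length ords)"

lemma coal_iff:
  "coal \<omega> k \<longleftrightarrow> fst (round_pair (sdrop (length isos) \<omega>) (heads isos \<omega>) k) =
     snd (round_pair (sdrop (length isos) \<omega>) (heads isos \<omega>) k)"
  unfolding coal_def coalesced_def by (simp add: bsim_round_pair)

definition result :: "state \<Rightarrow> nat set" where
  "result s = {v. v < n \<and> fst (snd s) v \<noteq> 0}"

lemma round_pair_subset: "fst (round_pair (sdrop (length isos) \<omega>) (heads isos \<omega>) k) \<subseteq> {..<n}"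
proof (cases "n = 0")
  case True
  have "isos = []" "ords = []" unfolding isos_def ords_def using True by simp_all
  then show ?thesis by (simp add: round_pair_def heads_def)
next
  case False
  then interpret schedule hg sched "length isos" "length ords" by (intro sched_schedule) simp
  show ?thesis
    unfolding bsim_round_pair[symmetric]
    using bsim_range[of "({}, {..<n})" "{..<n}" sched Es "snth \<omega>" 0] sched_verts by simp
qed

lemma sampler_halts:
  assumes "coal \<omega> J" "\<And>k. k < J \<Longrightarrow> \<not> coal \<omega> k"
  obtains t s where "exec sampler (init_state input \<omega>) t s" "t \<le> setup_cost + (\<Sum>k\<le>J. 112 * 2 ^ k * scan_cost + 16)"
    "result s = fst (round_pair (sdrop (length isos) \<omega>) (heads isos \<omega>) J)"
proof -
  let ?B = "round_pair (sdrop (length isos) \<omega>) (heads isos \<omega>)"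
  obtain t s where e: "exec sampler (init_state input \<omega>) t s" "t \<le> setup_cost + (\<Sum>k\<le>J. 112 * 2 ^ k * scan_cost + 16)"
    and s: "\<forall>v<n. fst (snd s) v = of_bool (v \<in> fst (?B J))"
    using wp_sampler[of \<omega> J] assms unfolding coal_iff wp_def by (auto split: prod.splits)
  have "result s = fst (?B J)" using s round_pair_subset[of \<omega> J] by (auto simp: result_def)
  with e that show ?thesis by blast
qed

section \<open>Output distribution\<close>

lemma coal_event: "{\<omega>. \<not> coal \<omega> k} \<in> sets coin_space"
  unfolding coal_def by (rule coalesced_event)

lemma coal_trivial: "ords = [] \<Longrightarrow> coal \<omega> k"
  by (simp add: coal_iff round_pair_def)

text \<open>Round \<open>Suc k\<close> performs \<open>2 * 2 ^ k\<close> scans, which is the horizon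
  of \<open>coalescence_decay\<close> for \<open>m = 2 ^ k - 1\<close>.\<close>

lemma coal_decay:
  assumes "lll_witness hg \<epsilon> x"
  shows "coin.prob {\<omega>. \<not> coal \<omega> (Suc k)} \<le> (1 - \<epsilon>) ^ (2 ^ k) * (\<Sum>C\<in>Es. x C / (1 - x C))"
proof (cases "ords = []")
  case True
  have "0 \<le> (\<Sum>C\<in>Es. x C / (1 - x C))" "0 \<le> 1 - \<epsilon>"
    using assms by (auto simp: lll_witness_def less_imp_le intro!: sum_nonneg)
  then show ?thesis using coal_trivial[OF True] by simp
next
  case False
  have "0 < n"
  proof (rule ccontr)
    assume "\<not> 0 < n"
    then have "ords = []" unfolding ords_def by simp
    then show False using False by simp
  qed
  then interpret schedule hg sched "length isos" "length ords" by (rule sched_schedule)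
  have "Suc (2 ^ k - 1) = 2 ^ k" by simp
  then show ?thesis using coalescence_decay[OF assms, of "2 ^ k - 1"] by (simp add: coal_def)
qed

text \<open>Almost every stream coalesces in some round, and there the program returns the coupled
  output, because the collapsed value does not depend on the horizon. Without vertices there is no
  schedule, and this case is settled directly.\<close>

lemma sampler_output:
  assumes w: "lll_witness hg \<epsilon> x"
  shows "coin.prob {\<omega>. \<exists>t s. exec sampler (init_state input \<omega>) t s \<and> result s = Y} =
    pmf (pmf_of_set {I. independent_set hg I}) Y" (is "coin.prob ?H = _")
proof (cases "n = 0")
  case True
  have ords: "ords = []" unfolding ords_def using True by simp
  have "\<exists>t s. exec sampler (init_state input \<omega>) t s" for \<omega>
    by (rule sampler_halts[of \<omega> 0, OF coal_trivial[OF ords]]) auto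
  moreover have "result s = {}" for s unfolding result_def using True by simp
  ultimately have H: "?H = (if Y = {} then UNIV else {})" by auto
  have "es = []"
  proof (rule ccontr)
    assume "es \<noteq> []"
    then obtain e where "e \<in> set es" by (cases es) auto
    then show False using wf[of e] nonempty[of e] True by simp
  qed
  then have "hg = ({}, {})" unfolding hg_def Es_def using True by simp
  then have "{I. independent_set hg I} = {{}}" by (auto simp: independent_set_def)
  then show ?thesis unfolding H using coin.prob_space by (simp add: indicator_def)
next
  case False
  then interpret schedule hg sched "length isos" "length ords" by (intro sched_schedule) simp
  let ?S = "\<Sum>C\<in>Es. x C / (1 - x C)"
  have q: "0 < 1 - \<epsilon>" "1 - \<epsilon> < 1" using w by (auto simp: lll_witness_def)
  have S: "0 \<le> ?S" using w by (auto simp: lll_witness_def less_imp_le intro!: sum_nonneg)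
  have small: "\<exists>k. coin.prob {\<omega>. \<not> coal \<omega> k} < e" if "e > 0" for e
  proof -
    \<comment> \<open>Adding 1 to the sum avoids a division by zero when there are no edges.\<close>
    obtain k where k: "(1 - \<epsilon>) ^ k < e / (?S + 1)"
      using real_arch_pow_inv[of "e / (?S + 1)" "1 - \<epsilon>"] q S \<open>e > 0\<close> by auto
    have "k \<le> 2 ^ k" by (simp add: less_imp_le)
    then have "(1 - \<epsilon>) ^ (2 ^ k) \<le> (1 - \<epsilon>) ^ k" using q by (intro power_decreasing) auto
    then have "(1 - \<epsilon>) ^ (2 ^ k) * ?S \<le> (1 - \<epsilon>) ^ k * (?S + 1)" using S q by (intro mult_mono) auto
    also have "\<dots> < e" using k S by (simp add: pos_less_divide_eq)
    finally show ?thesis using coal_decay[OF w, of k] by (meson le_less_trans)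
  qed
  have dist: "coin.prob (coupled_output hg sched Y) = pmf (pmf_of_set {I. independent_set hg I}) Y"
    by (rule coupling_from_the_past[OF hyper sched_verts]) (use small in \<open>auto simp: coal_def\<close>)
  let ?N = "{\<omega>. \<forall>k. \<not> coal \<omega> k}"
  have Nset: "?N \<in> sets coin_space"
  proof -
    have "?N = (\<Inter>k. {\<omega>. \<not> coal \<omega> k})" by auto
    then show ?thesis using coal_event by (simp add: sets.countable_INT'')
  qed
  have "coin.prob ?N \<le> e" if "e > 0" for e
  proof -
    obtain k where "coin.prob {\<omega>. \<not> coal \<omega> k} < e" using small[OF \<open>e > 0\<close>] by blast
    moreover have "coin.prob ?N \<le> coin.prob {\<omega>. \<not> coal \<omega> k}"
      by (rule coin.finite_measure_mono) (auto simp: coal_event)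
    ultimately show ?thesis by simp
  qed
  then have "coin.prob ?N \<le> 0" using field_le_epsilon[of "coin.prob ?N" 0] by simp
  then have N0: "emeasure coin_space ?N = 0" by (simp add: coin.emeasure_eq_measure measure_le_0_iff)
  \<comment> \<open>The exceptional set consists of the streams that never coalesce;
    \<open>J\<close> is the first successful round on all others.\<close>
  have "AE \<omega> in coin_space. \<omega> \<in> ?H \<longleftrightarrow> \<omega> \<in> coupled_output hg sched Y"
  proof (rule AE_I[OF _ N0 Nset], rule subsetI, rule ccontr)
    fix \<omega> assume A: "\<omega> \<in> {\<omega> \<in> space coin_space. \<not> (\<omega> \<in> ?H \<longleftrightarrow> \<omega> \<in> coupled_output hg sched Y)}" and "\<omega> \<notin> ?N"
    then obtain k0 where "coal \<omega> k0" by auto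
    define J where "J = (LEAST k. coal \<omega> k)"
    have J: "coal \<omega> J" "\<And>k. k < J \<Longrightarrow> \<not> coal \<omega> k"
      unfolding J_def by (rule LeastI[of "coal \<omega>", OF \<open>coal \<omega> k0\<close>], rule not_less_Least)
    let ?K = "length isos + 2 ^ J * length ords"
    let ?Z = "fst (bsim Es sched (snth \<omega>) 0 ?K ({}, {..<n}))"
    obtain t s where ex: "exec sampler (init_state input \<omega>) t s" and res: "result s = ?Z"
      by (rule sampler_halts[OF J]) (auto simp: bsim_round_pair)
    have "\<omega> \<in> ?H \<longleftrightarrow> ?Z = Y"
    proof
      assume "\<omega> \<in> ?H"
      then obtain t' s' where "exec sampler (init_state input \<omega>) t' s'" "result s' = Y" by blast
      then show "?Z = Y" using exec_deterministic[OF ex] res by metis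
    qed (use ex res in blast)
    moreover have cJ: "coalesced hg sched (snth \<omega>) ?K" using J(1) by (simp add: coal_def)
    have "\<omega> \<in> coupled_output hg sched Y \<longleftrightarrow> ?Z = Y"
    proof
      assume "\<omega> \<in> coupled_output hg sched Y"
      then obtain l where l: "coalesced hg sched (snth \<omega>) l" "fst (bsim Es sched (snth \<omega>) 0 l ({}, {..<n})) = Y"
        by (auto simp: coupled_output_def)
      have "bsim Es sched (snth \<omega>) 0 ?K ({}, {..<n}) = bsim Es sched (snth \<omega>) 0 l ({}, {..<n})"
      proof (cases "?K \<le> l")
        case True
        then show ?thesis using coalesced_bsim[OF cJ True sched_verts] by simp
      next
        case False
        then have "l \<le> ?K" by simp
        then show ?thesis using coalesced_bsim[OF l(1) \<open>l \<le> ?K\<close> sched_verts] by simp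
      qed
      then show "?Z = Y" using l(2) by simp
    next
      assume "?Z = Y"
      then show "\<omega> \<in> coupled_output hg sched Y" using cJ by (auto simp: coupled_output_def)
    qed
    ultimately show False using A by simp
  qed
  then have "coin.prob ?H = coin.prob (coupled_output hg sched Y)"
  proof (rule measure_eq_AE)
    show "?H \<in> sets coin_space"
      unfolding result_def by (rule halting_event[where Q = "\<lambda>\<mu>. {v. v < n \<and> \<mu> v \<noteq> 0} = Y"])
    show "coupled_output hg sched Y \<in> sets coin_space" by (rule coupled_output_event)
  qed
  then show ?thesis using dist by simp
qed

section \<open>Expected running time\<close>

text \<open>If round \<open>J\<close> is the first success, the sum of \<open>2 ^ k\<close> over
  \<open>k \<le> J\<close> is one plus twice that over the failed rounds, hence at most
  \<open>1 + 2 * waste \<omega>\<close>. Written as a series of indicators, its expectation is a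
  series of failure probabilities.\<close>

definition waste :: "bool stream \<Rightarrow> ennreal" where
  "waste \<omega> = (\<Sum>k. ennreal (2 ^ k) * indicator {\<omega>. \<not> coal \<omega> k} \<omega>)"

lemma sum_powers: "(\<Sum>k\<le>J. (2::nat) ^ k) = 1 + 2 * (\<Sum>k<J. 2 ^ k)"
  by (induction J) auto

lemma run_time_le:
  "run_time sampler input \<omega> \<le> of_nat setup_cost + of_nat (112 * scan_cost + 16) * (1 + 2 * waste \<omega>)"
proof (cases "\<exists>k. coal \<omega> k")
  case True
  then obtain k0 where "coal \<omega> k0" by auto
  define J where "J = (LEAST k. coal \<omega> k)"
  have J: "coal \<omega> J" "\<And>k. k < J \<Longrightarrow> \<not> coal \<omega> k"
    unfolding J_def by (rule LeastI[of "coal \<omega>", OF \<open>coal \<omega> k0\<close>], rule not_less_Least)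
  obtain t s where ex: "exec sampler (init_state input \<omega>) t s"
    and t: "t \<le> setup_cost + (\<Sum>k\<le>J. 112 * 2 ^ k * scan_cost + 16)"
    by (rule sampler_halts[OF J]) auto
  have "run_time sampler input \<omega> \<le> of_nat t"
    unfolding run_time_def by (rule INF_lower) (use ex in blast)
  also have "t \<le> setup_cost + (112 * scan_cost + 16) * (\<Sum>k\<le>J. 2 ^ k)"
  proof -
    have "(\<Sum>k\<le>J. 112 * 2 ^ k * scan_cost + 16) \<le> (\<Sum>k\<le>J. (112 * scan_cost + 16) * 2 ^ k)"
      by (intro sum_mono) (simp add: algebra_simps)
    then show ?thesis using t by (simp only: sum_distrib_left)
  qed
  also have "of_nat (setup_cost + (112 * scan_cost + 16) * (\<Sum>k\<le>J. 2 ^ k)) =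
      (of_nat setup_cost + of_nat (112 * scan_cost + 16) * (1 + 2 * of_nat (\<Sum>k<J. 2 ^ k)) :: ennreal)"
    unfolding sum_powers by (simp only: of_nat_add of_nat_mult of_nat_1 of_nat_numeral)
  also have "of_nat (\<Sum>k<J. 2 ^ k) \<le> waste \<omega>"
  proof -
    have "(of_nat (\<Sum>k<J. 2 ^ k) :: ennreal) = (\<Sum>k<J. ennreal (2 ^ k) * indicator {\<omega>. \<not> coal \<omega> k} \<omega>)"
      using J(2) by (auto simp: indicator_def ennreal_power[symmetric] intro!: sum.cong)
    also have "\<dots> \<le> waste \<omega>" unfolding waste_def by (rule sum_le_suminf) auto
    finally show ?thesis .
  qed
  finally show ?thesis by (simp add: add_left_mono mult_left_mono)
next
  case False
  \<comment> \<open>A run that never coalesces has infinite waste, which makes the bound trivial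
    there.\<close>
  have "(SUP m. of_nat m) \<le> waste \<omega>"
  proof (rule SUP_least)
    fix m
    have "(of_nat m :: ennreal) = (\<Sum>k<m. 1)" by simp
    also have "\<dots> \<le> (\<Sum>k<m. ennreal (2 ^ k) * indicator {\<omega>. \<not> coal \<omega> k} \<omega>)"
    proof (rule sum_mono)
      fix k
      have "ennreal 1 \<le> ennreal (2 ^ k)" by (rule ennreal_leI) simp
      then show "1 \<le> ennreal (2 ^ k) * indicator {\<omega>. \<not> coal \<omega> k} \<omega>" using False by simp
    qed
    also have "\<dots> \<le> waste \<omega>" unfolding waste_def by (rule sum_le_suminf) auto
    finally show "of_nat m \<le> waste \<omega>" .
  qed
  then have "waste \<omega> = \<top>" by (simp add: ennreal_SUP_of_nat_eq_top top_unique)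
  then show ?thesis by (simp add: ennreal_mult_top ennreal_top_mult)
qed

lemma expected_time_le:
  fixes X :: real
  assumes X: "\<And>m. (\<Sum>k<m. 2 ^ k * coin.prob {\<omega>. \<not> coal \<omega> k}) \<le> X"
  shows "expected_time sampler input \<le> ennreal (setup_cost + (112 * scan_cost + 16) * (1 + 2 * X))"
proof -
  have X0: "0 \<le> X" using X[of 0] by simp
  have meas: "(\<lambda>\<omega>. ennreal (2 ^ k) * indicator {\<omega>. \<not> coal \<omega> k} \<omega>) \<in> borel_measurable coin_space" for k
    using coal_event by simp
  have "(\<integral>\<^sup>+\<omega>. waste \<omega> \<partial>coin_space) = (\<Sum>k. \<integral>\<^sup>+\<omega>. ennreal (2 ^ k) * indicator {\<omega>. \<not> coal \<omega> k} \<omega> \<partial>coin_space)"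
    unfolding waste_def by (rule nn_integral_suminf) (rule meas)
  also have "\<dots> = (\<Sum>k. ennreal (2 ^ k * coin.prob {\<omega>. \<not> coal \<omega> k}))"
    using coal_event by (simp add: nn_integral_cmult_indicator coin.emeasure_eq_measure ennreal_mult)
  also have "\<dots> \<le> ennreal X"
  proof (rule suminf_le_const)
    show "(\<Sum>k<m. ennreal (2 ^ k * coin.prob {\<omega>. \<not> coal \<omega> k})) \<le> ennreal X" for m
      using X[of m] by (subst sum_ennreal) (auto intro: ennreal_leI)
  qed simp
  finally have W: "(\<integral>\<^sup>+\<omega>. waste \<omega> \<partial>coin_space) \<le> ennreal X" .
  have mW: "waste \<in> borel_measurable coin_space"
    unfolding waste_def by (rule borel_measurable_suminf_order) (rule meas)
  have "expected_time sampler input \<le>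
      (\<integral>\<^sup>+\<omega>. of_nat setup_cost + of_nat (112 * scan_cost + 16) * (1 + 2 * waste \<omega>) \<partial>coin_space)"
    unfolding expected_time_def by (intro nn_integral_mono run_time_le)
  also have "\<dots> = of_nat setup_cost + of_nat (112 * scan_cost + 16) * (1 + 2 * (\<integral>\<^sup>+\<omega>. waste \<omega> \<partial>coin_space))"
    using mW coin.emeasure_space_1 by (simp add: nn_integral_add nn_integral_cmult)
  also have "\<dots> \<le> of_nat setup_cost + of_nat (112 * scan_cost + 16) * (1 + 2 * ennreal X)"
    using W by (intro add_left_mono mult_left_mono) auto
  also have "\<dots> = ennreal (setup_cost + (112 * scan_cost + 16) * (1 + 2 * X))"
  proof -
    let ?a = "real setup_cost" and ?b = "real (112 * scan_cost + 16)"
    have "ennreal (?a + ?b * (1 + 2 * X)) = ennreal ?a + ennreal (?b * (1 + 2 * X))"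
      using X0 by (intro ennreal_plus) auto
    also have "ennreal (?b * (1 + 2 * X)) = ennreal ?b * ennreal (1 + 2 * X)"
      using X0 by (intro ennreal_mult) auto
    also have "ennreal (1 + 2 * X) = ennreal 1 + ennreal 2 * ennreal X"
      using X0 by (subst ennreal_plus) (auto simp: ennreal_mult)
    finally show ?thesis by (simp add: ennreal_of_nat_eq_real_of_nat)
  qed
  finally show ?thesis .
qed

end

text \<open>The two terms cross at \<open>2 ^ k = B\<close>. Up to there the powers sum to at most
  \<open>2 * B\<close>, and from there on the quotients form a geometric series with sum at most
  \<open>2 * B\<close>.\<close>

lemma dyadic_sum:
  fixes B :: real
  assumes B: "0 < B"
  shows "(\<Sum>k<m. min (2 ^ k) (B\<^sup>2 / 2 ^ k)) \<le> 4 * B"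
proof -
  obtain K0 :: nat where "B < 2 ^ K0" using real_arch_pow[of 2 B] by auto
  then have ex: "B \<le> 2 ^ K0" by simp
  define K where "K = (LEAST k. B \<le> 2 ^ k)"
  have K: "B \<le> 2 ^ K" unfolding K_def by (rule LeastI[of "\<lambda>k. B \<le> 2 ^ k", OF ex])
  have K2: "(2 :: real) ^ K - 1 \<le> 2 * B"
  proof (cases K)
    case 0
    then show ?thesis using B by simp
  next
    case (Suc k)
    then have "\<not> B \<le> 2 ^ k" using not_less_Least[of k "\<lambda>k. B \<le> 2 ^ k"] unfolding K_def by simp
    then show ?thesis using Suc by simp
  qed
  have tail: "(\<Sum>j<m. (1 / 2 :: real) ^ j) \<le> 2"
    using geometric_sum[of "1 / 2 :: real" m] by simp
  have "(\<Sum>k<m. min (2 ^ k) (B\<^sup>2 / 2 ^ k)) \<le> (\<Sum>k<K + m. min (2 ^ k) (B\<^sup>2 / 2 ^ k))"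
    by (rule sum_mono2) auto
  also have "\<dots> = (\<Sum>k<K. min (2 ^ k) (B\<^sup>2 / 2 ^ k)) + (\<Sum>j<m. min (2 ^ (K + j)) (B\<^sup>2 / 2 ^ (K + j)))"
    using sum.atLeastLessThan_concat[of 0 K "K + m" "\<lambda>k. min (2 ^ k) (B\<^sup>2 / 2 ^ k)"]
      sum.shift_bounds_nat_ivl[of "\<lambda>k. min (2 ^ k) (B\<^sup>2 / 2 ^ k)" 0 K m]
    by (simp add: atLeast0LessThan add.commute)
  also have "\<dots> \<le> (\<Sum>k<K. 2 ^ k) + (\<Sum>j<m. B\<^sup>2 / 2 ^ K * (1 / 2) ^ j)"
    by (intro add_mono sum_mono) (simp_all add: min.coboundedI2 power_add power_divide)
  also have "(\<Sum>k<K. (2 :: real) ^ k) = 2 ^ K - 1"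
    using geometric_sum[of "2 :: real" K] by simp
  also have "(\<Sum>j<m. B\<^sup>2 / 2 ^ K * (1 / 2) ^ j) \<le> B\<^sup>2 / 2 ^ K * 2"
    unfolding sum_distrib_left[symmetric] using tail by (intro mult_left_mono) auto
  also have "B\<^sup>2 / 2 ^ K \<le> B"
    using K B by (simp add: pos_divide_le_eq power2_eq_square)
  finally show ?thesis using K2 by simp
qed

text \<open>The square of \<open>y \<le> exp (y / 2)\<close>, which follows from the quadratic
  Taylor polynomial.\<close>

lemma exp_neg_le:
  fixes y :: real assumes "0 < y" shows "exp (- y) \<le> 1 / y\<^sup>2"
proof -
  have "(1 + y / 2 + y\<^sup>2 / 8)\<^sup>2 \<le> exp (y / 2) ^ 2"
    using assms exp_lower_Taylor_quadratic[of "y / 2"] by (intro power_mono) (auto simp: power_divide)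
  also have "exp (y / 2) ^ 2 = exp y" by (simp add: exp_double[symmetric])
  finally have "(1 + y / 2 + y\<^sup>2 / 8)\<^sup>2 \<le> exp y" .
  moreover have "y \<le> 1 + y / 2 + y\<^sup>2 / 8"
    using zero_le_power2[of "y / 2 - 1"] zero_le_power2[of y] by (simp add: power2_eq_square algebra_simps)
  then have "y\<^sup>2 \<le> (1 + y / 2 + y\<^sup>2 / 8)\<^sup>2" using assms by (intro power_mono) auto
  ultimately have "y\<^sup>2 \<le> exp y" by linarith
  then show ?thesis using assms by (simp add: exp_minus field_simps)
qed

text \<open>The 4 in \<open>B\<close> splits the exponent \<open>2 ^ k * (- ln q)\<close> into two
  equal halves: one absorbs \<open>ln S\<close> as soon as \<open>2 ^ Suc k\<close> reaches
  \<open>B\<close>, the other still is at least \<open>2 ^ Suc k / B\<close>. The maximum with 1 is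
  what makes the second half large enough.\<close>

lemma decay_quadratic:
  fixes q S :: real
  assumes q: "0 < q" "q < 1" and S: "0 \<le> S"
  defines "B \<equiv> 4 * max 1 (ln S) / - ln q"
  assumes k: "B \<le> 2 ^ Suc k"
  shows "q ^ (2 ^ k) * S \<le> B\<^sup>2 / (2 ^ Suc k)\<^sup>2"
proof -
  let ?l = "- ln q" and ?s = "max 1 (ln S)"
  have l: "0 < ?l" using q by simp
  have B: "0 < B" unfolding B_def by (intro divide_pos_pos) (use l in auto)
  have "S \<le> exp ?s"
  proof (cases "S = 0")
    case False
    then have "S = exp (ln S)" using S by simp
    also have "\<dots> \<le> exp ?s" by simp
    finally show ?thesis .
  qed simp
  then have "q ^ (2 ^ k) * S \<le> q ^ (2 ^ k) * exp ?s" using q by (intro mult_left_mono) auto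
  also have "q ^ (2 ^ k) * exp ?s = exp (?s - 2 ^ k * ?l)"
  proof -
    have "q ^ (2 ^ k) = exp (2 ^ k * ln q)" using q exp_of_nat_mult[of "2 ^ k" "ln q"] by simp
    then show ?thesis by (simp add: exp_add[symmetric] add.commute)
  qed
  also have "\<dots> \<le> exp (- (2 ^ Suc k / B))"
  proof -
    have lB: "?l = 4 * ?s / B" using l by (simp add: B_def)
    have "B * ?s \<le> 2 ^ Suc k * ?s" using k by (intro mult_right_mono) auto
    then have s: "?s \<le> 2 ^ Suc k * ?s / B" by (simp only: pos_le_divide_eq[OF B] mult.commute)
    have "2 ^ k * ?l = 2 * (2 ^ Suc k * ?s / B)" unfolding lB by simp
    moreover have "b = 2 * c \<Longrightarrow> a \<le> c \<Longrightarrow> a - b \<le> - c" for a b c :: real by simp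
    ultimately have "?s - 2 ^ k * ?l \<le> - (2 ^ Suc k * ?s / B)" using s by blast
    also have "\<dots> \<le> - (2 ^ Suc k / B)"
    proof -
      have "(2 :: real) ^ Suc k * 1 \<le> 2 ^ Suc k * ?s" by (intro mult_left_mono) auto
      then have "2 ^ Suc k / B \<le> 2 ^ Suc k * ?s / B" using B by (intro divide_right_mono) auto
      then show ?thesis by simp
    qed
    finally show ?thesis by simp
  qed
  also have "\<dots> \<le> 1 / (2 ^ Suc k / B)\<^sup>2" using B by (intro exp_neg_le) simp
  also have "\<dots> = B\<^sup>2 / (2 ^ Suc k)\<^sup>2" by (simp add: power_divide)
  finally show ?thesis .
qed

context hypergraph_input
begin

text \<open>Round 0 contributes at most 1. Each later round is bounded trivially by
  \<open>2 ^ k\<close> and, beyond the threshold \<open>B\<close>, by quadratic decay, so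
  \<open>dyadic_sum\<close> applies.\<close>

lemma waste_bound:
  assumes w: "lll_witness hg \<epsilon> x"
  defines "B \<equiv> 4 * max 1 (ln (\<Sum>C\<in>Es. x C / (1 - x C))) / - ln (1 - \<epsilon>)"
  shows "(\<Sum>k<m. 2 ^ k * coin.prob {\<omega>. \<not> coal \<omega> k}) \<le> 1 + 4 * B"
proof -
  let ?S = "\<Sum>C\<in>Es. x C / (1 - x C)" and ?P = "\<lambda>k. coin.prob {\<omega>. \<not> coal \<omega> k}"
  have q: "0 < 1 - \<epsilon>" "1 - \<epsilon> < 1" using w by (auto simp: lll_witness_def)
  have S: "0 \<le> ?S" using w by (auto simp: lll_witness_def less_imp_le intro!: sum_nonneg)
  have "0 < - ln (1 - \<epsilon>)" using q by simp
  then have B: "0 < B" unfolding B_def by (intro divide_pos_pos) auto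
  have tm: "2 ^ Suc k * ?P (Suc k) \<le> min (2 ^ Suc k) (B\<^sup>2 / 2 ^ Suc k)" for k
  proof (cases "B \<le> 2 ^ Suc k")
    case True
    have "?P (Suc k) \<le> B\<^sup>2 / (2 ^ Suc k)\<^sup>2"
      using coal_decay[OF w, of k] decay_quadratic[OF q S, of k] True unfolding B_def by linarith
    then have "2 ^ Suc k * ?P (Suc k) \<le> 2 ^ Suc k * (B\<^sup>2 / (2 ^ Suc k)\<^sup>2)" by (intro mult_left_mono) auto
    also have "\<dots> = B\<^sup>2 / 2 ^ Suc k" by (simp add: power2_eq_square)
    finally have "2 ^ Suc k * ?P (Suc k) \<le> B\<^sup>2 / 2 ^ Suc k" .
    moreover have "2 ^ Suc k * ?P (Suc k) \<le> 2 ^ Suc k * 1" by (intro mult_left_mono coin.prob_le_1) auto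
    ultimately show ?thesis by simp
  next
    case False
    then have "(2 ^ Suc k)\<^sup>2 \<le> B\<^sup>2" by (intro power_mono) auto
    then have "2 ^ Suc k \<le> B\<^sup>2 / 2 ^ Suc k" by (simp add: pos_le_divide_eq power2_eq_square)
    moreover have "2 ^ Suc k * ?P (Suc k) \<le> 2 ^ Suc k * 1" by (intro mult_left_mono coin.prob_le_1) auto
    ultimately show ?thesis by simp
  qed
  have "(\<Sum>k<m. 2 ^ k * ?P k) \<le> (\<Sum>k<Suc m. 2 ^ k * ?P k)" by simp
  also have "\<dots> = ?P 0 + (\<Sum>k<m. 2 ^ Suc k * ?P (Suc k))" by (subst sum.lessThan_Suc_shift) simp
  also have "\<dots> \<le> 1 + (\<Sum>k<m. min (2 ^ Suc k) (B\<^sup>2 / 2 ^ Suc k))"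
    using tm by (intro add_mono sum_mono coin.prob_le_1)
  also have "(\<Sum>k<m. min (2 ^ Suc k) (B\<^sup>2 / 2 ^ Suc k)) \<le> (\<Sum>k<Suc m. min (2 ^ k) (B\<^sup>2 / 2 ^ k))"
  proof -
    have "0 \<le> min ((2 :: real) ^ 0) (B\<^sup>2 / 2 ^ 0)" by simp
    then show ?thesis using sum.lessThan_Suc_shift[of "\<lambda>k. min (2 ^ k) (B\<^sup>2 / 2 ^ k)" m] by linarith
  qed
  also have "\<dots> \<le> 4 * B" by (rule dyadic_sum[OF B])
  finally show ?thesis by simp
qed

section \<open>Costs in terms of the total size of the edges\<close>

definition edge_volume :: nat where "edge_volume = (\<Sum>k<length es. length (es ! k))"

lemma edge_volume_eq: "real edge_volume = (\<Sum>C\<in>Es. real (card C))"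
proof -
  have "inj_on edge {..<length es}"
    using distinct_edges by (auto simp: inj_on_def edge_def distinct_conv_nth)
  then have "(\<Sum>C\<in>Es. real (card C)) = (\<Sum>k<length es. real (card (edge k)))"
    unfolding Es_eq by (simp add: sum.reindex)
  also have "\<dots> = real edge_volume"
    unfolding edge_volume_def of_nat_sum using wf by (intro sum.cong) (auto simp: edge_def distinct_card)
  finally show ?thesis by simp
qed

text \<open>Double counting of the incidences between vertices and edges.\<close>

lemma sum_inc_le: "(\<Sum>j<length ords. length (inc (ords ! j))) \<le> edge_volume"
proof -
  have "(\<Sum>j<length ords. length (inc (ords ! j))) = (\<Sum>v\<in>set ords. length (inc v))"
    by (subst sum_list_distinct_conv_sum_set[symmetric]) (auto simp: ords_def sum_list_sum_nth atLeast0LessThan)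
  also have "\<dots> \<le> (\<Sum>v<n. length (inc v))" by (intro sum_mono2) (auto simp: ords_def)
  also have "\<dots> = (\<Sum>v<n. \<Sum>k<length es. of_bool (v \<in> edge k))"
  proof (intro sum.cong refl)
    fix v
    have "length (inc v) = card (set (inc v))" using inc_props(1)[of v] by (simp add: distinct_card)
    also have "set (inc v) = {k\<in>{..<length es}. v \<in> edge k}" using inc_props(2)[of _ v] by auto
    finally show "length (inc v) = (\<Sum>k<length es. of_bool (v \<in> edge k))"
      by (simp add: of_bool_def sum.If_cases Int_def)
  qed
  also have "\<dots> = (\<Sum>k<length es. \<Sum>v<n. of_bool (v \<in> edge k))" by (rule sum.swap)
  also have "\<dots> = edge_volume"
    unfolding edge_volume_def
  proof (intro sum.cong refl)
    fix k assume "k \<in> {..<length es}"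
    then have e: "distinct (es ! k)" "set (es ! k) \<subseteq> {..<n}" using wf[of "es ! k"] by auto
    then have "{v\<in>{..<n}. v \<in> edge k} = set (es ! k)" by (auto simp: edge_def)
    then show "(\<Sum>v<n. of_bool (v \<in> edge k)) = length (es ! k)"
      using e(1) by (simp add: of_bool_def sum.If_cases Int_def distinct_card)
  qed
  finally show ?thesis .
qed

lemma length_ords_le_total: "length ords \<le> edge_volume"
proof -
  have "length ords = (\<Sum>j<length ords. 1)" by simp
  also have "\<dots> \<le> (\<Sum>j<length ords. length (inc (ords ! j)))"
  proof (rule sum_mono)
    fix j assume "j \<in> {..<length ords}"
    then have "ords ! j \<in> set ords" by simp
    then have "inc (ords ! j) \<noteq> []" by (simp add: ords_def)
    then show "1 \<le> length (inc (ords ! j))" by (cases "inc (ords ! j)") auto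
  qed
  finally show ?thesis using sum_inc_le by linarith
qed

lemma length_es_le_total: "length es \<le> edge_volume"
proof -
  have "length es = (\<Sum>k<length es. 1)" by simp
  also have "\<dots> \<le> edge_volume"
    unfolding edge_volume_def
  proof (rule sum_mono)
    fix k assume "k \<in> {..<length es}"
    then have "es ! k \<noteq> []" using nonempty[of "es ! k"] by simp
    then show "1 \<le> length (es ! k)" by (cases "es ! k") auto
  qed
  finally show ?thesis .
qed

lemma scan_cost_le: "scan_cost \<le> 2 * edge_volume"
proof -
  have "scan_cost = (\<Sum>j<length ords. length (inc (ords ! j))) + length ords"
    unfolding scan_cost_def by (subst sum.distrib) simp
  then show ?thesis using sum_inc_le length_ords_le_total by linarith
qed

lemma n_eq: "n = length isos + length ords"
  using sum_length_filter_compl[of "\<lambda>v. inc v = []" "[0..<n]"] by (simp add: isos_def ords_def)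

lemma setup_cost_le: "setup_cost \<le> 50 * edge_volume + 20 * length isos + 34"
proof -
  have "(\<Sum>k<length es. 12 * length (es ! k) + 12) = 12 * edge_volume + 12 * length es"
    by (simp add: edge_volume_def sum.distrib sum_distrib_left)
  then show ?thesis unfolding setup_cost_def using n_eq length_ords_le_total length_es_le_total by linarith
qed

lemma card_isolated: "card (isolated_verts hg) = length isos"
proof -
  have "isolated_verts hg = set isos" by (simp add: isolated_verts_def set_isos)
  moreover have "distinct isos" by (simp add: isos_def)
  ultimately show ?thesis using distinct_card[of isos] by simp
qed

text \<open>The local lemma condition forces \<open>2 ^ (- |C|) \<le> 1 - \<epsilon>\<close>, since
  its left side is at least \<open>2 ^ (- |C|)\<close> and all other factors on its right side are
  at most 1; it remains to take logarithms.\<close>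

lemma log_le_card:
  assumes w: "lll_witness hg \<epsilon> x" and C: "C \<in> Es"
  shows "- ln (1 - \<epsilon>) \<le> card C"
proof -
  have x: "0 < x C" "x C < 1" "0 < \<epsilon>" "\<epsilon> < 1" using w C by (auto simp: lll_witness_def)
  have P: "(\<Prod>C'\<in>nbhd2 hg C. 1 - x C') \<le> 1"
    using w by (intro prod_le_1) (auto simp: lll_witness_def nbhd2_def closed_nbhd2_def less_imp_le)
  have "card C > 0"
    using hypergraph_hg C finite_subset[of C "{..<n}"] by (auto simp: hypergraph_def card_gt_0_iff)
  then have "1 * (1 / 2) ^ card C \<le> 2 * real (card C) * (1 / 2) ^ card C"
    by (intro mult_right_mono) auto
  also have "\<dots> \<le> (1 - \<epsilon>) * x C * (\<Prod>C'\<in>nbhd2 hg C. 1 - x C')" using w C by (auto simp: lll_witness_def)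
  also have "\<dots> \<le> (1 - \<epsilon>) * 1 * 1" using x P w
    by (intro mult_mono prod_nonneg) (auto simp: lll_witness_def nbhd2_def closed_nbhd2_def less_imp_le)
  finally have "(1 / 2) ^ card C \<le> 1 - \<epsilon>" by simp
  then have "ln ((1 / 2) ^ card C) \<le> ln (1 - \<epsilon>)" using x by (subst ln_le_cancel_iff) auto
  then have "- ln (1 - \<epsilon>) \<le> card C * ln 2" by (simp add: ln_realpow ln_div)
  also have "\<dots> \<le> real (card C) * 1" using ln_2_less_1 by (intro mult_left_mono) auto
  finally show ?thesis by simp
qed

text \<open>Both the cost of one scan and that of the expected number of scans are charged to the
  time bound; the count of isolated vertices and the final 1 cover preprocessing and output. Without
  edges the time bound is 0 and the failure probability vanishes from round 1 on.\<close>

theorem sampler_time: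
  assumes w: "lll_witness hg \<epsilon> x"
  shows "expected_time sampler input \<le>
    ennreal (10000 * (time_bound hg \<epsilon> x + real (card (isolated_verts hg)) + 1))"
proof (cases "Es = {}")
  case True
  have zero: "coin.prob {\<omega>. \<not> coal \<omega> (Suc k)} = 0" for k
    using coal_decay[OF w, of k] True by (simp add: measure_le_0_iff)
  have "(\<Sum>k<m. 2 ^ k * coin.prob {\<omega>. \<not> coal \<omega> k}) \<le> 1" for m
  proof (cases m)
    case (Suc l)
    then show ?thesis by (simp add: sum.lessThan_Suc_shift zero del: sum.lessThan_Suc)
  qed simp
  from expected_time_le[OF this]
  have "expected_time sampler input \<le> ennreal (real setup_cost + real (112 * scan_cost + 16) * (1 + 2 * 1))" .
  also have "\<dots> \<le> ennreal (10000 * (time_bound hg \<epsilon> x + real (card (isolated_verts hg)) + 1))"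
  proof (rule ennreal_leI)
    have "edge_volume = 0" using edge_volume_eq True by simp
    then have "scan_cost = 0" "real setup_cost \<le> 20 * real (length isos) + 34"
      using scan_cost_le setup_cost_le by auto
    moreover have "time_bound hg \<epsilon> x = 0" by (simp add: time_bound_def True)
    ultimately show "real setup_cost + real (112 * scan_cost + 16) * (1 + 2 * 1) \<le>
        10000 * (time_bound hg \<epsilon> x + real (card (isolated_verts hg)) + 1)"
      by (simp add: card_isolated)
  qed
  finally show ?thesis .
next
  case False
  let ?l = "- ln (1 - \<epsilon>)" and ?s = "max 1 (ln (\<Sum>C\<in>Es. x C / (1 - x C)))"
  let ?B = "4 * ?s / ?l"
  let ?T = "time_bound hg \<epsilon> x"
  have l: "0 < ?l" using w by (simp add: lll_witness_def)
  have finE: "finite Es" by (simp add: Es_def)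
  define D where "D = (\<Sum>C\<in>Es. \<Sum>C'\<in>{C'\<in>Es. C \<inter> C' \<noteq> {}}. real (card C') * real (card C))"
  have T: "?T = ?s / ?l * D" by (simp add: time_bound_def D_def)
  \<comment> \<open>Every edge meets itself, so the double sum contains its diagonal.\<close>
  have sq: "(\<Sum>C\<in>Es. real (card C) * real (card C)) \<le> D"
    unfolding D_def
  proof (rule sum_mono)
    fix C assume C: "C \<in> Es"
    then have "C \<in> {C'\<in>Es. C \<inter> C' \<noteq> {}}" using hypergraph_hg by (auto simp: hypergraph_def)
    then show "real (card C) * real (card C) \<le> (\<Sum>C'\<in>{C'\<in>Es. C \<inter> C' \<noteq> {}}. real (card C') * real (card C))"
      using finE by (intro member_le_sum[of C _ "\<lambda>C'. real (card C') * real (card C)"]) auto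
  qed
  have card1: "1 \<le> real (card C)" if "C \<in> Es" for C
    using hypergraph_hg that finite_subset[of C "{..<n}"] by (auto simp: hypergraph_def Suc_le_eq card_gt_0_iff)
  have "real edge_volume \<le> D"
  proof -
    have "real edge_volume \<le> (\<Sum>C\<in>Es. real (card C) * real (card C))"
      unfolding edge_volume_eq
    proof (rule sum_mono)
      fix C assume "C \<in> Es"
      then show "real (card C) \<le> real (card C) * real (card C)"
        using card1[of C] mult_right_mono[of 1 "real (card C)" "real (card C)"] by simp
    qed
    then show ?thesis using sq by linarith
  qed
  then have "?s / ?l * real edge_volume \<le> ?T" unfolding T using l by (intro mult_left_mono divide_nonneg_pos) auto
  moreover have "t * (4 * a / b) = 4 * (a / b * t)" for t a b :: real by simp
  ultimately have WB: "real edge_volume * ?B \<le> 4 * ?T" by (simp only:)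
  \<comment> \<open>The factor \<open>1 / ?l\<close> may be small; \<open>log_le_card\<close> pays
    for it with one of the two factors \<open>card C\<close> on the diagonal.\<close>
  have "?l * real edge_volume \<le> (\<Sum>C\<in>Es. real (card C) * real (card C))"
    unfolding edge_volume_eq sum_distrib_left
    by (intro sum_mono mult_right_mono log_le_card[OF w]) auto
  also have "\<dots> \<le> ?s * D"
  proof -
    have "0 \<le> D" unfolding D_def by (intro sum_nonneg) auto
    then have "1 * D \<le> ?s * D" by (intro mult_right_mono) auto
    then show ?thesis using sq by linarith
  qed
  finally have "real edge_volume \<le> ?s * D / ?l" by (simp only: pos_le_divide_eq[OF l] mult.commute)
  then have WT: "real edge_volume \<le> ?T" unfolding T by (simp only: times_divide_eq_left)
  have "edge_volume > 0"
  proof -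
    obtain C where C: "C \<in> Es" using False by blast
    have "real (card C) \<le> real edge_volume" unfolding edge_volume_eq using finE C by (intro member_le_sum) auto
    then show ?thesis using card1[OF C] by linarith
  qed
  have "expected_time sampler input \<le> ennreal (setup_cost + (112 * scan_cost + 16) * (1 + 2 * (1 + 4 * ?B)))"
    by (rule expected_time_le) (rule waste_bound[OF w])
  also have "\<dots> \<le> ennreal (10000 * (?T + real (card (isolated_verts hg)) + 1))"
  proof (rule ennreal_leI)
    have B: "0 \<le> ?B" using l by (intro divide_nonneg_pos) auto
    \<comment> \<open>Here \<open>240 = 112 * 2 + 16\<close>, as the volume is at least 1.
      Multiplied by \<open>3 + 8 * ?B\<close> this gives \<open>720 + 4 * 1920 = 8400\<close> time
      bounds, and the 50 from the setup stay within 10000.\<close>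
    have "real (112 * scan_cost + 16) \<le> 240 * real edge_volume" using scan_cost_le \<open>edge_volume > 0\<close> by linarith
    then have "real (112 * scan_cost + 16) * (1 + 2 * (1 + 4 * ?B)) \<le> 240 * real edge_volume * (1 + 2 * (1 + 4 * ?B))"
      using B by (intro mult_right_mono) auto
    also have "\<dots> = 720 * real edge_volume + 1920 * (real edge_volume * ?B)" by (simp add: algebra_simps)
    also have "\<dots> \<le> 720 * ?T + 1920 * (4 * ?T)" using WB WT by linarith
    finally have "real (112 * scan_cost + 16) * (1 + 2 * (1 + 4 * ?B)) \<le> 8400 * ?T" by simp
    moreover have "real setup_cost \<le> 50 * ?T + 20 * real (length isos) + 34"
      using setup_cost_le WT by linarith
    ultimately show "real setup_cost + real (112 * scan_cost + 16) * (1 + 2 * (1 + 4 * ?B)) \<le>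
        10000 * (?T + real (card (isolated_verts hg)) + 1)"
      using WT unfolding card_isolated by (simp add: algebra_simps)
  qed
  finally show ?thesis .
qed

end

section \<open>Renaming vertices\<close>

text \<open>The machine works on indices, so all results concern \<open>hg\<close>; they are
  transported along the enumeration of the vertices, which is injective.\<close>

locale renaming =
  fixes \<Phi> :: "'a hypergraph" and f :: "'a \<Rightarrow> 'b"
  assumes inj: "inj_on f (verts \<Phi>)" and sub: "C \<in> edges \<Phi> \<Longrightarrow> C \<subseteq> verts \<Phi>"
begin

definition img :: "'b hypergraph" where "img = (f ` verts \<Phi>, (`) f ` edges \<Phi>)"

lemma inj_edges: "inj_on ((`) f) (edges \<Phi>)"
  using inj_on_image_eq_iff[OF inj] sub by (auto simp: inj_on_def)

lemma meets: "C \<in> edges \<Phi> \<Longrightarrow> D \<in> edges \<Phi> \<Longrightarrow> f ` C \<inter> f ` D \<noteq> {} \<longleftrightarrow> C \<inter> D \<noteq> {}"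
  using inj_on_image_Int[OF inj sub sub, of C D] by auto

lemma card_edge: "C \<in> edges \<Phi> \<Longrightarrow> card (f ` C) = card C"
  using card_image inj_on_subset[OF inj sub] by blast

lemma nbhd2_img:
  assumes C: "C \<in> edges \<Phi>" shows "nbhd2 img (f ` C) = (`) f ` nbhd2 \<Phi> C"
proof -
  have "f ` D \<in> closed_nbhd2 img (f ` C) \<longleftrightarrow> D \<in> closed_nbhd2 \<Phi> C" if D: "D \<in> edges \<Phi>" for D
    using D C meets by (auto simp: closed_nbhd2_def img_def)
  moreover have "closed_nbhd2 img (f ` C) \<subseteq> (`) f ` edges \<Phi>" "closed_nbhd2 \<Phi> C \<subseteq> edges \<Phi>"
    by (auto simp: closed_nbhd2_def img_def)
  ultimately have "closed_nbhd2 img (f ` C) = (`) f ` closed_nbhd2 \<Phi> C" by blast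
  moreover have "(`) f ` (closed_nbhd2 \<Phi> C - {C}) = (`) f ` closed_nbhd2 \<Phi> C - (`) f ` {C}"
    by (rule inj_on_image_set_diff[OF inj_edges]) (use C in \<open>auto simp: closed_nbhd2_def\<close>)
  ultimately show ?thesis by (simp add: nbhd2_def)
qed

lemma lll_witness_img:
  assumes "lll_witness img \<epsilon> x" shows "lll_witness \<Phi> \<epsilon> (\<lambda>C. x (f ` C))"
proof -
  have "(\<Prod>C'\<in>nbhd2 img (f ` C). 1 - x C') = (\<Prod>C'\<in>nbhd2 \<Phi> C. 1 - x (f ` C'))" if "C \<in> edges \<Phi>" for C
    unfolding nbhd2_img[OF that]
    by (subst prod.reindex) (auto simp: nbhd2_def closed_nbhd2_def intro: inj_on_subset[OF inj_edges])
  then show ?thesis using assms card_edge by (auto simp: lll_witness_def img_def)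
qed

lemma time_bound_img: "time_bound img \<epsilon> x = time_bound \<Phi> \<epsilon> (\<lambda>C. x (f ` C))"
proof -
  have "(\<Sum>C'\<in>{C'\<in>edges img. f ` C \<inter> C' \<noteq> {}}. real (card C') * real (card (f ` C))) =
      (\<Sum>C'\<in>{C'\<in>edges \<Phi>. C \<inter> C' \<noteq> {}}. real (card C') * real (card C))" if C: "C \<in> edges \<Phi>" for C
  proof -
    have "{C'\<in>edges img. f ` C \<inter> C' \<noteq> {}} = (`) f ` {C'\<in>edges \<Phi>. C \<inter> C' \<noteq> {}}"
      using C meets by (auto simp: img_def)
    then show ?thesis
      using C by (simp add: sum.reindex[OF inj_on_subset[OF inj_edges]] card_edge)
  qed
  then have "(\<Sum>C\<in>edges img. \<Sum>C'\<in>{C'\<in>edges img. C \<inter> C' \<noteq> {}}. real (card C') * real (card C)) =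
      (\<Sum>C\<in>edges \<Phi>. \<Sum>C'\<in>{C'\<in>edges \<Phi>. C \<inter> C' \<noteq> {}}. real (card C') * real (card C))"
    by (subst (1) img_def) (simp add: sum.reindex[OF inj_edges])
  moreover have "(\<Sum>C\<in>edges img. x C / (1 - x C)) = (\<Sum>C\<in>edges \<Phi>. x (f ` C) / (1 - x (f ` C)))"
    by (simp add: img_def sum.reindex[OF inj_edges])
  ultimately show ?thesis by (simp add: time_bound_def)
qed

lemma isolated_img: "card (isolated_verts img) = card (isolated_verts \<Phi>)"
proof -
  have "isolated_verts img = f ` isolated_verts \<Phi>"
    using inj_on_image_set_diff[OF inj, of "verts \<Phi>" "\<Union>(edges \<Phi>)"] sub
    by (simp add: isolated_verts_def img_def image_Union) blast
  then show ?thesis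
    using card_image[OF inj_on_subset[OF inj, of "isolated_verts \<Phi>"]] by (simp add: isolated_verts_def)
qed

lemma independent_img:
  assumes "Y \<subseteq> verts \<Phi>" shows "independent_set img (f ` Y) \<longleftrightarrow> independent_set \<Phi> Y"
  using assms inj_on_image_subset_iff[OF inj sub assms] by (auto simp: independent_set_def img_def)

lemma pmf_independent_img:
  assumes \<Phi>: "hypergraph \<Phi>" and Y: "Y \<subseteq> verts \<Phi>"
  shows "pmf (pmf_of_set {I. independent_set img I}) (f ` Y) = pmf (pmf_of_set {I. independent_set \<Phi> I}) Y"
proof -
  have eq: "{I. independent_set img I} = (`) f ` {I. independent_set \<Phi> I}"
  proof (intro set_eqI iffI)
    fix I assume I: "I \<in> {I. independent_set img I}"
    then have "I \<subseteq> f ` verts \<Phi>" by (simp add: independent_set_def img_def)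
    then obtain Z where "Z \<subseteq> verts \<Phi>" "I = f ` Z" by (auto simp: subset_image_iff)
    then show "I \<in> (`) f ` {I. independent_set \<Phi> I}" using I independent_img by auto
  next
    fix I assume "I \<in> (`) f ` {I. independent_set \<Phi> I}"
    then obtain Z where "independent_set \<Phi> Z" "I = f ` Z" by auto
    moreover from this have "Z \<subseteq> verts \<Phi>" by (simp add: independent_set_def)
    ultimately show "I \<in> {I. independent_set img I}" using independent_img by auto
  qed
  have "inj_on ((`) f) {I. independent_set \<Phi> I}"
    by (rule inj_on_subset[OF inj_on_image_Pow[OF inj]]) (auto simp: independent_set_def)
  then have card: "card {I. independent_set img I} = card {I. independent_set \<Phi> I}"
    unfolding eq by (rule card_image)
  have fin: "finite {I. independent_set \<Phi> I}" "{I. independent_set \<Phi> I} \<noteq> {}"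
    using finite_independent[OF \<Phi>] independent_empty[OF \<Phi>] by auto
  then have "finite {I. independent_set img I}" "{I. independent_set img I} \<noteq> {}" unfolding eq by auto
  then show ?thesis using fin card independent_img[OF Y] by (simp add: indicator_def)
qed

end

theorem theorem1p1:
  "\<exists>(P :: com) (K :: real). \<forall>\<Phi> \<in> (lll_hypergraphs :: nat hypergraph set).
     \<forall>vs es. represents vs es \<Phi> \<longrightarrow>
       (\<forall>S. output_prob P vs es S = pmf (pmf_of_set {I. independent_set \<Phi> I}) S) \<and>
       (\<forall>\<epsilon> x. lll_witness \<Phi> \<epsilon> x \<longrightarrow>
          expected_time P (encode (length vs) es)
            \<le> ennreal (K * (time_bound \<Phi> \<epsilon> x + real (card (isolated_verts \<Phi>)) + 1)))"
proof (intro exI[of _ sampler] exI[of _ "10000 :: real"] ballI allI impI)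
  fix \<Phi> :: "nat hypergraph" and vs :: "nat list" and es :: "nat list list"
  assume "\<Phi> \<in> lll_hypergraphs" and rep: "represents vs es \<Phi>"
  then obtain \<epsilon>0 x0 where \<Phi>: "hypergraph \<Phi>" and w0: "lll_witness \<Phi> \<epsilon>0 x0" by (auto simp: lll_hypergraphs_def)
  let ?n = "length vs" and ?f = "(!) vs"
  have vs: "distinct vs" "set vs = verts \<Phi>" and es: "\<And>e. e \<in> set es \<Longrightarrow> distinct e \<and> set e \<subseteq> {..<?n}"
    and de: "distinct (map set es)" and ed: "(\<lambda>e. ?f ` set e) ` set es = edges \<Phi>"
    using rep by (auto simp: represents_def)
  interpret hypergraph_input ?n es "length (encode ?n es) + ?n"
  proof
    show "distinct e \<and> set e \<subseteq> {..<?n}" if "e \<in> set es" for e using es[OF that] .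
    \<comment> \<open>An empty list would represent an empty hyperedge.\<close>
    show "e \<noteq> []" if "e \<in> set es" for e
    proof
      assume "e = []"
      then have "{} \<in> edges \<Phi>" using ed that by force
      then show False using \<Phi> by (auto simp: hypergraph_def)
    qed
  qed (use de in auto)
  have injf: "inj_on ?f {..<?n}" using vs(1) by (auto simp: inj_on_def nth_eq_iff_index_eq)
  interpret renaming hg ?f
    by unfold_locales (use injf hypergraph_hg in \<open>auto simp: hypergraph_def\<close>)
  have img: "img = \<Phi>"
  proof -
    have "?f ` {..<?n} = verts \<Phi>" using vs(2) by (auto simp: set_conv_nth)
    moreover have "(`) ?f ` Es = edges \<Phi>" using ed by (simp add: Es_def image_image)
    ultimately show ?thesis by (simp add: img_def prod_eq_iff)
  qed
  have out: "output_set vs s = ?f ` result s" for s by (auto simp: output_set_def result_def)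
  have res: "result s \<subseteq> {..<?n}" for s by (auto simp: result_def)
  show "(\<forall>S. output_prob sampler vs es S = pmf (pmf_of_set {I. independent_set \<Phi> I}) S) \<and>
    (\<forall>\<epsilon> x. lll_witness \<Phi> \<epsilon> x \<longrightarrow> expected_time sampler (encode ?n es)
       \<le> ennreal (10000 * (time_bound \<Phi> \<epsilon> x + real (card (isolated_verts \<Phi>)) + 1)))"
  proof (intro conjI allI impI)
    fix S
    show "output_prob sampler vs es S = pmf (pmf_of_set {I. independent_set \<Phi> I}) S"
    proof (cases "S \<subseteq> verts \<Phi>")
      case True
      then have "S \<subseteq> ?f ` {..<?n}" using img by (metis fst_conv hg_simps(1) img_def)
      then obtain Y where Y: "Y \<subseteq> {..<?n}" "S = ?f ` Y" by (auto simp: subset_image_iff)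
      have "output_set vs s = S \<longleftrightarrow> result s = Y" for s
        unfolding out Y(2) by (rule inj_on_image_eq_iff[OF injf res Y(1)])
      then have "output_prob sampler vs es S =
          coin.prob {\<omega>. \<exists>t s. exec sampler (init_state input \<omega>) t s \<and> result s = Y}"
        by (simp add: output_prob_def)
      also have "\<dots> = pmf (pmf_of_set {I. independent_set hg I}) Y"
        by (rule sampler_output[OF lll_witness_img]) (use w0 img in simp)
      also have "\<dots> = pmf (pmf_of_set {I. independent_set \<Phi> I}) S"
        using pmf_independent_img[OF hypergraph_hg, of Y] Y img by simp
      finally show ?thesis .
    next
      case False
      \<comment> \<open>The output always consists of vertices, so both probabilities vanish for any
        other \<open>S\<close>.\<close>
      have "?f ` result s \<noteq> S" for s
      proof
        assume "?f ` result s = S"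
        moreover have "?f ` result s \<subseteq> set vs" using res[of s] by auto
        ultimately show False using False vs(2) by simp
      qed
      then have "output_prob sampler vs es S = 0" by (simp add: output_prob_def out)
      moreover have "\<not> independent_set \<Phi> S" using False by (simp add: independent_set_def)
      then have "pmf (pmf_of_set {I. independent_set \<Phi> I}) S = 0"
        using finite_independent[OF \<Phi>] independent_empty[OF \<Phi>] by (subst pmf_of_set) auto
      ultimately show ?thesis by simp
    qed
  next
    fix \<epsilon> x assume w: "lll_witness \<Phi> \<epsilon> x"
    have "lll_witness hg \<epsilon> (\<lambda>C. x (?f ` C))" by (rule lll_witness_img) (use w img in simp)
    from sampler_time[OF this]
    show "expected_time sampler (encode ?n es)
       \<le> ennreal (10000 * (time_bound \<Phi> \<epsilon> x + real (card (isolated_verts \<Phi>)) + 1))"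
      using time_bound_img[of \<epsilon> x] isolated_img img by simp
  qed
qed

end
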